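(* Let $d\ge2$, let $D\subseteq\mathbb{R}^d$ be a convex domain, let $T>0$, let $A$ be a constant symmetric positive definite $d\times d$ matrix, let $g\in\mathbb{R}^d$ be a constant vector, and let $z_0\in D$. Then the law on $C([0,T],\mathbb{R}^d)$ of the reflected Brownian motion in $D$ with drift $g$ and diffusion matrix $A$, starting from $z_0$, satisfies $T_2(C)$ with $C=T\|A\|$.
   Context: Transportation-cost inequality. For Borel probability measures $\mathbb{P},\mathbb{Q}$ on a metric space $(E,\rho)$, $W_2(\mathbb{P},\mathbb{Q}):=\inf_\pi\left[\iint\rho^2(x,y)\,d\pi(x,y)\right]^{1/2}$, the infimum being over all couplings $\pi$ of $\mathbb{P}$ and $\mathbb{Q}$. The relative entropy is $\mathcal{H}(\mathbb{Q}\mid\mathbb{P}):=\int\log\frac{d\mathbb{Q}}{d\mathbb{P}}\,d\mathbb{Q}$ if $\mathbb{Q}\ll\mathbb{P}$, and $+\infty$ otherwise. $\mathbb{P}$ satisfies $T_2(C)$ if $W_2(\mathbb{P},\mathbb{Q})\le\sqrt{2C\,\mathcal{H}(\mathbb{Q}\mid\mathbb{P})}$ for every Borel probability measure $\mathbb{Q}$ on $E$. The space $C([0,T],\mathbb{R}^d)$ of continuous functions is equipped with the metric induced by $\|x\|:=\sup_{0\le t\le T}\|x(t)\|$, where $\|x(t)\|$ is the Euclidean norm. The matrix norm is $\|A\|:=\max_{\|x\|=1}\|Ax\|$. Domains and normals. A domain in $\mathbb{R}^d$ is the closure of an open connected subset; no smoothness of the boundary is assumed. For a convex domain $D$ and $x\in\partial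 D$, $\mathcal{N}(x)$ is the set of inward unit normal vectors at $x$: all unit vectors $y\in\mathbb{R}^d$ such that $(z-x)\cdot y\ge0$ for every $z\in D$. Reflected Brownian motion. The reflected Brownian motion in $D$ with constant drift $g\in\mathbb{R}^d$ and diffusion matrix $A$, starting from $z_0\in D$, is the continuous adapted $D$-valued process $Z$ satisfying $$Z(t)=z_0+W(t)+gt+\int_0^t\mathbf{n}(s)\,d\ell(s),$$ where $W$ is a $d$-dimensional Brownian motion started from the origin with zero drift and covariance matrix $A$ (so $W(t)$ has covariance $tA$); $\mathbf{n}$ is a measurable function of time whose values are unit vectors in $\mathbb{R}^d$; $\ell$ is a real-valued continuous nondecreasing process (with $\ell(0)=0$) that can increase only when $Z(t)\in\partial D$; and for such $t$, $\mathbf{n}(t)\in\mathcal{N}(Z(t))$. This equation has a pathwise unique strong solution. *)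

theory Defs
  imports "HOL-Probability.Probability"
begin

section \<open>Transportation-cost inequalities\<close>

definition mborel :: "'a metric \<Rightarrow> 'a measure" where
  "mborel m = sigma (mspace m) {U. openin (mtopology_of m) U}"

definition borel_probs :: "'a metric \<Rightarrow> 'a measure set" where
  "borel_probs m = {P. prob_space P \<and> sets P = sets (mborel m)}"

text \<open>Couplings live on the product \<open>\<sigma>\<close>-algebra, which is the Borel \<open>\<sigma>\<close>-algebra of the product
  whenever the metric space is separable, as the path spaces below are.\<close>

definition couplings :: "'a measure \<Rightarrow> 'a measure \<Rightarrow> ('a \<times> 'a) measure set" where
  "couplings P Q = {\<pi>. prob_space \<pi> \<and> sets \<pi> = sets (P \<Otimes>\<^sub>M Q) \<and> distr \<pi> P fst = P \<and> distr \<pi> Q snd = Q}"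

definition ennreal_sqrt :: "ennreal \<Rightarrow> ennreal" where
  "ennreal_sqrt x = (if x = \<top> then \<top> else ennreal (sqrt (enn2real x)))"

definition W2 :: "'a metric \<Rightarrow> 'a measure \<Rightarrow> 'a measure \<Rightarrow> ennreal" where
  "W2 m P Q = (INF \<pi>\<in>couplings P Q. ennreal_sqrt (\<integral>\<^sup>+ (x, y). ennreal ((mdist m x y)\<^sup>2) \<partial>\<pi>))"

text \<open>For \<open>Q \<lless> P\<close> the negative part of \<open>ln (dQ/dP)\<close> is always \<open>Q\<close>-integrable, so that failure of
  integrability means that the integral is \<open>+\<infinity>\<close>; the Bochner integral in \<^const>\<open>KL_divergence\<close>
  would be \<open>0\<close> there. The passage to \<^typ>\<open>ennreal\<close> loses nothing, as the divergence is nonnegative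
  between probability measures.\<close>

definition relative_entropy :: "'a measure \<Rightarrow> 'a measure \<Rightarrow> ennreal" where
  "relative_entropy Q P =
     (if absolutely_continuous P Q \<and> integrable Q (entropy_density (exp 1) P Q)
      then ennreal (KL_divergence (exp 1) P Q) else \<top>)"

definition T2_inequality :: "'a metric \<Rightarrow> real \<Rightarrow> 'a measure \<Rightarrow> bool" where
  "T2_inequality m C P \<longleftrightarrow>
     P \<in> borel_probs m \<and>
     (\<forall>Q\<in>borel_probs m. W2 m P Q \<le> ennreal_sqrt (ennreal (2 * C) * relative_entropy Q P))"

text \<open>The space \<open>C([0,T], \<real>\<^sup>d)\<close> with the supremum metric; its points are extensional, that is
  \<open>undefined\<close> outside of \<open>[0,T]\<close>.\<close>

definition path_space :: "real \<Rightarrow> (real \<Rightarrow> real ^ 'n) metric" where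
  "path_space T = cfunspace (top_of_set {0..T}) euclidean_metric"


section \<open>Domains and inward normals\<close>

definition is_domain :: "(real ^ 'n) set \<Rightarrow> bool" where
  "is_domain D \<longleftrightarrow> (\<exists>U. open U \<and> connected U \<and> D = closure U)"

definition inward_normals :: "(real ^ 'n) set \<Rightarrow> real ^ 'n \<Rightarrow> (real ^ 'n) set" where
  "inward_normals D x = {y. norm y = 1 \<and> (\<forall>z\<in>D. 0 \<le> (z - x) \<bullet> y)}"


section \<open>Reflected Brownian motion\<close>

definition positive_definite :: "real ^ 'n ^ 'n \<Rightarrow> bool" where
  "positive_definite A \<longleftrightarrow> (\<forall>x. x \<noteq> 0 \<longrightarrow> 0 < x \<bullet> (A *v x))"

definition mvnormal_density :: "real ^ 'n ^ 'n \<Rightarrow> real ^ 'n \<Rightarrow> real" where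
  "mvnormal_density S x =
     exp (- (x \<bullet> (matrix_inv S *v x)) / 2) / sqrt ((2 * pi) ^ CARD('n) * det S)"

text \<open>Time is \<open>[0,\<infinity>)\<close>; the members of the filtration at negative times are irrelevant.\<close>

locale brownian_motion = prob_space M + filtration "space M" F
  for M :: "'w measure" and F :: "real \<Rightarrow> 'w measure" +
  fixes A :: "real ^ 'n ^ 'n" and W :: "real \<Rightarrow> 'w \<Rightarrow> real ^ 'n"
  assumes subalgebra_F: "\<And>t. 0 \<le> t \<Longrightarrow> subalgebra M (F t)"
    and W_adapted: "\<And>t. 0 \<le> t \<Longrightarrow> W t \<in> borel_measurable (F t)"
    and W_start: "AE \<omega> in M. W 0 \<omega> = 0"
    and W_continuous: "AE \<omega> in M. continuous_on {0..} (\<lambda>t. W t \<omega>)"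
    and W_gaussian: "\<And>s t. 0 \<le> s \<Longrightarrow> s < t \<Longrightarrow>
      distributed M lborel (\<lambda>\<omega>. W t \<omega> - W s \<omega>) (\<lambda>x. ennreal (mvnormal_density ((t - s) *\<^sub>R A) x))"
    and W_indep: "\<And>s t. 0 \<le> s \<Longrightarrow> s < t \<Longrightarrow>
      indep_set (sets (F s)) (sets (vimage_algebra (space M) (\<lambda>\<omega>. W t \<omega> - W s \<omega>) borel))"

text \<open>The Lebesgue-Stieltjes measure \<open>d\<ell>\<close> of a path \<open>\<ell>\<close> on \<open>[0,\<infinity>)\<close>, as a measure on the whole line
  that does not charge the negative times.\<close>

definition stieltjes :: "(real \<Rightarrow> real) \<Rightarrow> real measure" where
  "stieltjes l = interval_measure (\<lambda>s. l (max 0 s))"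

text \<open>Almost surely, \<open>d\<ell>\<close> is carried by the times at which \<open>Z\<close> is in the boundary and \<open>n\<close> is an
  inward normal there. Neither \<open>n\<close> nor the normal direction is required to be unique.\<close>

locale reflected_brownian_motion = brownian_motion M F A W
  for M :: "'w measure" and F :: "real \<Rightarrow> 'w measure"
    and A :: "real ^ 'n ^ 'n" and W :: "real \<Rightarrow> 'w \<Rightarrow> real ^ 'n" +
  fixes D :: "(real ^ 'n) set" and g z0 :: "real ^ 'n"
    and Z :: "real \<Rightarrow> 'w \<Rightarrow> real ^ 'n"
    and n :: "real \<Rightarrow> 'w \<Rightarrow> real ^ 'n"
    and l :: "real \<Rightarrow> 'w \<Rightarrow> real"
  assumes Z_adapted: "\<And>t. 0 \<le> t \<Longrightarrow> Z t \<in> borel_measurable (F t)"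
    and Z_continuous: "\<And>\<omega>. \<omega> \<in> space M \<Longrightarrow> continuous_on {0..} (\<lambda>t. Z t \<omega>)"
    and Z_in_D: "\<And>\<omega> t. \<omega> \<in> space M \<Longrightarrow> 0 \<le> t \<Longrightarrow> Z t \<omega> \<in> D"
    and l_measurable: "\<And>t. 0 \<le> t \<Longrightarrow> l t \<in> borel_measurable M"
    and l_start: "AE \<omega> in M. l 0 \<omega> = 0"
    and l_continuous: "AE \<omega> in M. continuous_on {0..} (\<lambda>t. l t \<omega>)"
    and l_nondecreasing: "AE \<omega> in M. mono_on {0..} (\<lambda>t. l t \<omega>)"
    and n_measurable: "AE \<omega> in M. set_borel_measurable borel {0..} (\<lambda>t. n t \<omega>)"
    and n_unit: "AE \<omega> in M. \<forall>t\<ge>0. norm (n t \<omega>) = 1"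
    and reflection: "AE \<omega> in M. AE t in stieltjes (\<lambda>t. l t \<omega>).
      Z t \<omega> \<in> frontier D \<and> n t \<omega> \<in> inward_normals D (Z t \<omega>)"
    and equation: "AE \<omega> in M. \<forall>t\<ge>0.
      Z t \<omega> = z0 + W t \<omega> + t *\<^sub>R g + (LINT s:{0..t}|stieltjes (\<lambda>s. l s \<omega>). n s \<omega>)"

definition path_law :: "'w measure \<Rightarrow> real \<Rightarrow> (real \<Rightarrow> 'w \<Rightarrow> real ^ 'n) \<Rightarrow> (real \<Rightarrow> real ^ 'n) measure" where
  "path_law M T Z = distr M (mborel (path_space T)) (\<lambda>\<omega>. restrict (\<lambda>t. Z t \<omega>) {0..T})"

end

theory Submission
  imports Defs
begin

text \<open>By duality, \<open>T\<^sub>2(C)\<close> follows from the inequality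
  \<open>\<integral> exp \<psi> dP \<le> exp (\<integral> \<phi> dP)\<close> for all bounded continuous \<open>\<phi>\<close>, \<open>\<psi>\<close> with
  \<open>\<psi> x - \<phi> y \<le> \<rho>(x, y)\<^sup>2 / (2C)\<close>: the Gibbs variational principle bounds
  \<open>\<integral> \<psi> dQ - \<integral> \<phi> dP\<close> by the relative entropy, and Kantorovich duality, which is only needed
  for finitely many points after a quantization of the space, turns this into a coupling.

  The dual inequality holds for the standard Gaussian on the line by a special case of the
  Prekopa-Leindler inequality, it tensorizes, it passes to images under Lipschitz maps, and unlike \<open>T\<^sub>2\<close>
  itself it passes to limits trivially. So it suffices to approximate \<open>Z\<close> almost surely by
  functions of the increments of \<open>W\<close> over a grid with \<open>N\<close> steps. Take the scheme that adds the increment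
  of \<open>W(t) + gt\<close> and projects to \<open>D\<close>. Projections are contractions, so two runs differ at any
  time by at most the sum of the norms of the differences of the increments, that is, by at most
  \<open>\<surd>N\<close> times the Euclidean distance of the increments; these have covariance \<open>(T/N)A\<close>, whence the
  constant \<open>T\<parallel>A\<parallel>\<close>. Convexity of \<open>D\<close> bounds the squared distance of the scheme to \<open>Z\<close> by
  \<open>2\<ell>(T)\<close> times the modulus of continuity of \<open>Z\<close> at \<open>T/N\<close>.\<close>

section \<open>Infimum convolution inequalities for Gaussian measures\<close>

text \<open>The constant comes from the Cameron-Martin norm. Reflection is not controlled here in
  the supremum norm of the driving path, but in the variation of the difference of two drivers,
  which over \<open>[0,T]\<close> is at most \<open>sqrt T\<close> times the Cameron-Martin norm of
  that difference. The bound by increments over a grid is the discrete form of this fact, and so it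
  survives refinement.

  The dual form passes to limits because it only involves integrals of bounded continuous functions
  against a single law. For \<open>T2_inequality\<close> itself, every competitor \<open>Q\<close>
  would have to be approximated with control of its entropy relative to the approximating laws.

  The price is paid on the way back to couplings. The squared distance is unbounded, so quantization
  requires finite second moments of \<open>P\<close> and of \<open>Q\<close>; both are extracted
  from the dual inequality.

  The scheme only produces values at grid points. They are extended to paths by Bernstein
  polynomials: each value is an average of the node values, so the extension is a contraction. The
  same operator shows that the path space is separable.\<close>

lemma nn_integral_layer_cake:
  fixes u :: "'a \<Rightarrow> real"
  assumes "sigma_finite_measure M" and [measurable]: "u \<in> borel_measurable M"
  shows "(\<integral>\<^sup>+x. ennreal (u x) \<partial>M) =
    (\<integral>\<^sup>+r. indicator {0<..} r * emeasure M {x \<in> space M. r < u x} \<partial>lborel)"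
proof -
  interpret sigma_finite_measure M by fact
  interpret pair_sigma_finite M lborel ..
  have *: "ennreal (u x) = (\<integral>\<^sup>+r. indicator {0<..<u x} r \<partial>lborel)" for x
  proof (cases "0 \<le> u x")
    case False
    then have "{0<..<u x} = {}" by auto
    with False show ?thesis by (simp add: ennreal_neg)
  qed auto
  have "(\<integral>\<^sup>+x. ennreal (u x) \<partial>M) =
      (\<integral>\<^sup>+x. (\<integral>\<^sup>+r. indicator {0<..} r * indicator {r. r < u x} r \<partial>lborel) \<partial>M)"
    unfolding * by (intro nn_integral_cong) (auto split: split_indicator)
  also have "\<dots> = (\<integral>\<^sup>+r. (\<integral>\<^sup>+x. indicator {0<..} r * indicator {r. r < u x} r \<partial>M) \<partial>lborel)"
    by (rule Fubini'[symmetric]) measurable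
  also have "\<dots> = (\<integral>\<^sup>+r. indicator {0<..} r * emeasure M {x \<in> space M. r < u x} \<partial>lborel)"
  proof (intro nn_integral_cong)
    fix r
    have "(\<integral>\<^sup>+x. indicator {0<..} r * indicator {r. r < u x} r \<partial>M) =
      (\<integral>\<^sup>+x. indicator {0<..} r * indicator {x\<in>space M. r < u x} x \<partial>M)"
      by (intro nn_integral_cong) (auto split: split_indicator)
    also have "\<dots> = indicator {0<..} r * emeasure M {x \<in> space M. r < u x}"
      by (subst nn_integral_cmult) auto
    finally show "(\<integral>\<^sup>+x. indicator {0<..} r * indicator {r. r < u x} r \<partial>M) = 
      indicator {0<..} r * emeasure M {x \<in> space M. r < u x}" .
  qed
  finally show ?thesis .
qed

text \<open>An interval containing \<open>tA + (1-t)B\<close> is at least as long as the combination of the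
  diameters of \<open>A\<close> and \<open>B\<close>, so no Brunn-Minkowski inequality is needed.\<close>

lemma emeasure_interval_convex_combination:
  fixes A B I :: "real set"
  assumes [measurable]: "A \<in> sets borel" "B \<in> sets borel" "I \<in> sets borel"
    and ne: "A \<noteq> {}" "B \<noteq> {}" and I: "is_interval I" and t: "0 < t" "t < 1"
    and sub: "\<And>x y. x \<in> A \<Longrightarrow> y \<in> B \<Longrightarrow> t * x + (1 - t) * y \<in> I"
  shows "t * emeasure lborel A + ennreal (1 - t) * emeasure lborel B \<le> emeasure lborel I"
proof (cases "emeasure lborel I = \<top>")
  case False
  then obtain m where m: "0 \<le> m" "emeasure lborel I = ennreal m"
    by (metis ennreal_cases)
  have seg: "q - p \<le> m" if "p \<in> I" "q \<in> I" for p q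
  proof (cases "p \<le> q")
    case True
    have "{p..q} \<subseteq> I"
      using mem_is_interval_1_I[OF I that] by auto
    then have "emeasure lborel {p..q} \<le> emeasure lborel I"
      by (intro emeasure_mono) auto
    with True m show ?thesis by (simp)
  qed (use m in auto)
  \<comment> \<open>Both combinations lie in the interval of length \<open>m\<close>. With one pair
    frozen at a point of its set, this bounds the other set.\<close>
  have diff: "t * (x - x') + (1 - t) * (y - y') \<le> m"
    if "x \<in> A" "x' \<in> A" "y \<in> B" "y' \<in> B" for x x' y y'
    using seg[OF sub[OF that(2,4)] sub[OF that(1,3)]] by (simp add: algebra_simps)
  obtain a0 b0 where a0: "a0 \<in> A" and b0: "b0 \<in> B" using ne by auto
  have bA: "x \<le> a0 + m / t" "a0 - m / t \<le> x" if "x \<in> A" for x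
    using diff[OF that a0 b0 b0] diff[OF a0 that b0 b0] t by (auto simp: field_simps)
  have bB: "x \<le> b0 + m / (1-t)" "b0 - m / (1-t) \<le> x" if "x \<in> B" for x
    using diff[OF a0 a0 that b0] diff[OF a0 a0 b0 that] t by (auto simp: field_simps)
  have bdd: "bdd_above A" "bdd_below A" "bdd_above B" "bdd_below B"
    by (rule bdd_aboveI bdd_belowI, erule bA bB)+
  have "t * (Sup A - Inf A) + (1 - t) * (Sup B - Inf B) \<le> m"
  proof (rule field_le_epsilon)
    \<comment> \<open>Each of the four points misses its extremum by less than \<open>e/2\<close>,
      so each difference loses at most \<open>e\<close>; the weights add up to one.\<close>
    fix e :: real assume e: "0 < e"
    obtain x where x: "x \<in> A" "Sup A - e/2 < x"
      using less_cSup_iff[OF ne(1) bdd(1), of "Sup A - e/2"] e by auto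
    obtain x' where x': "x' \<in> A" "x' < Inf A + e/2"
      using cInf_less_iff[OF ne(1) bdd(2), of "Inf A + e/2"] e by auto
    obtain y where y: "y \<in> B" "Sup B - e/2 < y"
      using less_cSup_iff[OF ne(2) bdd(3), of "Sup B - e/2"] e by auto
    obtain y' where y': "y' \<in> B" "y' < Inf B + e/2"
      using cInf_less_iff[OF ne(2) bdd(4), of "Inf B + e/2"] e by auto
    have "t * (Sup A - Inf A) \<le> t * (x - x' + e)"
      using x x' t by (intro mult_left_mono) auto
    moreover have "(1-t) * (Sup B - Inf B) \<le> (1-t) * (y - y' + e)"
      using y y' t by (intro mult_left_mono) auto
    ultimately show "t * (Sup A - Inf A) + (1 - t) * (Sup B - Inf B) \<le> m + e"
      using diff[OF x(1) x'(1) y(1) y'(1)] by (simp add: algebra_simps)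
  qed
  moreover have "Inf A \<le> Sup A" "Inf B \<le> Sup B"
    using cInf_lower[OF a0 bdd(2)] cSup_upper[OF a0 bdd(1)] cInf_lower[OF b0 bdd(4)] cSup_upper[OF b0 bdd(3)] by linarith+
  moreover have "emeasure lborel A \<le> ennreal (Sup A - Inf A)"
  proof -
    have "emeasure lborel A \<le> emeasure lborel {Inf A..Sup A}"
      using cInf_lower[OF _ bdd(2)] cSup_upper[OF _ bdd(1)] by (intro emeasure_mono) auto
    then show ?thesis using \<open>Inf A \<le> Sup A\<close> by simp
  qed
  moreover have "emeasure lborel B \<le> ennreal (Sup B - Inf B)"
  proof -
    have "emeasure lborel B \<le> emeasure lborel {Inf B..Sup B}"
      using cInf_lower[OF _ bdd(4)] cSup_upper[OF _ bdd(3)] by (intro emeasure_mono) auto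
    then show ?thesis using \<open>Inf B \<le> Sup B\<close> by simp
  qed
  ultimately have "t * emeasure lborel A + ennreal (1 - t) * emeasure lborel B \<le>
     ennreal t * ennreal (Sup A - Inf A) + ennreal (1 - t) * ennreal (Sup B - Inf B)"
    using t by (intro add_mono mult_left_mono) (auto)
  also have "\<dots> = ennreal (t * (Sup A - Inf A) + (1 - t) * (Sup B - Inf B))"
    using t \<open>Inf A \<le> Sup A\<close> \<open>Inf B \<le> Sup B\<close>
    by (subst ennreal_plus) (auto simp: ennreal_mult simp del: ennreal_plus)
  also have "\<dots> \<le> ennreal m"
    using \<open>t * (Sup A - Inf A) + (1 - t) * (Sup B - Inf B) \<le> m\<close> by (rule ennreal_leI)
  finally show ?thesis using m by simp
qed simp

text \<open>With both suprema equal to 1, the superlevel sets of \<open>u\<close> and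
  \<open>v\<close> are nonempty at exactly the same levels below 1, so the interval lemma applies at
  every level in \<open>(0,1)\<close>. From level 1 on, the left side vanishes. Integration over the
  levels yields an arithmetic mean of the integrals.\<close>

lemma prekopa_leindler_normalized:
  fixes u v h :: "real \<Rightarrow> real"
  assumes [measurable]: "u \<in> borel_measurable borel" "v \<in> borel_measurable borel" "h \<in> borel_measurable borel"
    and u: "\<And>x. u x \<le> 1" "\<And>r. r < 1 \<Longrightarrow> \<exists>x. r < u x"
    and v: "\<And>x. v x \<le> 1" "\<And>r. r < 1 \<Longrightarrow> \<exists>x. r < v x"
    and h: "\<And>r. is_interval {z. r < h z}" and t: "0 < t" "t < 1"
    and le: "\<And>r x y. 0 < r \<Longrightarrow> r < u x \<Longrightarrow> r < v y \<Longrightarrow> r < h (t * x + (1 - t) * y)"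
  shows "t * (\<integral>\<^sup>+x. u x \<partial>lborel) + ennreal (1 - t) * (\<integral>\<^sup>+x. v x \<partial>lborel) \<le> (\<integral>\<^sup>+x. h x \<partial>lborel)"
proof -
  have sf: "sigma_finite_measure (lborel :: real measure)" ..
  have lc: "(\<integral>\<^sup>+x. ennreal (f x) \<partial>lborel) =
    (\<integral>\<^sup>+r. indicator {0<..} r * emeasure lborel {x. r < f x} \<partial>lborel)"
    if "f \<in> borel_measurable borel" for f :: "real \<Rightarrow> real"
    using nn_integral_layer_cake[OF sf, of f] that by simp
  have [measurable]: "(\<lambda>r. emeasure lborel {x. r < f x}) \<in> borel_measurable borel"
    if [measurable]: "f \<in> borel_measurable borel" for f :: "real \<Rightarrow> real"
    by measurable
  have pw: "t * (indicator {0<..} r * emeasure lborel {x. r < u x}) +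
      ennreal (1 - t) * (indicator {0<..} r * emeasure lborel {x. r < v x})
     \<le> indicator {0<..} r * emeasure lborel {x. r < h x}" for r :: real
  proof (cases "0 < r \<and> r < 1")
    case True
    have "t * emeasure lborel {x. r < u x} + ennreal (1 - t) * emeasure lborel {x. r < v x}
       \<le> emeasure lborel {x. r < h x}"
    proof (rule emeasure_interval_convex_combination)
      show "{x. r < u x} \<noteq> {}" "{x. r < v x} \<noteq> {}" using u(2) v(2) True by auto
    qed (use t h le True in auto)
    with True show ?thesis by simp
  next
    case False
    show ?thesis
    proof (cases "0 < r")
      case True
      with False have "{x. r < u x} = {}" "{x. r < v x} = {}"
        using u(1) v(1) by (metis (no_types, lifting) Collect_empty_eq leD less_le_trans not_le_imp_less)+
      then show ?thesis by simp
    qed simp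
  qed
  have "t * (\<integral>\<^sup>+x. u x \<partial>lborel) + ennreal (1 - t) * (\<integral>\<^sup>+x. v x \<partial>lborel) =
     (\<integral>\<^sup>+r. t * (indicator {0<..} r * emeasure lborel {x. r < u x}) +
      ennreal (1 - t) * (indicator {0<..} r * emeasure lborel {x. r < v x}) \<partial>lborel)"
    by (subst lc, simp, subst lc, simp) (subst nn_integral_add; simp add: nn_integral_cmult)
  also have "\<dots> \<le> (\<integral>\<^sup>+r. indicator {0<..} r * emeasure lborel {x. r < h x} \<partial>lborel)"
    by (intro nn_integral_mono pw)
  also have "\<dots> = (\<integral>\<^sup>+x. h x \<partial>lborel)" by (subst lc) auto
  finally show ?thesis .
qed

text \<open>Dividing \<open>u\<close>, \<open>v\<close> by their suprema and \<open>h\<close> by the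
  corresponding product of powers reduces to the normalized case; weighted AM-GM then turns the
  arithmetic mean into the product. Quasiconcavity of \<open>h\<close> makes its superlevel sets
  intervals, which holds for the Gaussian density.\<close>

lemma prekopa_leindler_quasiconcave:
  fixes u v h :: "real \<Rightarrow> real"
  assumes [measurable]: "u \<in> borel_measurable borel" "v \<in> borel_measurable borel" "h \<in> borel_measurable borel"
    and u: "\<And>x. 0 < u x" "bdd_above (range u)" "integrable lborel u"
    and v: "\<And>x. 0 < v x" "bdd_above (range v)" "integrable lborel v"
    and h: "\<And>r. is_interval {z. r < h z}" "\<And>x. 0 \<le> h x" "integrable lborel h"
    and t: "0 < t" "t < 1"
    and le: "\<And>x y. u x powr t * v y powr (1 - t) \<le> h (t * x + (1 - t) * y)"
  shows "(\<integral>x. u x \<partial>lborel) powr t * (\<integral>x. v x \<partial>lborel) powr (1 - t) \<le> (\<integral>x. h x \<partial>lborel)"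
proof -
  define a b where "a = (SUP x. u x)" and "b = (SUP x. v x)"
  have ua: "u x \<le> a" for x unfolding a_def by (intro cSUP_upper u) auto
  have vb: "v x \<le> b" for x unfolding b_def by (intro cSUP_upper v) auto
  have a: "0 < a" and b: "0 < b" using u(1)[of 0] ua[of 0] v(1)[of 0] vb[of 0] by linarith+
  define c where "c = a powr t * b powr (1 - t)"
  have c: "0 < c" using a b by (simp add: c_def)
  have ex: "\<exists>x. r < w x / s" if w: "s = (SUP x. w x)" "0 < s" "bdd_above (range w)" "r < 1"
    for w :: "real \<Rightarrow> real" and s r
  proof -
    have "r * s < s" using that by simp
    then obtain x where "r * s < w x"
      using w less_cSUP_iff[of UNIV w "r * s"] by auto
    then show ?thesis using that by (intro exI[of _ x]) (simp add: field_simps)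
  qed
  have "t * (\<integral>\<^sup>+x. u x / a \<partial>lborel) + ennreal (1 - t) * (\<integral>\<^sup>+x. v x / b \<partial>lborel) \<le> (\<integral>\<^sup>+x. h x / c \<partial>lborel)"
  proof (rule prekopa_leindler_normalized)
    show "\<exists>x. r < u x / a" if "r < 1" for r using ex[OF a_def a u(2) that] .
    show "\<exists>x. r < v x / b" if "r < 1" for r using ex[OF b_def b v(2) that] .
    show "is_interval {z. r < h z / c}" for r
      using h(1)[of "r * c"] c by (simp add: field_simps)
    show "r < h (t * x + (1 - t) * y) / c" if "0 < r" "r < u x / a" "r < v y / b" for r x y
    proof -
      have "r = r powr t * r powr (1 - t)" using that t by (simp flip: powr_add)
      also have "\<dots> < (u x / a) powr t * (v y / b) powr (1 - t)"
        using that t by (intro mult_strict_mono powr_less_mono2) auto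
      also have "\<dots> = u x powr t * v y powr (1 - t) / c"
        using u(1)[of x] v(1)[of y] a b by (simp add: powr_divide c_def)
      also have "\<dots> \<le> h (t * x + (1 - t) * y) / c"
        using le c by (simp add: divide_right_mono)
      finally show ?thesis .
    qed
  qed (use ua vb a b t in \<open>auto\<close>)
  note PL = this
  have int: "(\<integral>\<^sup>+x. ennreal (w x / s) \<partial>lborel) = ennreal ((\<integral>x. w x \<partial>lborel) / s)"
    if "integrable lborel w" "\<And>x. 0 \<le> w x" "0 < s" for w :: "real \<Rightarrow> real" and s
    using that by (subst nn_integral_eq_integral) auto
  define U V H where "U = (\<integral>x. u x \<partial>lborel)" and "V = (\<integral>x. v x \<partial>lborel)" and "H = (\<integral>x. h x \<partial>lborel)"
  have U: "0 \<le> U" and V: "0 \<le> V" and H: "0 \<le> H"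
    unfolding U_def V_def H_def using u(1) v(1) h(2) by (auto intro!: integral_nonneg_AE simp: less_imp_le)
  have "ennreal t * ennreal (U / a) + ennreal (1 - t) * ennreal (V / b) \<le> ennreal (H / c)"
    using PL int[OF u(3) less_imp_le[OF u(1)] a] int[OF v(3) less_imp_le[OF v(1)] b] int[OF h(3) h(2) c]
    by (simp add: U_def V_def H_def)
  also have "ennreal t * ennreal (U / a) + ennreal (1 - t) * ennreal (V / b) = ennreal (t * (U / a) + (1 - t) * (V / b))"
    using t U V a b by (subst ennreal_plus) (auto simp flip: ennreal_mult simp del: ennreal_plus)
  finally have *: "t * (U / a) + (1 - t) * (V / b) \<le> H / c"
    using H c by (simp add: ennreal_le_iff)
  have "(U / a) powr t * (V / b) powr (1 - t) \<le> t * (U / a) + (1 - t) * (V / b)"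
  proof (cases "U = 0 \<or> V = 0")
    case True
    then show ?thesis using t U V a b by auto
  next
    case False
    then have "0 < U / a" "0 < V / b" using U V a b by auto
    then show ?thesis
      using Youngs_inequality_0[of t "1 - t" "U / a" "V / b"] t by auto
  qed
  also note *
  also have "(U / a) powr t * (V / b) powr (1 - t) = U powr t * V powr (1 - t) / c"
    using a b U V by (simp add: powr_divide c_def)
  finally show ?thesis using c by (simp add: U_def V_def H_def divide_le_cancel)
qed

text \<open>The dual form of a transportation-cost inequality. It is stated for pairs of functions, because the
  infimum convolution \<open>inf y. \<phi> y + c x y\<close> of a measurable function need not be measurable.\<close>

definition inf_conv_ineq :: "'a measure \<Rightarrow> ('a \<Rightarrow> 'a \<Rightarrow> real) \<Rightarrow> bool" where
  "inf_conv_ineq \<mu> c \<longleftrightarrow> (\<forall>\<phi> \<psi> K. \<phi> \<in> borel_measurable \<mu> \<longrightarrow> \<psi> \<in> borel_measurable \<mu> \<longrightarrow>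
     (\<forall>x\<in>space \<mu>. \<bar>\<phi> x\<bar> \<le> K \<and> \<bar>\<psi> x\<bar> \<le> K) \<longrightarrow>
     (\<forall>x\<in>space \<mu>. \<forall>y\<in>space \<mu>. \<psi> x \<le> \<phi> y + c x y) \<longrightarrow>
     (\<integral>x. exp (\<psi> x) \<partial>\<mu>) \<le> exp (\<integral>x. \<phi> x \<partial>\<mu>))"

lemma inf_conv_ineqI:
  assumes "\<And>\<phi> \<psi> K. \<phi> \<in> borel_measurable \<mu> \<Longrightarrow> \<psi> \<in> borel_measurable \<mu> \<Longrightarrow>
     (\<And>x. x \<in> space \<mu> \<Longrightarrow> \<bar>\<phi> x\<bar> \<le> K) \<Longrightarrow> (\<And>x. x \<in> space \<mu> \<Longrightarrow> \<bar>\<psi> x\<bar> \<le> K) \<Longrightarrow>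
     (\<And>x y. x \<in> space \<mu> \<Longrightarrow> y \<in> space \<mu> \<Longrightarrow> \<psi> x \<le> \<phi> y + c x y) \<Longrightarrow>
     (\<integral>x. exp (\<psi> x) \<partial>\<mu>) \<le> exp (\<integral>x. \<phi> x \<partial>\<mu>)"
  shows "inf_conv_ineq \<mu> c"
  using assms unfolding inf_conv_ineq_def by blast

lemma inf_conv_ineqD:
  assumes "inf_conv_ineq \<mu> c" "\<phi> \<in> borel_measurable \<mu>" "\<psi> \<in> borel_measurable \<mu>"
    "\<And>x. x \<in> space \<mu> \<Longrightarrow> \<bar>\<phi> x\<bar> \<le> K" "\<And>x. x \<in> space \<mu> \<Longrightarrow> \<bar>\<psi> x\<bar> \<le> K"
    "\<And>x y. x \<in> space \<mu> \<Longrightarrow> y \<in> space \<mu> \<Longrightarrow> \<psi> x \<le> \<phi> y + c x y"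
  shows "(\<integral>x. exp (\<psi> x) \<partial>\<mu>) \<le> exp (\<integral>x. \<phi> x \<partial>\<mu>)"
  using assms unfolding inf_conv_ineq_def by blast

lemma (in prob_space) integrable_bounded:
  fixes f :: "'a \<Rightarrow> real"
  assumes "f \<in> borel_measurable M" "\<And>x. x \<in> space M \<Longrightarrow> \<bar>f x\<bar> \<le> K"
  shows "integrable M f"
  by (rule integrable_const_bound[where B=K]) (use assms in auto)

lemma (in prob_space) exp_integral_le:
  fixes f :: "'a \<Rightarrow> real"
  assumes [measurable]: "f \<in> borel_measurable M" and "\<And>x. x \<in> space M \<Longrightarrow> \<bar>f x\<bar> \<le> K"
  shows "exp (\<integral>x. f x \<partial>M) \<le> (\<integral>x. exp (f x) \<partial>M)"
proof -
  have "integrable M f" by (rule integrable_bounded[OF assms])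
  moreover have "integrable M (\<lambda>x. exp (f x))"
    by (rule integrable_bounded[where K="exp K"]) (use assms(2) in \<open>force+\<close>)
  ultimately show ?thesis
    by (intro jensens_inequality[where X=f and I=UNIV and q=exp] exp_convex) auto
qed

section \<open>The standard Gaussian on the line\<close>

lemma std_normal_density_bound: "std_normal_density x \<le> 1"
proof -
  have "1 \<le> sqrt (2 * pi)" using pi_gt3 by simp
  then have "1 / sqrt (2 * pi) * exp (- x\<^sup>2 / 2) \<le> 1 * 1"
    by (intro mult_mono) (auto simp: field_simps)
  then show ?thesis by (simp add: std_normal_density_def)
qed

lemma is_interval_std_normal_density: "is_interval {z. r < std_normal_density z}"
  unfolding is_interval_1
proof safe
  fix x y z assume *: "r < std_normal_density x" "r < std_normal_density y" "x \<le> z" "z \<le> y"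
  have "z\<^sup>2 \<le> x\<^sup>2 \<or> z\<^sup>2 \<le> y\<^sup>2"
    using *(3,4) by (cases "0 \<le> z") (auto intro: power_mono simp: abs_le_square_iff[symmetric])
  then have "std_normal_density x \<le> std_normal_density z \<or> std_normal_density y \<le> std_normal_density z"
    unfolding std_normal_density_def by (auto intro!: mult_left_mono simp: divide_simps)
  with * show "r < std_normal_density z" by auto
qed

text \<open>This is the identity
  \<open>t x^2 + (1-t) y^2 = (t x + (1-t) y)^2 + t (1-t) (x-y)^2\<close> in the exponent. That it is
  an equality is what leads to the sharp constant.\<close>

lemma std_normal_density_convex_combination:
  assumes t: "0 < t" "t < 1"
  shows "std_normal_density x powr t * std_normal_density y powr (1 - t) * exp (t * (1 - t) * (x - y)\<^sup>2 / 2)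
    = std_normal_density (t * x + (1 - t) * y)"
proof -
  define k where "k = 1 / sqrt (2 * pi)"
  have k: "0 < k" by (simp add: k_def)
  have "std_normal_density x powr t * std_normal_density y powr (1 - t) * exp (t * (1 - t) * (x - y)\<^sup>2 / 2)
    = (k powr t * k powr (1 - t)) * (exp (- x\<^sup>2 / 2) powr t * exp (- y\<^sup>2 / 2) powr (1 - t) * exp (t * (1 - t) * (x - y)\<^sup>2 / 2))"
    unfolding std_normal_density_def k_def[symmetric] using k by (simp add: powr_mult)
  also have "k powr t * k powr (1 - t) = k" using k by (simp flip: powr_add)
  also have "exp (- x\<^sup>2 / 2) powr t * exp (- y\<^sup>2 / 2) powr (1 - t) * exp (t * (1 - t) * (x - y)\<^sup>2 / 2) =
    exp (- (t * x + (1 - t) * y)\<^sup>2 / 2)"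
    by (simp add: powr_def flip: exp_add) (simp add: field_simps power2_eq_square)
  finally show ?thesis by (simp add: std_normal_density_def k_def)
qed

abbreviation std_normal :: "real measure" where
  "std_normal \<equiv> density lborel std_normal_density"

lemma prob_space_std_normal: "prob_space std_normal"
  by (rule prob_space_normal_density) simp

text \<open>The scaling by \<open>s = 1 - t\<close> makes the cost \<open>(x - y)\<^sup>2/2\<close> match the modulus of convexity
  \<open>t(1-t)(x - y)\<^sup>2/2\<close> of the Gaussian potential; letting \<open>t\<close> tend to \<open>0\<close> then recovers the sharp constant.\<close>

lemma inf_conv_ineq_std_normal:
  "inf_conv_ineq std_normal (\<lambda>x y. (x - y)\<^sup>2 / 2)"
proof (rule inf_conv_ineqI)
  fix \<phi> \<psi> :: "real \<Rightarrow> real" and K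
  assume "\<phi> \<in> borel_measurable std_normal" "\<psi> \<in> borel_measurable std_normal"
  then have [measurable]: "\<phi> \<in> borel_measurable borel" "\<psi> \<in> borel_measurable borel" by simp_all
  assume "\<And>x. x \<in> space std_normal \<Longrightarrow> \<bar>\<phi> x\<bar> \<le> K" "\<And>x. x \<in> space std_normal \<Longrightarrow> \<bar>\<psi> x\<bar> \<le> K"
    "\<And>x y. x \<in> space std_normal \<Longrightarrow> y \<in> space std_normal \<Longrightarrow> \<psi> x \<le> \<phi> y + (x - y)\<^sup>2 / 2"
  then have bd: "\<bar>\<phi> x\<bar> \<le> K" "\<bar>\<psi> x\<bar> \<le> K" and le: "\<psi> x \<le> \<phi> y + (x - y)\<^sup>2 / 2" for x y by auto
  interpret prob_space std_normal by (rule prob_space_std_normal)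
  have int: "integrable lborel (\<lambda>x. exp (f x) * std_normal_density x)"
    and eq: "(\<integral>x. exp (f x) * std_normal_density x \<partial>lborel) = (\<integral>x. exp (f x) \<partial>std_normal)"
    if [measurable]: "f \<in> borel_measurable borel" and f: "\<And>x. \<bar>f x\<bar> \<le> B" for f B
  proof -
    have "exp (f x) \<le> exp B" for x using f[of x] by simp
    then have "integrable std_normal (\<lambda>x. exp (f x))"
      by (intro integrable_bounded[where K="exp B"]) auto
    then show "integrable lborel (\<lambda>x. exp (f x) * std_normal_density x)"
      by (subst (asm) integrable_density) (auto simp: mult.commute)
    show "(\<integral>x. exp (f x) * std_normal_density x \<partial>lborel) = (\<integral>x. exp (f x) \<partial>std_normal)"
      by (subst integral_density) (auto simp: mult.commute)
  qed
  let ?I = "\<integral>x. \<phi> x \<partial>std_normal"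
  have step: "(\<integral>x. exp (s * \<psi> x) \<partial>std_normal) \<le> exp (s * ?I)" if s: "0 < s" "s < 1" for s
  proof -
    define t where "t = 1 - s"
    have t: "0 < t" "t < 1" "1 - t = s" using s by (auto simp: t_def)
    \<comment> \<open>The powers \<open>t\<close> and \<open>s\<close> turn the two exponents into
      \<open>s t (\<psi> x - \<phi> y)\<close>, which the constraint bounds by
      \<open>s t (x - y)^2 / 2\<close>, exactly the gain from the density.\<close>
    define U V where "U = (\<integral>x. exp (s * \<psi> x) \<partial>std_normal)" and "V = (\<integral>x. exp (- t * \<phi> x) \<partial>std_normal)"
    have b1: "\<bar>s * \<psi> x\<bar> \<le> K" and b2: "\<bar>- t * \<phi> x\<bar> \<le> K" for x
      using bd[of x] s t mult_mono[of s 1 "\<bar>\<psi> x\<bar>" K] mult_mono[of t 1 "\<bar>\<phi> x\<bar>" K] by (auto simp: abs_mult)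
    have bdd: "bdd_above (range (\<lambda>x. exp (f x) * std_normal_density x))" if f: "\<And>x. \<bar>f x\<bar> \<le> B" for f B
      by (rule bdd_aboveI2[where M="exp B * 1"], rule mult_mono)
         (use f std_normal_density_bound in \<open>auto simp: abs_le_iff\<close>)
    have "(\<integral>x. exp (s * \<psi> x) * std_normal_density x \<partial>lborel) powr t *
      (\<integral>x. exp (- t * \<phi> x) * std_normal_density x \<partial>lborel) powr (1 - t) \<le> (\<integral>x. std_normal_density x \<partial>lborel)"
    proof (rule prekopa_leindler_quasiconcave)
      show "(exp (s * \<psi> x) * std_normal_density x) powr t *
        (exp (- t * \<phi> y) * std_normal_density y) powr (1 - t) \<le> std_normal_density (t * x + (1 - t) * y)" for x y
      proof -
        have "(exp (s * \<psi> x) * std_normal_density x) powr t * (exp (- t * \<phi> y) * std_normal_density y) powr (1 - t)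
          = std_normal_density x powr t * std_normal_density y powr (1 - t) * exp (s * t * (\<psi> x - \<phi> y))"
          by (simp add: powr_mult normal_density_nonneg t(3) powr_def[of "exp _"] flip: exp_add)
             (simp add: algebra_simps)
        also have "\<dots> \<le> std_normal_density x powr t * std_normal_density y powr (1 - t) * exp (t * (1 - t) * (x - y)\<^sup>2 / 2)"
          using mult_left_mono[of "\<psi> x - \<phi> y" "(x - y)\<^sup>2 / 2" "s * t"] le[of x y] s t
          by (intro mult_left_mono) (auto simp: mult_ac)
        also have "\<dots> = std_normal_density (t * x + (1 - t) * y)"
          by (rule std_normal_density_convex_combination) (use t in auto)
        finally show ?thesis .
      qed
    qed (use t b1 b2 in \<open>auto intro!: bdd int is_interval_std_normal_density mult_pos_pos normal_density_pos normal_density_nonneg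
       integrable_normal_density\<close>)
    also have "\<dots> = 1" by (rule integral_normal_density) simp
    finally have UV: "U powr t * V powr s \<le> 1"
      using eq[of "\<lambda>x. s * \<psi> x", OF _ b1] eq[of "\<lambda>x. - t * \<phi> x", OF _ b2] by (simp add: U_def V_def t(3))
    \<comment> \<open>Jensen bounds \<open>V\<close> from below and so eliminates it from
      \<open>UV\<close>; dividing by \<open>t\<close> leaves \<open>ln U \<le> s * ?I\<close>. The
      second use of Jensen only ensures that \<open>U\<close> is positive.\<close>
    have "exp (\<integral>x. - t * \<phi> x \<partial>std_normal) \<le> V"
      unfolding V_def by (rule exp_integral_le[OF _ b2]) simp
    then have V: "exp (- t * ?I) \<le> V" by simp
    have "exp (\<integral>x. s * \<psi> x \<partial>std_normal) \<le> U"
      unfolding U_def by (rule exp_integral_le[OF _ b1]) simp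
    then have Upos: "0 < U" using exp_gt_zero less_le_trans by blast
    have "U powr t * exp (- t * ?I) powr s \<le> U powr t * V powr s"
      using V s by (intro mult_left_mono powr_mono2) auto
    also note UV
    finally have "t * ln U - t * s * ?I \<le> 0"
      using Upos by (simp add: powr_def algebra_simps flip: exp_add)
    then have "t * (ln U - s * ?I) \<le> 0" by (simp add: algebra_simps)
    then have "ln U \<le> s * ?I" using t by (simp add: mult_le_0_iff)
    then show ?thesis using Upos unfolding U_def by (metis exp_le_cancel_iff exp_ln)
  qed
  have K: "0 \<le> K" using bd(1)[of 0] by auto
  \<comment> \<open>The summand 2 keeps \<open>s n\<close> strictly inside \<open>(0,1)\<close> at
    \<open>n = 0\<close> as well.\<close>
  define s where "s n = 1 - 1 / (real n + 2)" for n
  have s: "0 < s n" "s n < 1" for n by (auto simp: s_def field_simps)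
  have lim: "s \<longlonglongrightarrow> 1"
    unfolding s_def by real_asymp
  show "(\<integral>x. exp (\<psi> x) \<partial>std_normal) \<le> exp ?I"
  proof (rule LIMSEQ_le)
    show "(\<lambda>n. \<integral>x. exp (s n * \<psi> x) \<partial>std_normal) \<longlonglongrightarrow> (\<integral>x. exp (\<psi> x) \<partial>std_normal)"
    proof (rule integral_dominated_convergence[where w="\<lambda>_. exp K"])
      show "AE x in std_normal. (\<lambda>n. exp (s n * \<psi> x)) \<longlonglongrightarrow> exp (\<psi> x)"
        by (intro AE_I2 tendsto_exp tendsto_mult_right[OF lim, of "\<psi> _", simplified])
      show "AE x in std_normal. norm (exp (s n * \<psi> x)) \<le> exp K" for n
      proof (intro AE_I2)
        fix x
        have "s n * \<psi> x \<le> s n * K"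
          using bd(2)[of x] s[of n] by (intro mult_left_mono) auto
        also have "\<dots> \<le> 1 * K" using K s[of n] by (intro mult_right_mono) auto
        finally have "s n * \<psi> x \<le> K" by simp
        then show "norm (exp (s n * \<psi> x)) \<le> exp K" by simp
      qed
    qed auto
    show "(\<lambda>n. exp (s n * ?I)) \<longlonglongrightarrow> exp ?I"
      by (intro tendsto_exp tendsto_mult_right[OF lim, of "?I", simplified])
    show "\<exists>N. \<forall>n\<ge>N. (\<integral>x. exp (s n * \<psi> x) \<partial>std_normal) \<le> exp (s n * ?I)"
      using step s by blast
  qed
qed

section \<open>Images and products\<close>

text \<open>Composing both test functions with \<open>f\<close> preserves the constraint, because
  \<open>f\<close> does not increase the cost.\<close>

lemma inf_conv_ineq_distr:
  assumes "inf_conv_ineq \<mu> c" and [measurable]: "f \<in> measurable \<mu> N"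
    and le: "\<And>x y. x \<in> space \<mu> \<Longrightarrow> y \<in> space \<mu> \<Longrightarrow> c' (f x) (f y) \<le> c x y"
  shows "inf_conv_ineq (distr \<mu> N f) c'"
proof (rule inf_conv_ineqI)
  fix \<phi> \<psi> :: "_ \<Rightarrow> real" and K
  assume "\<phi> \<in> borel_measurable (distr \<mu> N f)" "\<psi> \<in> borel_measurable (distr \<mu> N f)"
  then have [measurable]: "\<phi> \<in> borel_measurable N" "\<psi> \<in> borel_measurable N" by simp_all
  assume bd: "\<And>x. x \<in> space (distr \<mu> N f) \<Longrightarrow> \<bar>\<phi> x\<bar> \<le> K" "\<And>x. x \<in> space (distr \<mu> N f) \<Longrightarrow> \<bar>\<psi> x\<bar> \<le> K"
    and d: "\<And>x y. x \<in> space (distr \<mu> N f) \<Longrightarrow> y \<in> space (distr \<mu> N f) \<Longrightarrow> \<psi> x \<le> \<phi> y + c' x y"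
  have sp: "f x \<in> space N" if "x \<in> space \<mu>" for x using that by (rule measurable_space[OF assms(2)])
  have "(\<integral>x. exp (\<psi> (f x)) \<partial>\<mu>) \<le> exp (\<integral>x. \<phi> (f x) \<partial>\<mu>)"
  proof (rule inf_conv_ineqD[OF assms(1), where K=K])
    fix x y assume "x \<in> space \<mu>" "y \<in> space \<mu>"
    then show "\<psi> (f x) \<le> \<phi> (f y) + c x y"
      using d[of "f x" "f y"] le[of x y] sp by fastforce
  qed (use bd sp in auto)
  then show "(\<integral>x. exp (\<psi> x) \<partial>distr \<mu> N f) \<le> exp (\<integral>x. \<phi> x \<partial>distr \<mu> N f)"
    by (simp add: integral_distr)
qed

text \<open>Integrate out the second coordinate asymmetrically: \<open>\<psi>\<close> through its
  log-Laplace transform \<open>\<Psi>\<close>, \<open>\<phi>\<close> through its mean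
  \<open>\<Phi>\<close>. For fixed \<open>x\<close> and \<open>y\<close> the number
  \<open>c x y\<close> can be moved into \<open>\<psi>\<close>, and the inequality for
  \<open>\<nu>\<close> says precisely that \<open>\<Psi> x \<le> \<Phi> y + c x y\<close>. So the
  inequality for \<open>\<mu>\<close> applies to this pair.\<close>

lemma inf_conv_ineq_pair:
  fixes \<mu> :: "'a measure" and \<nu> :: "'b measure"
  assumes "prob_space \<mu>" "prob_space \<nu>" "inf_conv_ineq \<mu> c" "inf_conv_ineq \<nu> c'"
  shows "inf_conv_ineq (\<mu> \<Otimes>\<^sub>M \<nu>) (\<lambda>x y. c (fst x) (fst y) + c' (snd x) (snd y))"
proof (rule inf_conv_ineqI)
  fix \<phi> \<psi> :: "'a \<times> 'b \<Rightarrow> real" and K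
  let ?I = "\<lambda>x. \<integral>x'. exp (\<psi> (x, x')) \<partial>\<nu>"
  let ?R = "\<mu> \<Otimes>\<^sub>M \<nu>"
  interpret M: prob_space \<mu> by fact
  interpret N: prob_space \<nu> by fact
  interpret P: pair_prob_space \<mu> \<nu> ..
  assume [measurable]: "\<phi> \<in> borel_measurable ?R" "\<psi> \<in> borel_measurable ?R"
  assume bd1: "\<And>x. x \<in> space ?R \<Longrightarrow> \<bar>\<phi> x\<bar> \<le> K"
    and bd2: "\<And>x. x \<in> space ?R \<Longrightarrow> \<bar>\<psi> x\<bar> \<le> K"
    and le': "\<And>x y. x \<in> space ?R \<Longrightarrow> y \<in> space ?R \<Longrightarrow>
       \<psi> x \<le> \<phi> y + (c (fst x) (fst y) + c' (snd x) (snd y))"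
  have sp: "(x, x') \<in> space ?R" if "x \<in> space \<mu>" "x' \<in> space \<nu>" for x x'
    using that by (simp add: space_pair_measure)
  have bd: "\<bar>\<phi> (x, x')\<bar> \<le> K" "\<bar>\<psi> (x, x')\<bar> \<le> K" if "x \<in> space \<mu>" "x' \<in> space \<nu>" for x x'
    using bd1[OF sp[OF that]] bd2[OF sp[OF that]] by auto
  have le: "\<psi> (x, x') \<le> \<phi> (y, y') + (c x y + c' x' y')"
    if "x \<in> space \<mu>" "y \<in> space \<mu>" "x' \<in> space \<nu>" "y' \<in> space \<nu>" for x y x' y'
    using le'[OF sp sp, OF that(1,3,2,4)] by simp
  define \<Psi> \<Phi> where "\<Psi> x = ln (?I x)" and "\<Phi> y = (\<integral>y'. \<phi> (y, y') \<partial>\<nu>)" for x y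
  \<comment> \<open>These bounds make the logarithm of the inner integral bounded by the same
    \<open>K\<close>, hence an admissible test function.\<close>
  have lo: "exp (- K) \<le> ?I x" and hi: "?I x \<le> exp K"
    if x: "x \<in> space \<mu>" for x
  proof -
    have b: "exp (\<psi> (x, x')) \<le> exp K" "exp (- K) \<le> exp (\<psi> (x, x'))" if "x' \<in> space \<nu>" for x'
      using bd(2)[OF x that] by auto
    have int: "integrable \<nu> (\<lambda>x'. exp (\<psi> (x, x')))"
      by (rule N.integrable_bounded[where K="exp K"]) (use b x in auto)
    show "exp (- K) \<le> ?I x"
      using b by (intro N.integral_ge_const[OF int] AE_I2) auto
    show "?I x \<le> exp K"
      using b by (intro N.integral_le_const[OF int] AE_I2) auto
  qed
  have exp\<Psi>: "exp (\<Psi> x) = ?I x" if "x \<in> space \<mu>" for x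
    unfolding \<Psi>_def by (rule exp_ln) (use less_le_trans[OF exp_gt_zero lo[OF that]] in simp)
  have int\<phi>: "integrable \<nu> (\<lambda>y'. \<phi> (y, y'))" if "y \<in> space \<mu>" for y
    by (rule N.integrable_bounded[where K=K]) (use bd that in auto)
  have "(\<integral>x. exp (\<Psi> x) \<partial>\<mu>) \<le> exp (\<integral>x. \<Phi> x \<partial>\<mu>)"
  proof (rule inf_conv_ineqD[OF assms(3), where K=K])
    show "\<Phi> \<in> borel_measurable \<mu>" "\<Psi> \<in> borel_measurable \<mu>"
      unfolding \<Phi>_def \<Psi>_def by measurable
    show "\<bar>\<Phi> x\<bar> \<le> K" if x: "x \<in> space \<mu>" for x
    proof -
      have "- K \<le> \<Phi> x" "\<Phi> x \<le> K" unfolding \<Phi>_def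
        using bd(1)[OF x] by (intro N.integral_ge_const[OF int\<phi>[OF x]] N.integral_le_const[OF int\<phi>[OF x]] AE_I2; force)+
      then show ?thesis by auto
    qed
    show "\<bar>\<Psi> x\<bar> \<le> K" if x: "x \<in> space \<mu>" for x
      using lo[OF x] hi[OF x] unfolding exp\<Psi>[OF x, symmetric] by auto
    show "\<Psi> x \<le> \<Phi> y + c x y" if x: "x \<in> space \<mu>" and y: "y \<in> space \<mu>" for x y
    proof -
      have b: "\<bar>\<psi> (x, x') - c x y\<bar> \<le> K + \<bar>c x y\<bar>" "\<bar>\<phi> (y, x')\<bar> \<le> K + \<bar>c x y\<bar>" if "x' \<in> space \<nu>" for x'
        using bd(1)[OF y that] bd(2)[OF x that] by auto
      have "(\<integral>x'. exp (\<psi> (x, x') - c x y) \<partial>\<nu>) \<le> exp (\<Phi> y)"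
        unfolding \<Phi>_def
      proof (rule inf_conv_ineqD[OF assms(4), where K="K + \<bar>c x y\<bar>"])
        show "\<psi> (x, x') - c x y \<le> \<phi> (y, y') + c' x' y'" if "x' \<in> space \<nu>" "y' \<in> space \<nu>" for x' y'
          using le[OF x y that] by auto
      qed (use b x y in \<open>auto\<close>)
      also have "(\<integral>x'. exp (\<psi> (x, x') - c x y) \<partial>\<nu>) = exp (\<Psi> x - c x y)"
        by (simp add: exp_diff exp\<Psi>[OF x])
      finally show ?thesis by simp
    qed
  qed
  also have "(\<integral>x. exp (\<Psi> x) \<partial>\<mu>) = (\<integral>x. ?I x \<partial>\<mu>)"
    by (intro Bochner_Integration.integral_cong refl exp\<Psi>)
  also have "\<dots> = (\<integral>z. exp (\<psi> z) \<partial>?R)"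
  proof (subst P.integral_fst)
    have "exp (\<psi> z) \<le> exp K" if "z \<in> space ?R" for z
      using bd(2)[of "fst z" "snd z"] that by (auto simp: space_pair_measure)
    then show "integrable ?R (\<lambda>(x, x'). exp (\<psi> (x, x')))"
      by (intro P.integrable_bounded[where K="exp K"]) auto
  qed (auto simp: case_prod_beta')
  also have "(\<integral>x. \<Phi> x \<partial>\<mu>) = (\<integral>z. \<phi> z \<partial>?R)"
    unfolding \<Phi>_def
  proof (subst P.integral_fst)
    show "integrable ?R (\<lambda>(x, x'). \<phi> (x, x'))"
      by (intro P.integrable_bounded[where K=K]) (use bd in \<open>auto simp: space_pair_measure\<close>)
  qed (auto simp: case_prod_beta')
  finally show "(\<integral>x. exp (\<psi> x) \<partial>?R) \<le> exp (\<integral>x. \<phi> x \<partial>?R)" .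
qed

lemma inf_conv_ineq_PiM:
  assumes "finite I" "\<And>i. i \<in> I \<Longrightarrow> prob_space (M i)" "\<And>i. i \<in> I \<Longrightarrow> inf_conv_ineq (M i) (c i)"
  shows "inf_conv_ineq (PiM I M) (\<lambda>x y. \<Sum>i\<in>I. c i (x i) (y i))"
  using assms
proof (induction I rule: finite_induct)
  case empty
  show ?case
    by (rule inf_conv_ineqI) (simp add: PiM_empty lebesgue_integral_count_space_finite)
next
  case (insert i I)
  have "inf_conv_ineq (M i \<Otimes>\<^sub>M PiM I M)
    (\<lambda>x y. c i (fst x) (fst y) + (\<Sum>j\<in>I. c j (snd x j) (snd y j)))"
    using insert by (intro inf_conv_ineq_pair prob_space_PiM) auto
  then have "inf_conv_ineq (distr (M i \<Otimes>\<^sub>M PiM I M) (PiM (insert i I) M) (\<lambda>(x, X). X(i := x)))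
     (\<lambda>x y. \<Sum>j\<in>insert i I. c j (x j) (y j))"
  proof (rule inf_conv_ineq_distr)
    have "(\<Sum>j\<in>I. c j ((X(i := x)) j) ((Y(i := y)) j)) = (\<Sum>j\<in>I. c j (X j) (Y j))" for X Y x y
      using insert(2) by (intro sum.cong) auto
    then show "(\<Sum>j\<in>insert i I. c j ((case z of (x, X) \<Rightarrow> X(i := x)) j) ((case w of (x, X) \<Rightarrow> X(i := x)) j))
      \<le> c i (fst z) (fst w) + (\<Sum>j\<in>I. c j (snd z j) (snd w j))" for z w
      using insert(1,2) by (cases z; cases w) simp
  qed simp
  also have "distr (M i \<Otimes>\<^sub>M PiM I M) (PiM (insert i I) M) (\<lambda>(x, X). X(i := x)) = PiM (insert i I) M"
    using insert by (intro distr_pair_PiM_eq_PiM) auto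
  finally show ?case .
qed

text \<open>Identifies a product of standard Gaussians as a density with respect to Lebesgue
  measure, the form in which the increments of \<open>W\<close> are given.\<close>

lemma PiM_density:
  fixes f :: "'i \<Rightarrow> 'a \<Rightarrow> ennreal"
  assumes "finite I" and sf: "\<And>i. sigma_finite_measure (M i)" "\<And>i. sigma_finite_measure (density (M i) (f i))"
    and [measurable]: "\<And>i. f i \<in> borel_measurable (M i)"
  shows "PiM I (\<lambda>i. density (M i) (f i)) = density (PiM I M) (\<lambda>x. \<Prod>i\<in>I. f i (x i))"
proof -
  interpret M: product_sigma_finite M using sf(1) by (simp add: product_sigma_finite_def)
  interpret D: product_sigma_finite "\<lambda>i. density (M i) (f i)" using sf(2) by (simp add: product_sigma_finite_def)
  have "density (PiM I M) (\<lambda>x. \<Prod>i\<in>I. f i (x i)) = PiM I (\<lambda>i. density (M i) (f i))"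
  proof (rule D.PiM_eqI[OF \<open>finite I\<close>])
    show "sets (density (PiM I M) (\<lambda>x. \<Prod>i\<in>I. f i (x i))) = sets (PiM I (\<lambda>i. density (M i) (f i)))"
      by (simp cong: sets_PiM_cong)
    fix A assume A: "\<And>i. i \<in> I \<Longrightarrow> A i \<in> sets (density (M i) (f i))"
    have [measurable]: "Pi\<^sub>E I A \<in> sets (PiM I M)" using A \<open>finite I\<close> by (intro sets_PiM_I_finite) auto
    have "emeasure (density (PiM I M) (\<lambda>x. \<Prod>i\<in>I. f i (x i))) (Pi\<^sub>E I A)
      = (\<integral>\<^sup>+x. (\<Prod>i\<in>I. f i (x i)) * indicator (Pi\<^sub>E I A) x \<partial>PiM I M)"
      by (rule emeasure_density) auto
    also have "\<dots> = (\<integral>\<^sup>+x. (\<Prod>i\<in>I. f i (x i) * indicator (A i) (x i)) \<partial>PiM I M)"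
    proof (rule nn_integral_cong)
      fix x assume "x \<in> space (PiM I M)"
      then have "indicator (Pi\<^sub>E I A) x = (\<Prod>i\<in>I. indicator (A i) (x i) :: ennreal)"
        using \<open>finite I\<close> by (auto simp: indicator_def PiE_def space_PiM Pi_iff prod_zero_iff)
      then show "(\<Prod>i\<in>I. f i (x i)) * indicator (Pi\<^sub>E I A) x = (\<Prod>i\<in>I. f i (x i) * indicator (A i) (x i))"
        by (simp add: prod.distrib)
    qed
    also have "\<dots> = (\<Prod>i\<in>I. \<integral>\<^sup>+x. f i x * indicator (A i) x \<partial>M i)"
      using A by (intro M.product_nn_integral_prod[OF \<open>finite I\<close>]) auto
    also have "\<dots> = (\<Prod>i\<in>I. emeasure (density (M i) (f i)) (A i))"
      using A by (intro prod.cong refl emeasure_density[symmetric]) auto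
    finally show "emeasure (density (PiM I M) (\<lambda>x. \<Prod>i\<in>I. f i (x i))) (Pi\<^sub>E I A)
      = (\<Prod>i\<in>I. emeasure (density (M i) (f i)) (A i))" .
  qed
  then show ?thesis ..
qed

lemma inf_conv_ineq_std_normal_euclidean:
  "inf_conv_ineq (density lborel (\<lambda>x::'a::euclidean_space. \<Prod>b\<in>Basis. ennreal (std_normal_density (x \<bullet> b))))
     (\<lambda>x y. (norm (x - y))\<^sup>2 / 2)"
proof -
  define s where "s f = (\<Sum>b\<in>Basis. f b *\<^sub>R (b :: 'a))" for f
  have [measurable]: "s \<in> measurable (PiM Basis (\<lambda>_. borel)) borel"
    unfolding s_def by measurable
  have sb: "s f \<bullet> b = f b" if "b \<in> Basis" for f b
    using that by (simp add: s_def)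
  have "inf_conv_ineq (PiM (Basis :: 'a set) (\<lambda>_. std_normal)) (\<lambda>x y. \<Sum>b\<in>Basis. (x b - y b)\<^sup>2 / 2)"
    by (intro inf_conv_ineq_PiM prob_space_std_normal inf_conv_ineq_std_normal) simp
  then have "inf_conv_ineq (distr (PiM (Basis :: 'a set) (\<lambda>_. std_normal)) borel s) (\<lambda>x y. (norm (x - y))\<^sup>2 / 2)"
  proof (rule inf_conv_ineq_distr)
    fix f g
    have "(norm (s f - s g))\<^sup>2 = (\<Sum>b\<in>Basis. (f b - g b)\<^sup>2)"
      unfolding power2_norm_eq_inner euclidean_inner[of "s f - s g" "s f - s g"]
      by (simp add: inner_diff_left sb power2_eq_square)
    then show "(norm (s f - s g))\<^sup>2 / 2 \<le> (\<Sum>b\<in>Basis. (f b - g b)\<^sup>2 / 2)"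
      by (simp add: sum_divide_distrib)
  qed measurable
  also have "PiM (Basis :: 'a set) (\<lambda>_. std_normal) =
      density (PiM Basis (\<lambda>_. lborel)) (\<lambda>x. \<Prod>b\<in>Basis. ennreal (std_normal_density (x b)))"
    by (intro PiM_density) (auto intro: sigma_finite_lborel prob_space_std_normal prob_space_imp_sigma_finite)
  also have "distr \<dots> borel s = density (distr (PiM Basis (\<lambda>_. lborel)) borel s)
      (\<lambda>x::'a. \<Prod>b\<in>Basis. ennreal (std_normal_density (x \<bullet> b)))"
  proof (subst density_distr)
    have "(\<lambda>x. \<Prod>b\<in>Basis. ennreal (std_normal_density (x b))) =
      (\<lambda>x. \<Prod>b\<in>Basis. ennreal (std_normal_density (s x \<bullet> b)))"
      by (simp add: sb)
    then show "distr (density (PiM Basis (\<lambda>_. lborel)) (\<lambda>x. \<Prod>b\<in>Basis. ennreal (std_normal_density (x b)))) borel s =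
      distr (density (PiM Basis (\<lambda>_. lborel)) (\<lambda>x. \<Prod>b\<in>Basis. ennreal (std_normal_density (s x \<bullet> b)))) borel s"
      by simp
  qed auto
  also have "distr (PiM Basis (\<lambda>_. lborel)) borel s = (lborel :: 'a measure)"
    unfolding s_def by (rule lborel_eq[symmetric])
  finally show ?thesis .
qed

section \<open>Gaussian vectors with general covariance\<close>

lemma inner_transpose_matrix_vector:
  fixes A :: "real ^ 'n ^ 'm"
  shows "(transpose A *v x) \<bullet> y = x \<bullet> (A *v y)"
  by (simp only: transpose_matrix_vector dot_lmul_matrix)

text \<open>Gram-Schmidt for the inner product \<open>x \<bullet> (S *v y)\<close>: as long as fewer
  vectors than the dimension are chosen, some nonzero \<open>x\<close> is Euclidean orthogonal to
  all \<open>S *v f i\<close>, and positive definiteness allows it to be normalized.\<close>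

lemma positive_definite_orthonormal:
  fixes S :: "real ^ 'n ^ 'n"
  assumes sym: "transpose S = S" and pd: "positive_definite S"
  assumes "k \<le> CARD('n)"
  shows "\<exists>f :: nat \<Rightarrow> real ^ 'n. \<forall>i<k. \<forall>j<k. f i \<bullet> (S *v f j) = (if i = j then 1 else 0)"
  using assms(3)
proof (induction k)
  case (Suc k)
  have bsym: "x \<bullet> (S *v y) = y \<bullet> (S *v x)" for x y
    by (metis sym dot_lmul_matrix inner_commute vector_transpose_matrix)
  from Suc obtain f :: "nat \<Rightarrow> real ^ 'n"
    where f: "\<And>i j. i < k \<Longrightarrow> j < k \<Longrightarrow> f i \<bullet> (S *v f j) = (if i = j then 1 else 0)"
    by (metis Suc_leD)
  have "dim ((\<lambda>i. S *v f i) ` {..<k}) \<le> card ((\<lambda>i. S *v f i) ` {..<k})"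
    by (rule dim_le_card') simp
  also have "\<dots> \<le> k" using card_image_le[of "{..<k}" "\<lambda>i. S *v f i"] by simp
  also have "\<dots> < DIM(real ^ 'n)" using Suc.prems by simp
  finally obtain x where x: "x \<noteq> 0" "\<And>y. y \<in> span ((\<lambda>i. S *v f i) ` {..<k}) \<Longrightarrow> orthogonal x y"
    using orthogonal_to_subspace_exists by blast
  have xf: "x \<bullet> (S *v f i) = 0" if "i < k" for i
    using x(2)[of "S *v f i"] that by (auto intro: span_base simp: orthogonal_def)
  have pos: "0 < x \<bullet> (S *v x)" using pd x(1) by (simp add: positive_definite_def)
  define y where "y = (1 / sqrt (x \<bullet> (S *v x))) *\<^sub>R x"
  have yy: "y \<bullet> (S *v y) = 1"
    using pos by (simp add: y_def matrix_vector_mult_scaleR field_simps)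
  have yf: "y \<bullet> (S *v f i) = 0" "f i \<bullet> (S *v y) = 0" if "i < k" for i
    using xf[OF that] bsym[of y "f i"] by (simp_all add: y_def)
  show ?case
    by (rule exI[of _ "\<lambda>i. if i < k then f i else y"]) (auto simp: f yy yf less_Suc_eq)
qed simp

lemma matrix_inv_eqI:
  fixes S :: "real ^ 'n ^ 'n"
  assumes "S ** B = mat 1" "B ** S = mat 1"
  shows "matrix_inv S = B"
proof -
  have "\<exists>C. S ** C = mat 1 \<and> C ** S = mat 1" using assms by blast
  then have "matrix_inv S ** S = mat 1" unfolding matrix_inv_def by (rule someI2_ex) simp
  then have "matrix_inv S ** (S ** B) = B" by (simp add: matrix_mul_assoc)
  then show ?thesis by (simp add: assms)
qed

text \<open>The rows of \<open>R\<close> are an \<open>S\<close>-orthonormal basis, that is,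
  \<open>R S R^T = 1\<close>. Hence \<open>L = S R^T\<close> inverts \<open>R\<close> and satisfies
  \<open>L L^T = S\<close>. Such a factor takes the role of the square root of \<open>S\<close>,
  without any diagonalization.\<close>

lemma positive_definite_inverse_root:
  fixes S :: "real ^ 'n ^ 'n"
  assumes sym: "transpose S = S" and pd: "positive_definite S"
  obtains R L :: "real ^ 'n ^ 'n" where "L ** R = mat 1" "R ** L = mat 1" "S = L ** transpose L"
    "matrix_inv S = transpose R ** R"
proof -
  obtain f :: "nat \<Rightarrow> real ^ 'n" where f: "\<And>i j. i < CARD('n) \<Longrightarrow> j < CARD('n) \<Longrightarrow>
      f i \<bullet> (S *v f j) = (if i = j then 1 else 0)"
    using positive_definite_orthonormal[OF sym pd order_refl] by blast
  obtain e :: "'n \<Rightarrow> nat" where e: "bij_betw e UNIV {..<CARD('n)}"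
    using finite_same_card_bij[of "UNIV :: 'n set" "{..<CARD('n)}"] by auto
  have e1: "e i < CARD('n)" for i using e by (auto simp: bij_betw_def)
  have e2: "e i = e j \<longleftrightarrow> i = j" for i j using e by (auto simp: bij_betw_def inj_on_def)
  define R :: "real ^ 'n ^ 'n" where "R = (\<chi> i. f (e i))"
  have RSR: "R ** (S ** transpose R) = mat 1"
  proof -
    have "(R ** (S ** transpose R)) $ i $ j = f (e i) \<bullet> (S *v f (e j))" for i j
      by (simp add: matrix_matrix_mult_def R_def transpose_def inner_vec_def matrix_vector_mult_def)
    then show ?thesis by (simp add: vec_eq_iff mat_def f e1 e2)
  qed
  define L where "L = S ** transpose R"
  have RL: "R ** L = mat 1" unfolding L_def by (rule RSR)
  then have LR: "L ** R = mat 1" by (simp add: matrix_left_right_inverse)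
  have tr: "transpose R ** transpose L = mat 1" "transpose L ** transpose R = mat 1"
    using arg_cong[OF LR, of transpose] arg_cong[OF RL, of transpose] by (simp_all add: matrix_transpose_mul)
  have S: "S = L ** transpose L"
  proof -
    have "L ** transpose L = S ** (transpose R ** transpose L)"
      by (simp add: L_def matrix_mul_assoc)
    then show ?thesis by (simp add: tr)
  qed
  have "S ** (transpose R ** R) = mat 1"
    using LR by (simp add: L_def matrix_mul_assoc)
  moreover from this have "(transpose R ** R) ** S = mat 1" by (simp add: matrix_left_right_inverse)
  ultimately have "matrix_inv S = transpose R ** R"
    by (rule matrix_inv_eqI)
  with LR RL S show ?thesis by (rule that)
qed

lemma nn_integral_lborel_translate:
  fixes f :: "'a::euclidean_space \<Rightarrow> ennreal"
  assumes [measurable]: "f \<in> borel_measurable borel"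
  shows "(\<integral>\<^sup>+x. f (x + c) \<partial>lborel) = (\<integral>\<^sup>+x. f x \<partial>lborel)"
proof -
  have "(\<integral>\<^sup>+x. f x \<partial>lborel) = (\<integral>\<^sup>+x. f x \<partial>distr lborel borel ((+) c))"
    by (simp add: lborel_distr_plus)
  also have "\<dots> = (\<integral>\<^sup>+x. f (c + x) \<partial>lborel)" by (rule nn_integral_distr) auto
  finally show ?thesis by (simp add: add.commute)
qed

text \<open>Uniqueness of the translation-invariant measure up to a factor. The change of variables formula
  of the library identifies the factor, but only for index types that are well-ordered.\<close>

lemma distr_lborel_matrix:
  fixes L R :: "real ^ 'n ^ 'n"
  assumes LR: "L ** R = mat 1"
  obtains k where "distr lborel borel (\<lambda>x. L *v x) = density lborel (\<lambda>_. k)"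
proof
  have [measurable]: "(\<lambda>x. L *v x) \<in> borel_measurable borel"
    by (intro borel_measurable_continuous_onI continuous_intros)
  have [simp]: "L *v (x + R *v y) = L *v x + y" for x y
    by (simp add: matrix_vector_right_distrib matrix_vector_mul_assoc LR)
  define B where "B = box 0 (One :: real ^ 'n)"
  have [measurable]: "B \<in> sets borel" by (simp add: B_def)
  have B1: "emeasure lborel B = 1" by (simp add: B_def emeasure_lborel_box_eq)
  \<comment> \<open>Averaging over \<open>y\<close> in the unit-volume box \<open>B\<close> and
    absorbing the shift by \<open>y\<close> into a shift of \<open>x\<close> by
    \<open>R *v y\<close> leaves this factor; the minus sign comes from moving the shift by
    \<open>L *v x\<close> onto the box.\<close>
  define k where "k = (\<integral>\<^sup>+x. indicator B (- (L *v x)) \<partial>lborel)"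
  show "distr lborel borel (\<lambda>x. L *v x) = density lborel (\<lambda>_. k)"
  proof (rule measure_eqI)
    fix A assume "A \<in> sets (distr lborel borel (\<lambda>x. L *v x))"
    then have [measurable]: "A \<in> sets borel" by simp
    have t1: "(\<integral>\<^sup>+x. indicator A (L *v x) \<partial>lborel) = (\<integral>\<^sup>+x. indicator A (L *v x + y) \<partial>lborel)" for y
      using nn_integral_lborel_translate[of "\<lambda>x. indicator A (L *v x)" "R *v y"] by simp
    have t2: "(\<integral>\<^sup>+y. indicator B y * indicator A (L *v x + y) \<partial>lborel) =
        (\<integral>\<^sup>+y. indicator B (y - L *v x) * indicator A y \<partial>lborel)" for x
      using nn_integral_lborel_translate[of "\<lambda>y. indicator B y * indicator A (L *v x + y)" "- (L *v x)"] by simp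
    have t3: "(\<integral>\<^sup>+x. indicator B (y - L *v x) * indicator A y \<partial>lborel) =
        (\<integral>\<^sup>+x. indicator B (- (L *v x)) * indicator A y \<partial>lborel)" for y
      using nn_integral_lborel_translate[of "\<lambda>x. indicator B (y - L *v x) * indicator A y" "R *v y"] by simp
    have "emeasure (distr lborel borel (\<lambda>x. L *v x)) A = (\<integral>\<^sup>+x. indicator A (L *v x) \<partial>lborel)"
      using nn_integral_distr[of "\<lambda>x. L *v x" lborel borel "indicator A"] by simp
    also have "\<dots> = (\<integral>\<^sup>+y. indicator B y * (\<integral>\<^sup>+x. indicator A (L *v x) \<partial>lborel) \<partial>lborel)"
      by (simp add: nn_integral_multc B1)
    also have "\<dots> = (\<integral>\<^sup>+y. (\<integral>\<^sup>+x. indicator B y * indicator A (L *v x + y) \<partial>lborel) \<partial>lborel)"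
      by (simp add: nn_integral_cmult flip: t1)
    also have "\<dots> = (\<integral>\<^sup>+x. (\<integral>\<^sup>+y. indicator B y * indicator A (L *v x + y) \<partial>lborel) \<partial>lborel)"
      by (rule lborel_pair.Fubini') measurable
    also have "\<dots> = (\<integral>\<^sup>+x. (\<integral>\<^sup>+y. indicator B (y - L *v x) * indicator A y \<partial>lborel) \<partial>lborel)"
      by (simp only: t2)
    also have "\<dots> = (\<integral>\<^sup>+y. (\<integral>\<^sup>+x. indicator B (y - L *v x) * indicator A y \<partial>lborel) \<partial>lborel)"
      by (rule lborel_pair.Fubini'[symmetric]) measurable
    also have "\<dots> = (\<integral>\<^sup>+y. (\<integral>\<^sup>+x. indicator B (- (L *v x)) * indicator A y \<partial>lborel) \<partial>lborel)"
      by (simp only: t3)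
    also have "\<dots> = (\<integral>\<^sup>+y. k * indicator A y \<partial>lborel)"
      by (simp add: nn_integral_multc k_def)
    also have "\<dots> = emeasure (density lborel (\<lambda>_. k)) A"
      by (simp add: emeasure_density)
    finally show "emeasure (distr lborel borel (\<lambda>x. L *v x)) A = emeasure (density lborel (\<lambda>_. k)) A" .
  qed simp
qed

lemma onorm_positive_definite:
  fixes A :: "real ^ 'n ^ 'n"
  assumes "positive_definite A"
  shows "0 < onorm (\<lambda>x. A *v x)"
proof -
  have "A *v axis undefined 1 \<noteq> 0"
    using assms[unfolded positive_definite_def, rule_format, of "axis undefined 1"] by auto
  then show ?thesis using onorm_pos_lt[OF matrix_vector_mul_bounded_linear[of A]] by auto
qed

text \<open>The law is the image of the standard Gaussian under \<open>L\<close>, whose operator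
  norm is at most the square root of that of \<open>S\<close>.\<close>

lemma inf_conv_ineq_mvnormal:
  fixes S :: "real ^ 'n ^ 'n"
  assumes sym: "transpose S = S" and pd: "positive_definite S"
    and prob: "prob_space (density lborel (\<lambda>x. ennreal (mvnormal_density S x)))"
  shows "inf_conv_ineq (density lborel (\<lambda>x. ennreal (mvnormal_density S x)))
    (\<lambda>x y. (norm (x - y))\<^sup>2 / (2 * onorm (\<lambda>x. S *v x)))"
proof -
  obtain R L :: "real ^ 'n ^ 'n" where LR: "L ** R = mat 1" and RL: "R ** L = mat 1"
    and S: "S = L ** transpose L" and inv: "matrix_inv S = transpose R ** R"
    by (rule positive_definite_inverse_root[OF sym pd])
  have [measurable]: "(\<lambda>x. L *v x) \<in> borel_measurable borel" "(\<lambda>x. R *v x) \<in> borel_measurable borel"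
    by (intro borel_measurable_continuous_onI continuous_intros)+
  obtain k where k: "distr lborel borel (\<lambda>x. L *v x) = density lborel (\<lambda>_. k)"
    by (rule distr_lborel_matrix[OF LR])
  define g where "g x = (\<Prod>b\<in>Basis. ennreal (std_normal_density (x \<bullet> b)))" for x :: "real ^ 'n"
  have [measurable]: "g \<in> borel_measurable borel" unfolding g_def by measurable
  define c0 where "c0 = (1 / sqrt (2 * pi)) ^ CARD('n)"
  have c0: "0 < c0" by (simp add: c0_def)
  have g: "g x = ennreal (c0 * exp (- (norm x)\<^sup>2 / 2))" for x
  proof -
    have "(\<Prod>b\<in>Basis. std_normal_density (x \<bullet> b)) = c0 * exp (\<Sum>b\<in>Basis. - (x \<bullet> b)\<^sup>2 / 2)"
      unfolding std_normal_density_def prod.distrib exp_sum[OF finite_Basis] prod_constant c0_def by simp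
    also have "(\<Sum>b\<in>Basis. - (x \<bullet> b)\<^sup>2 / 2) = - (norm x)\<^sup>2 / 2"
      unfolding power2_norm_eq_inner euclidean_inner[of x x] by (simp add: power2_eq_square sum_negf flip: sum_divide_distrib)
    finally show ?thesis by (simp add: g_def prod_ennreal normal_density_nonneg)
  qed
  define \<kappa> where "\<kappa> = 1 / (sqrt ((2 * pi) ^ CARD('n) * det S) * c0)"
  have mv: "mvnormal_density S x = \<kappa> * (c0 * exp (- (norm (R *v x))\<^sup>2 / 2))" for x
  proof -
    have "x \<bullet> (matrix_inv S *v x) = (norm (R *v x))\<^sup>2"
      using inner_transpose_matrix_vector[of "transpose R" x "R *v x"]
      by (simp add: inv power2_norm_eq_inner flip: matrix_vector_mul_assoc)
    then show ?thesis using c0 by (simp add: mvnormal_density_def \<kappa>_def)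
  qed
  have mv2: "ennreal (mvnormal_density S x) = ennreal \<kappa> * g (R *v x)" for x
    using c0 by (simp add: mv g ennreal_mult'')
  define G where "G = (\<integral>\<^sup>+x. g (R *v x) \<partial>lborel)"
  have \<gamma>L: "distr (density lborel g) borel (\<lambda>x. L *v x) = density lborel (\<lambda>x. k * g (R *v x))"
  proof -
    have "density lborel g = density lborel (\<lambda>x. g (R *v (L *v x)))"
      by (simp add: matrix_vector_mul_assoc RL)
    then have "distr (density lborel g) borel (\<lambda>x. L *v x) = density (distr lborel borel (\<lambda>x. L *v x)) (\<lambda>x. g (R *v x))"
      by (subst density_distr) auto
    also have "\<dots> = density lborel (\<lambda>x. k * g (R *v x))"
      unfolding k by (rule density_density_eq) auto
    finally show ?thesis .
  qed
  have g1: "(\<integral>\<^sup>+x. g x \<partial>lborel) = 1"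
  proof -
    have "(\<integral>\<^sup>+x. g x \<partial>lborel) = (\<integral>\<^sup>+x. (\<Prod>b\<in>Basis. (\<lambda>_ y. ennreal (std_normal_density y)) b ((x :: real ^ 'n) \<bullet> b)) \<partial>lborel)"
      by (simp add: g_def)
    also have "\<dots> = (\<Prod>b\<in>(Basis :: (real ^ 'n) set). \<integral>\<^sup>+y. ennreal (std_normal_density y) \<partial>lborel)"
      by (rule nn_integral_lborel_prod) auto
    also have "(\<integral>\<^sup>+y. ennreal (std_normal_density y) \<partial>lborel) = 1"
      by (simp add: nn_integral_eq_integral integrable_normal_density normal_density_nonneg integral_normal_density)
    finally show ?thesis by simp
  qed
  have "emeasure (density lborel (\<lambda>x. k * g (R *v x))) UNIV = 1"
    unfolding \<gamma>L[symmetric] by (simp add: emeasure_distr emeasure_density g1)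
  then have kG: "k * G = 1"
    by (simp add: emeasure_density G_def nn_integral_cmult)
  have "emeasure (density lborel (\<lambda>x. ennreal (mvnormal_density S x))) UNIV = 1"
    using prob_space.emeasure_space_1[OF prob] by simp
  then have \<kappa>G: "ennreal \<kappa> * G = 1"
    unfolding mv2 by (simp add: emeasure_density G_def nn_integral_cmult)
  \<comment> \<open>Both densities are multiples of \<open>g (R *v x)\<close> with total mass one,
    so the factors agree. This identifies the Jacobian factor without evaluating
    \<open>det S\<close>.\<close>
  have "k = ennreal \<kappa> * G * k" using \<kappa>G by simp
  also have "\<dots> = ennreal \<kappa> * (k * G)" by (simp add: mult_ac)
  finally have "k = ennreal \<kappa>" using kG by simp
  then have eq: "density lborel (\<lambda>x. ennreal (mvnormal_density S x)) = distr (density lborel g) borel (\<lambda>x. L *v x)"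
    unfolding \<gamma>L mv2 by simp
  define a where "a = onorm (\<lambda>x. S *v x)"
  have bl: "bounded_linear (\<lambda>x. S *v x)" by (rule matrix_vector_mul_bounded_linear)
  have a: "0 < a" unfolding a_def by (rule onorm_positive_definite[OF pd])
  \<comment> \<open>The quadratic form of \<open>S\<close> only controls the transpose of
    \<open>L\<close>. Its bound is carried over to \<open>L\<close> by Cauchy-Schwarz for
    \<open>y = L *v x\<close>, after cancelling the square of \<open>norm y\<close>.\<close>
  have L: "(norm (L *v x))\<^sup>2 \<le> a * (norm x)\<^sup>2" for x
  proof -
    define y where "y = L *v x"
    have "(norm (transpose L *v y))\<^sup>2 = y \<bullet> (S *v y)"
      using inner_transpose_matrix_vector[of L y "transpose L *v y"]
      by (simp add: S power2_norm_eq_inner flip: matrix_vector_mul_assoc)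
    also have "\<dots> \<le> norm y * (a * norm y)"
      unfolding a_def by (rule order_trans[OF norm_cauchy_schwarz mult_left_mono[OF onorm[OF bl]]]) simp
    finally have 1: "(norm (transpose L *v y))\<^sup>2 \<le> a * (norm y)\<^sup>2" by (simp add: power2_eq_square mult_ac)
    have "(norm y)\<^sup>2 = x \<bullet> (transpose L *v y)"
      using inner_transpose_matrix_vector[of L y x]
      by (simp add: power2_norm_eq_inner y_def inner_commute)
    also have "\<dots> \<le> norm x * norm (transpose L *v y)" by (rule norm_cauchy_schwarz)
    finally have "((norm y)\<^sup>2)\<^sup>2 \<le> (norm x * norm (transpose L *v y))\<^sup>2" by (intro power_mono) auto
    also have "\<dots> \<le> (norm x)\<^sup>2 * (a * (norm y)\<^sup>2)"
      using 1 by (simp add: power_mult_distrib mult_left_mono)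
    finally have 2: "(norm y)\<^sup>2 * (norm y)\<^sup>2 \<le> (a * (norm x)\<^sup>2) * (norm y)\<^sup>2" by (simp add: power2_eq_square mult_ac)
    show ?thesis
    proof (cases "y = 0")
      case False
      then have "0 < (norm y)\<^sup>2" by simp
      with 2 show ?thesis unfolding y_def by (simp only: mult_le_cancel_right_pos)
    qed (use a in \<open>auto simp: y_def\<close>)
  qed
  show ?thesis
    unfolding eq a_def[symmetric]
  proof (rule inf_conv_ineq_distr)
    show "inf_conv_ineq (density lborel g) (\<lambda>x y. (norm (x - y))\<^sup>2 / 2)"
      unfolding g_def by (rule inf_conv_ineq_std_normal_euclidean)
    show "(norm (L *v x - L *v y))\<^sup>2 / (2 * a) \<le> (norm (x - y))\<^sup>2 / 2" for x y
      using L[of "x - y"] a by (simp add: matrix_vector_mult_diff_distrib field_simps)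
  qed simp
qed

section \<open>The space of continuous paths\<close>

locale separable_metric =
  fixes m :: "'a metric" and C :: "'a set"
  assumes countable_dense: "countable C" "C \<subseteq> mspace m"
    "\<And>x e. x \<in> mspace m \<Longrightarrow> 0 < e \<Longrightarrow> \<exists>c\<in>C. mdist m c x < e"

lemma space_mborel [simp]: "space (mborel m) = mspace m"
  by (simp add: mborel_def space_measure_of_conv)

lemma openin_mtopology_of_iff:
  "openin (mtopology_of m) U \<longleftrightarrow> U \<subseteq> mspace m \<and> (\<forall>x\<in>U. \<exists>r>0. \<forall>y\<in>mspace m. mdist m x y < r \<longrightarrow> y \<in> U)"
proof -
  interpret Metric_space "mspace m" "mdist m" by (rule Metric_space_mspace_mdist)
  show ?thesis
    unfolding mtopology_of_def openin_mtopology by (fastforce simp: subset_iff mball_def)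
qed

lemma sets_mborelI: "openin (mtopology_of m) U \<Longrightarrow> U \<in> sets (mborel m)"
  unfolding mborel_def
  by (subst sets_measure_of) (auto simp: openin_mtopology_of_iff)

abbreviation mcontinuous :: "'a metric \<Rightarrow> ('a \<Rightarrow> real) \<Rightarrow> bool" where
  "mcontinuous m \<equiv> continuous_map (mtopology_of m) euclideanreal"

lemma mcontinuous_measurable: "mcontinuous m f \<Longrightarrow> f \<in> borel_measurable (mborel m)"
  using openin_continuous_map_preimage[of "mtopology_of m" euclideanreal f]
  by (intro borel_measurableI) (auto simp: vimage_def Int_def conj_commute intro!: sets_mborelI)

lemma mcontinuous_mdist: "c \<in> mspace m \<Longrightarrow> mcontinuous m (mdist m c)"
  using continuous_map_mdist[of "mtopology_of m" m "\<lambda>_. c" "\<lambda>x. x"] by simp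

lemmas measurable_mdist_mborel = mcontinuous_measurable[OF mcontinuous_mdist]

text \<open>An open set is a countable union of balls with centre in \<open>C\<close> and rational
  radius, so distances to the points of \<open>C\<close> decide measurability.\<close>

lemma (in separable_metric) measurable_mborelI:
  assumes f: "f \<in> space N \<rightarrow> mspace m"
    and dist: "\<And>c. c \<in> C \<Longrightarrow> (\<lambda>\<omega>. mdist m c (f \<omega>)) \<in> borel_measurable N"
  shows "f \<in> measurable N (mborel m)"
  unfolding mborel_def
proof (rule measurable_measure_of)
  interpret Metric_space "mspace m" "mdist m" by (rule Metric_space_mspace_mdist)
  fix U assume "U \<in> {U. openin (mtopology_of m) U}"
  then have U: "U \<subseteq> mspace m" "\<And>x. x \<in> U \<Longrightarrow> \<exists>r>0. \<forall>y\<in>mspace m. mdist m x y < r \<longrightarrow> y \<in> U"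
    by (auto simp: openin_mtopology_of_iff)
  define B where "B = {(c, r). c \<in> C \<and> r \<in> \<rat> \<and> (\<forall>y\<in>mspace m. mdist m c y < r \<longrightarrow> y \<in> U)}"
  have "B \<subseteq> C \<times> \<rat>" by (auto simp: B_def)
  then have "countable B" by (rule countable_subset) (auto intro: countable_dense countable_rat)
  moreover have "{\<omega>\<in>space N. mdist m c (f \<omega>) < r} \<in> sets N" if "c \<in> C" for c r
    using dist[OF that] by simp
  ultimately have "(\<Union>(c, r)\<in>B. {\<omega>\<in>space N. mdist m c (f \<omega>) < r}) \<in> sets N"
    by (intro sets.countable_UN') (auto simp: B_def)
  also have "(\<Union>(c, r)\<in>B. {\<omega>\<in>space N. mdist m c (f \<omega>) < r}) = f -` U \<inter> space N"
  proof (intro set_eqI iffI)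
    fix \<omega> assume \<omega>: "\<omega> \<in> f -` U \<inter> space N"
    then have fU: "f \<omega> \<in> U" "f \<omega> \<in> mspace m" using f by auto
    then obtain r where r: "0 < r" "\<And>y. y \<in> mspace m \<Longrightarrow> mdist m (f \<omega>) y < r \<Longrightarrow> y \<in> U" using U by blast
    obtain q where q: "q \<in> \<rat>" "0 < q" "q < r / 2" using Rats_dense_in_real[of 0 "r / 2"] r by auto
    obtain c where c: "c \<in> C" "mdist m c (f \<omega>) < q" using countable_dense(3)[OF fU(2) q(2)] by blast
    have cm: "c \<in> mspace m" using c countable_dense by auto
    have "y \<in> U" if y: "y \<in> mspace m" "mdist m c y < q" for y
    proof (rule r(2)[OF y(1)])
      have "mdist m (f \<omega>) y \<le> mdist m (f \<omega>) c + mdist m c y" by (rule triangle[OF fU(2) cm y(1)])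
      then show "mdist m (f \<omega>) y < r" using c y q commute[of "f \<omega>" c] by simp
    qed
    then have "(c, q) \<in> B" using c q by (auto simp: B_def)
    then show "\<omega> \<in> (\<Union>(c, r)\<in>B. {\<omega>\<in>space N. mdist m c (f \<omega>) < r})" using c \<omega> by auto
  next
    fix \<omega> assume "\<omega> \<in> (\<Union>(c, r)\<in>B. {\<omega>\<in>space N. mdist m c (f \<omega>) < r})"
    then show "\<omega> \<in> f -` U \<inter> space N" using f by (auto simp: B_def)
  qed
  finally show "f -` U \<inter> space N \<in> sets N" .
qed (use f in \<open>auto simp: openin_mtopology_of_iff\<close>)

lemma path_space_iff:
  "f \<in> mspace (path_space T) \<longleftrightarrow> f \<in> extensional {0..T} \<and> continuous_on {0..T} f"
proof -
  have "Met_TC.mbounded (f ` {0..T})" if "continuous_on {0..T} f"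
    using compact_imp_bounded[OF compact_continuous_image[OF that compact_Icc]]
    by (auto simp: Met_TC.mbounded_def bounded_def subset_iff)
  then show ?thesis
    by (auto simp: path_space_def)
qed

lemma mdist_path_space_le:
  assumes "f \<in> mspace (path_space T)" "g \<in> mspace (path_space T)" "0 \<le> T"
  shows "mdist (path_space T) f g \<le> r \<longleftrightarrow> (\<forall>t\<in>{0..T}. dist (f t) (g t) \<le> r)"
  using assms unfolding path_space_def by (subst cfunspace_mdist_le) auto

section \<open>Bernstein approximation of paths\<close>

text \<open>The Bernstein operator rescaled to \<open>[0,T]\<close>, with \<open>v k\<close> read as
  the value at time \<open>k T / N\<close>. It takes arbitrary node values, so that it applies to
  the scheme as well as to a given path.\<close>

definition bernstein_path :: "real \<Rightarrow> nat \<Rightarrow> (nat \<Rightarrow> real ^ 'n) \<Rightarrow> real \<Rightarrow> real ^ 'n" where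
  "bernstein_path T N v = restrict (\<lambda>t. \<Sum>k\<le>N. Bernstein N k (t / T) *\<^sub>R v k) {0..T}"

lemma bernstein_path_mspace: "0 < T \<Longrightarrow> bernstein_path T N v \<in> mspace (path_space T)"
proof -
  assume "0 < T"
  then have "continuous_on {0..T} (\<lambda>t. \<Sum>k\<le>N. Bernstein N k (t / T) *\<^sub>R v k)"
    unfolding Bernstein_def by (auto intro!: continuous_intros)
  then have "continuous_on {0..T} (bernstein_path T N v)"
    by (rule continuous_on_eq) (simp add: bernstein_path_def)
  then show ?thesis by (simp add: path_space_iff bernstein_path_def)
qed

text \<open>Bernstein polynomials are nonnegative and sum to one, so both paths are averages of
  their nodes with the same weights. Through this bound, estimates on the grid become estimates for
  whole paths.\<close>

lemma mdist_bernstein_path_le: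
  assumes T: "0 < T" and r: "\<And>k. k \<le> N \<Longrightarrow> dist (v k) (w k) \<le> r"
  shows "mdist (path_space T) (bernstein_path T N v) (bernstein_path T N w) \<le> r"
proof (subst mdist_path_space_le)
  show "\<forall>t\<in>{0..T}. dist (bernstein_path T N v t) (bernstein_path T N w t) \<le> r"
  proof
    fix t assume t: "t \<in> {0..T}"
    then have tT: "0 \<le> t / T" "t / T \<le> 1" using T by auto
    have "norm (\<Sum>k\<le>N. Bernstein N k (t / T) *\<^sub>R (v k - w k)) \<le> (\<Sum>k\<le>N. Bernstein N k (t / T) * r)"
      using Bernstein_nonneg[OF tT] r
      by (intro sum_norm_le) (auto simp: dist_norm intro!: mult_left_mono)
    also have "\<dots> = r" by (simp flip: sum_distrib_right)
    finally show "dist (bernstein_path T N v t) (bernstein_path T N w t) \<le> r"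
      using t by (simp add: bernstein_path_def dist_norm scaleR_diff_right sum_subtractf)
  qed
qed (use T bernstein_path_mspace in auto)

lemma bernstein_path_tendsto:
  fixes x :: "real \<Rightarrow> real ^ 'n"
  assumes T: "0 < T" and x: "x \<in> mspace (path_space T)"
  shows "(\<lambda>N. mdist (path_space T) (bernstein_path T N (\<lambda>k. x (real k * (T / real N)))) x) \<longlonglongrightarrow> 0"
proof (rule LIMSEQ_I)
  let ?B = "\<lambda>n. bernstein_path T n (\<lambda>k. x (real k * (T / real n)))"
  fix e :: real assume e: "0 < e"
  \<comment> \<open>The scalar theorem is applied to each coordinate; the sum over all coordinates
    then bounds the norm by \<open>e/2\<close>.\<close>
  define d where "d = e / (2 * CARD('n))"
  have d: "0 < d" using e by (simp add: d_def)
  have cont: "continuous_on {0..1} (\<lambda>s. x (s * T) $ i)" for i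
  proof -
    have im: "(\<lambda>s. s * T) ` {0..1} \<subseteq> {0..T}"
      using T mult_right_mono[of _ 1 T] by fastforce
    have c: "continuous_on {0..T} x" using x by (simp add: path_space_iff)
    have "continuous_on {0..1} (\<lambda>s. x (s * T))"
      by (rule continuous_on_compose2[OF c _ im]) (intro continuous_intros)
    then show ?thesis by (intro continuous_intros)
  qed
  have "\<forall>i. \<exists>N. \<forall>n s. N \<le> n \<and> s \<in> {0..1} \<longrightarrow>
      \<bar>x (s * T) $ i - (\<Sum>k\<le>n. x (real k / real n * T) $ i * Bernstein n k s)\<bar> < d"
    using Bernstein_Weierstrass[OF cont d] by blast
  from choice[OF this] obtain N where N: "\<And>i n s. N i \<le> n \<Longrightarrow> s \<in> {0..1} \<Longrightarrow>
      \<bar>x (s * T) $ i - (\<Sum>k\<le>n. x (real k / real n * T) $ i * Bernstein n k s)\<bar> < d"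
    by blast
  show "\<exists>no. \<forall>n\<ge>no. norm (mdist (path_space T) (?B n) x - 0) < e"
  proof (intro exI allI impI)
    fix n assume n: "Max (range N) \<le> n"
    have Nn: "N i \<le> n" for i using n Max_ge[of "range N" "N i"] by simp
    have "mdist (path_space T) (?B n) x \<le> e / 2"
    proof (subst mdist_path_space_le[OF bernstein_path_mspace[OF T] x])
      show "\<forall>t\<in>{0..T}. dist (?B n t) (x t) \<le> e / 2"
      proof
        fix t assume t: "t \<in> {0..T}"
        define s where "s = t / T"
        have s: "s \<in> {0..1}" "s * T = t" using t T by (auto simp: s_def)
        have "norm (x t - ?B n t) \<le>
          (\<Sum>i\<in>UNIV. \<bar>(x t - ?B n t) $ i\<bar>)"
          by (rule norm_le_l1_cart)
        also have "\<dots> \<le> (\<Sum>i\<in>(UNIV :: 'n set). d)"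
        proof (rule sum_mono)
          fix i
          show "\<bar>(x t - ?B n t) $ i\<bar> \<le> d"
            using N[OF Nn s(1), of i] t s(2)
            by (simp add: bernstein_path_def s_def[symmetric] mult.commute)
        qed
        also have "\<dots> = e / 2" by (simp add: d_def)
        finally show "dist (?B n t) (x t) \<le> e / 2"
          by (simp add: dist_norm norm_minus_commute)
      qed
    qed (use T in auto)
    then show "norm (mdist (path_space T) (?B n) x - 0) < e"
      using e by simp
  qed
qed

lemma separable_path_space:
  assumes T: "0 < T"
  obtains C :: "(real \<Rightarrow> real ^ 'n) set" where "separable_metric (path_space T) C"
proof -
  obtain Q :: "(real ^ 'n) set" where Q: "countable Q" "\<And>X. open X \<Longrightarrow> X \<noteq> {} \<Longrightarrow> \<exists>d\<in>Q. d \<in> X"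
    using countable_dense_exists by blast
  \<comment> \<open>Bernstein paths with nodes in a countable dense set. They are dense, because
    every path is close to its own Bernstein path and perturbing the nodes is harmless.\<close>
  define C where "C = (\<Union>N. bernstein_path T N ` (Pi\<^sub>E {..N} (\<lambda>_. Q)))"
  have "separable_metric (path_space T) C"
  proof
    show "countable C" unfolding C_def using Q(1) by (intro countable_UN countable_image countable_PiE) auto
    show "C \<subseteq> mspace (path_space T)" unfolding C_def using bernstein_path_mspace[OF T] by auto
    fix x :: "real \<Rightarrow> real ^ 'n" and e :: real assume x: "x \<in> mspace (path_space T)" and e: "0 < e"
    interpret Metric_space "mspace (path_space T) :: (real \<Rightarrow> real ^ 'n) set" "mdist (path_space T)" by (rule Metric_space_mspace_mdist)
    let ?B = "\<lambda>N. bernstein_path T N (\<lambda>k. x (real k * (T / real N)))"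
    obtain N where N: "mdist (path_space T) (?B N) x < e / 2"
      using LIMSEQ_D[OF bernstein_path_tendsto[OF T x], of "e / 2"] e by auto
    have "\<exists>d\<in>Q. d \<in> ball (x (real k * (T / real N))) (e / 2)" for k
      using e by (intro Q(2)) auto
    then obtain v where v: "\<And>k. v k \<in> Q" "\<And>k. dist (x (real k * (T / real N))) (v k) < e / 2" by (metis mem_ball)
    define c where "c = bernstein_path T N (restrict v {..N})"
    have "mdist (path_space T) c (?B N) \<le> e / 2"
      unfolding c_def using v(2) by (intro mdist_bernstein_path_le[OF T]) (auto simp: dist_commute less_imp_le)
    moreover have "mdist (path_space T) c x \<le> mdist (path_space T) c (?B N)
      + mdist (path_space T) (?B N) x"
      unfolding c_def by (intro triangle bernstein_path_mspace T x)
    moreover have "c \<in> C" unfolding C_def c_def using v(1) by (intro UN_I[of N] imageI) (auto split: if_splits)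
    ultimately show "\<exists>c\<in>C. mdist (path_space T) c x < e" using N by (intro bexI[of _ c]) auto
  qed
  then show ?thesis by (rule that)
qed

text \<open>For continuous paths a bound on the supremum distance can be checked at a countable
  dense set of times, so the evaluations decide measurability.\<close>

lemma measurable_path_spaceI:
  fixes f :: "'w \<Rightarrow> real \<Rightarrow> real ^ 'n"
  assumes T: "0 < T" and f: "f \<in> space N \<rightarrow> mspace (path_space T)"
    and ev: "\<And>t. t \<in> {0..T} \<Longrightarrow> (\<lambda>\<omega>. f \<omega> t) \<in> borel_measurable N"
  shows "f \<in> measurable N (mborel (path_space T))"
proof -
  obtain C :: "(real \<Rightarrow> real ^ 'n) set" where "separable_metric (path_space T) C"
    by (rule separable_path_space[OF T])
  then interpret separable_metric "path_space T" C .
  obtain S where S: "countable S" "S \<subseteq> {0..T}" "{0..T} \<subseteq> closure S"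
    using separable[of "{0..T}"] by blast
  show ?thesis
  proof (rule measurable_mborelI[OF f])
    fix c assume "c \<in> C"
    then have c: "c \<in> mspace (path_space T)" using countable_dense by auto
    show "(\<lambda>\<omega>. mdist (path_space T) c (f \<omega>)) \<in> borel_measurable N"
    proof (rule borel_measurableI_le)
      fix r
      have [measurable]: "(\<lambda>\<omega>. f \<omega> t) \<in> borel_measurable N" if "t \<in> S" for t using ev that S by auto
      have "{\<omega>\<in>space N. \<forall>t\<in>S. dist (c t) (f \<omega> t) \<le> r} \<in> sets N"
        using S(1) by (intro sets.sets_Collect_countable_All') auto
      also have "{\<omega>\<in>space N. \<forall>t\<in>S. dist (c t) (f \<omega> t) \<le> r} = {\<omega>\<in>space N. mdist (path_space T) c (f \<omega>) \<le> r}"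
      proof -
        have "(\<forall>t\<in>S. dist (c t) (f \<omega> t) \<le> r) \<longleftrightarrow> mdist (path_space T) c (f \<omega>) \<le> r" if \<omega>: "\<omega> \<in> space N" for \<omega>
        proof -
          have f\<omega>: "f \<omega> \<in> mspace (path_space T)" using f \<omega> by auto
          have "closure S = {0..T}" using S by (metis closed_atLeastAtMost closure_minimal subset_antisym)
          then have "continuous_on (closure S) (\<lambda>t. dist (c t) (f \<omega> t))"
            using c f\<omega> by (auto simp: path_space_iff intro!: continuous_intros)
          then have "(\<forall>t\<in>S. dist (c t) (f \<omega> t) \<le> r) \<longleftrightarrow> (\<forall>t\<in>closure S. dist (c t) (f \<omega> t) \<le> r)"
            using closure_subset[of S] by (auto intro: continuous_le_on_closure)
          then show ?thesis using \<open>closure S = {0..T}\<close> T by (simp add: mdist_path_space_le[OF c f\<omega>])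
        qed
        then show ?thesis by blast
      qed
      finally show "{\<omega>\<in>space N. mdist (path_space T) c (f \<omega>) \<le> r} \<in> sets N" .
    qed
  qed
qed

section \<open>From the dual inequality to couplings\<close>

text \<open>First order condition at an endpoint: divide by \<open>t\<close> and let
  \<open>t\<close> tend to 0.\<close>

lemma quadratic_nonneg_linear_coeff:
  fixes L q :: real
  assumes "\<And>t. 0 < t \<Longrightarrow> t \<le> 1 \<Longrightarrow> 0 \<le> t * L + t\<^sup>2 * q"
  shows "0 \<le> L"
proof (rule field_le_epsilon)
  fix e :: real assume e: "0 < e"
  define t where "t = min 1 (e / (\<bar>q\<bar> + 1))"
  have t: "0 < t" "t \<le> 1" using e by (auto simp: t_def add_nonneg_pos)
  have "t * q \<le> t * (\<bar>q\<bar> + 1)" using t by (intro mult_left_mono) auto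
  also have "\<dots> \<le> e / (\<bar>q\<bar> + 1) * (\<bar>q\<bar> + 1)" by (intro mult_right_mono) (auto simp: t_def)
  also have "\<dots> = e" by (simp add: add_nonneg_eq_0_iff)
  finally have "t * q \<le> e" .
  moreover have "0 \<le> t * (L + t * q)" using assms[OF t] by (simp add: algebra_simps power2_eq_square)
  then have "0 \<le> L + t * q" using t by (simp add: zero_le_mult_iff)
  ultimately show "0 \<le> L + e" by simp
qed

text \<open>The marginal constraints are relaxed to a quadratic penalty of weight \<open>1/(2\<epsilon>)\<close>; the first order
  condition at a minimizer produces a dual pair that certifies the bound on cost and penalty.\<close>

lemma finite_kantorovich_duality:
  fixes \<mu> \<nu> :: "nat \<Rightarrow> real" and c :: "nat \<Rightarrow> nat \<Rightarrow> real"
  assumes I: "finite I" "I \<noteq> {}" 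
    and \<mu>: "(\<Sum>i\<in>I. \<mu> i) = 1" and \<nu>: "(\<Sum>i\<in>I. \<nu> i) = 1"
    and dual: "\<And>a b. (\<And>i j. i \<in> I \<Longrightarrow> j \<in> I \<Longrightarrow> b j - a i \<le> c i j) \<Longrightarrow>
      (\<Sum>j\<in>I. b j * \<nu> j) - (\<Sum>i\<in>I. a i * \<mu> i) \<le> D"
  obtains p where "\<And>i j. 0 \<le> p (i, j)" "\<And>i. i \<in> I \<Longrightarrow> (\<Sum>j\<in>I. p (i, j)) = \<mu> i"
    "\<And>j. j \<in> I \<Longrightarrow> (\<Sum>i\<in>I. p (i, j)) = \<nu> j" "(\<Sum>i\<in>I. \<Sum>j\<in>I. p (i, j) * c i j) \<le> D"
proof -
  \<comment> \<open>Plans are functions on all of \<open>nat \<times> nat\<close>; forcing them to 0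
    off \<open>I \<times> I\<close> and into \<open>[0,1]\<close> on it makes \<open>K\<close>
    compact by Tychonoff.\<close>
  define K where "K = {p :: nat \<times> nat \<Rightarrow> real. (\<forall>x. p x \<in> (if x \<in> I \<times> I then {0..1} else {0})) \<and> (\<Sum>i\<in>I. \<Sum>j\<in>I. p (i, j)) = 1}"
  define row where "row p i = (\<Sum>j\<in>I. p (i, j))" for p :: "nat \<times> nat \<Rightarrow> real" and i
  define col where "col p j = (\<Sum>i\<in>I. p (i, j))" for p :: "nat \<times> nat \<Rightarrow> real" and j
  define cost where "cost p = (\<Sum>i\<in>I. \<Sum>j\<in>I. p (i, j) * c i j)" for p
  define E where "E p = (\<Sum>i\<in>I. (row p i - \<mu> i)\<^sup>2) + (\<Sum>j\<in>I. (col p j - \<nu> j)\<^sup>2)" for p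
  have E0: "0 \<le> E p" for p unfolding E_def by (intro add_nonneg_nonneg sum_nonneg) auto
  have pij: "continuous_on UNIV (\<lambda>p :: nat \<times> nat \<Rightarrow> real. p x)" for x
    by (rule continuous_on_product_coordinates)
  have cont: "continuous_on UNIV row'" if "row' = (\<lambda>p. row p i) \<or> row' = (\<lambda>p. col p i) \<or> row' = cost" for row' i
    using that unfolding row_def col_def cost_def by (auto intro!: continuous_intros pij)
  have contc: "continuous_on UNIV cost" and contE: "continuous_on UNIV E"
    unfolding E_def using cont by (auto intro!: continuous_intros)
  have "compact (Pi\<^sub>E UNIV (\<lambda>x. if x \<in> I \<times> I then {0..1::real} else {0}))"
    using compactin_PiE[of "\<lambda>_. euclideanreal" UNIV "\<lambda>x. if x \<in> I \<times> I then {0..1::real} else {0}"]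
    by (auto simp: euclidean_product_topology)
  moreover have "closed {p :: nat \<times> nat \<Rightarrow> real. (\<Sum>i\<in>I. \<Sum>j\<in>I. p (i, j)) = 1}"
    by (intro closed_Collect_eq continuous_intros pij)
  moreover have "K = Pi\<^sub>E UNIV (\<lambda>x. if x \<in> I \<times> I then {0..1::real} else {0}) \<inter> {p. (\<Sum>i\<in>I. \<Sum>j\<in>I. p (i, j)) = 1}"
    by (simp add: K_def PiE_UNIV_domain Pi_def Int_def)
  ultimately have K: "compact K" by (simp add: compact_Int_closed)
  define d where "d i0 j0 = (\<lambda>x. if x = (i0, j0) then 1 else 0 :: real)" for i0 j0 :: nat
  have rd: "row (d i0 j0) i = (if i = i0 then 1 else 0)" if "j0 \<in> I" for i0 j0 i
    using that I unfolding row_def d_def by (auto simp: sum.delta)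
  have cd: "col (d i0 j0) j = (if j = j0 then 1 else 0)" if "i0 \<in> I" for i0 j0 j
    using that I unfolding col_def d_def by (auto simp: sum.delta)
  have sd: "(\<Sum>i\<in>I. f i * (if i = i0 then 1 else 0)) = f i0" if "i0 \<in> I" for f :: "nat \<Rightarrow> real" and i0
    using that I by (simp add: if_distrib[of "(*) _"] sum.delta cong: if_cong)
  have costd: "cost (d i0 j0) = c i0 j0" if "i0 \<in> I" "j0 \<in> I" for i0 j0
  proof -
    have "cost (d i0 j0) = (\<Sum>i\<in>I. (\<Sum>j\<in>I. c i j * (if j = j0 then 1 else 0)) * (if i = i0 then 1 else 0))"
      unfolding cost_def d_def sum_distrib_right by (intro sum.cong) auto
    then show ?thesis by (simp only: sd[OF that(1)] sd[OF that(2)])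
  qed
  have dK: "d i0 j0 \<in> K" if "i0 \<in> I" "j0 \<in> I" for i0 j0
    using that rd[OF that(2), of i0] I unfolding K_def by (auto simp: d_def row_def[symmetric] rd[OF that(2), unfolded d_def])
  obtain i0 where i0: "i0 \<in> I" using I by auto
  then have Kne: "K \<noteq> {}" using dK by blast
  have in01: "0 \<le> p x \<and> p x \<le> 1" if "p \<in> K" for p x
  proof -
    have "p x \<in> (if x \<in> I \<times> I then {0..1} else {0})" using that unfolding K_def by blast
    then show ?thesis by (simp split: if_splits)
  qed
  have mixK: "(\<lambda>x. (1 - t) * p x + t * q x) \<in> K" if "p \<in> K" "q \<in> K" "0 < t" "t \<le> 1" for p q t
  proof -
    have "0 \<le> p x" "p x \<le> 1" "0 \<le> q x" "q x \<le> 1" for x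
      using in01[OF that(1), of x] in01[OF that(2), of x] by simp_all
    then have "0 \<le> (1 - t) * p x + t * q x" "(1 - t) * p x + t * q x \<le> 1" for x
      using that convex_bound_le[of "p x" 1 "q x" "1 - t" t] by (auto intro!: add_nonneg_nonneg)
    moreover have "p x = 0" "q x = 0" if "x \<notin> I \<times> I" for x
      using \<open>p \<in> K\<close> \<open>q \<in> K\<close> that unfolding K_def by (metis (mono_tags, lifting) mem_Collect_eq singletonD)+
    ultimately show ?thesis
      using that unfolding K_def by (auto simp: sum.distrib split: if_splits simp flip: sum_distrib_left)
  qed
  \<comment> \<open>The minimization uses the penalty \<open>E p / (2 * e)\<close>, but the
    certified bound contains \<open>E p / e\<close>: differentiating the square yields the factor
    2.\<close>
  have pen: "\<exists>p\<in>K. cost p + E p / e \<le> D" if e: "0 < e" for e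
  proof -
    have "continuous_on K (\<lambda>p. cost p + E p / (2 * e))"
      using e by (intro continuous_intros continuous_on_subset[OF contc] continuous_on_subset[OF contE]) auto
    from continuous_attains_inf[OF K Kne this] obtain p
      where p: "p \<in> K" and min: "\<And>q. q \<in> K \<Longrightarrow> cost p + E p / (2 * e) \<le> cost q + E q / (2 * e)" by blast
    define R C where "R i = row p i - \<mu> i" and "C j = col p j - \<nu> j" for i j
    \<comment> \<open>The derivative at the minimizer \<open>p\<close> towards the unit mass at
      \<open>(i, j)\<close> is \<open>c i j + (R i + C j) / e - \<kappa>\<close>, and minimality
      makes it nonnegative.\<close>
    define \<kappa> where "\<kappa> = cost p + ((\<Sum>i\<in>I. R i * row p i) + (\<Sum>j\<in>I. C j * col p j)) / e"
    have key: "\<kappa> - C j / e - R i / e \<le> c i j" if ij: "i \<in> I" "j \<in> I" for i j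
    proof -
      define R' C' where "R' k = row (d i j) k - row p k" and "C' k = col (d i j) k - col p k" for k
      define q where "q = (\<Sum>k\<in>I. (R' k)\<^sup>2) + (\<Sum>k\<in>I. (C' k)\<^sup>2)"
      define M where "M = (\<Sum>k\<in>I. R k * R' k) + (\<Sum>k\<in>I. C k * C' k)"
      define L where "L = c i j - cost p + M / e"
      have "0 \<le> L"
      proof (rule quadratic_nonneg_linear_coeff)
        fix t :: real assume t: "0 < t" "t \<le> 1"
        define r where "r = (\<lambda>x. (1 - t) * p x + t * d i j x)"
        have rK: "r \<in> K" unfolding r_def by (intro mixK p dK ij t)
        have rowr: "row r k = (1 - t) * row p k + t * row (d i j) k"
          and colr: "col r k = (1 - t) * col p k + t * col (d i j) k" for k
          by (simp_all add: r_def row_def col_def sum.distrib sum_distrib_left)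
        have "row r k - \<mu> k = R k + t * R' k" "col r k - \<nu> k = C k + t * C' k" for k
          by (simp_all add: rowr colr R_def R'_def C_def C'_def algebra_simps)
        then have "E r = E p + 2 * t * ((\<Sum>k\<in>I. R k * R' k) + (\<Sum>k\<in>I. C k * C' k)) + t\<^sup>2 * q"
          unfolding E_def q_def R_def[symmetric] C_def[symmetric]
          by (simp add: power2_sum sum.distrib power_mult_distrib sum_distrib_left algebra_simps)
        moreover have "cost r = (1 - t) * cost p + t * c i j"
          unfolding costd[OF ij, symmetric] r_def cost_def
          by (simp add: sum.distrib distrib_right mult.assoc sum_distrib_left)
        ultimately have "cost p + E p / (2 * e) \<le> (1 - t) * cost p + t * c i j +
            (E p + 2 * t * M + t\<^sup>2 * q) / (2 * e)"
          using min[OF rK] by (simp add: M_def)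
        moreover have "(E p + 2 * t * M + t\<^sup>2 * q) / (2 * e) = E p / (2 * e) + t * (M / e) + t\<^sup>2 * (q / (2 * e))"
          using e by (simp add: add_divide_distrib)
        ultimately have "0 \<le> t * (c i j - cost p) + t * (M / e) + t\<^sup>2 * (q / (2 * e))"
          by (simp add: algebra_simps)
        then show "0 \<le> t * L + t\<^sup>2 * (q / (2 * e))"
          unfolding L_def by (simp add: distrib_left)
      qed
      moreover have "(\<Sum>k\<in>I. R k * R' k) = R i - (\<Sum>k\<in>I. R k * row p k)"
        unfolding R'_def rd[OF ij(2)] right_diff_distrib sum_subtractf sd[OF ij(1)] ..
      moreover have "(\<Sum>k\<in>I. C k * C' k) = C j - (\<Sum>k\<in>I. C k * col p k)"
        unfolding C'_def cd[OF ij(1)] right_diff_distrib sum_subtractf sd[OF ij(2)] ..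
      ultimately show ?thesis
        unfolding L_def M_def \<kappa>_def by (simp add: diff_divide_distrib add_divide_distrib)
    qed
    \<comment> \<open>The dual pair consists of \<open>R i / e\<close> and
      \<open>\<kappa> - C j / e\<close>. Its value is the cost of \<open>p\<close> plus the
      residuals paired with themselves, that is, plus \<open>E p / e\<close>.\<close>
    have "(\<Sum>j\<in>I. (\<kappa> - C j / e) * \<nu> j) - (\<Sum>i\<in>I. R i / e * \<mu> i) \<le> D"
      by (rule dual) (use key in auto)
    also have "(\<Sum>j\<in>I. (\<kappa> - C j / e) * \<nu> j) = \<kappa> - (\<Sum>j\<in>I. C j * \<nu> j) / e"
      using \<nu> by (simp add: left_diff_distrib sum_subtractf sum_divide_distrib flip: sum_distrib_left)
    also have "(\<Sum>i\<in>I. R i / e * \<mu> i) = (\<Sum>i\<in>I. R i * \<mu> i) / e"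
      by (simp add: sum_divide_distrib)
    finally have "cost p + (((\<Sum>i\<in>I. R i * row p i) - (\<Sum>i\<in>I. R i * \<mu> i)) +
       ((\<Sum>j\<in>I. C j * col p j) - (\<Sum>j\<in>I. C j * \<nu> j))) / e \<le> D"
      unfolding \<kappa>_def by (simp add: diff_divide_distrib add_divide_distrib)
    also have "((\<Sum>i\<in>I. R i * row p i) - (\<Sum>i\<in>I. R i * \<mu> i)) +
       ((\<Sum>j\<in>I. C j * col p j) - (\<Sum>j\<in>I. C j * \<nu> j)) = E p"
      unfolding E_def R_def[symmetric] C_def[symmetric]
      by (simp add: R_def C_def power2_eq_square algebra_simps flip: sum_subtractf)
    finally show ?thesis using p by blast
  qed
  \<comment> \<open>Minimize the marginal error among plans of cost at most \<open>D\<close>. Since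
    the cost is bounded below on \<open>K\<close>, the penalized plans in \<open>K'\<close> have
    error of order \<open>e\<close>, so the minimum is 0.\<close>
  define K' where "K' = K \<inter> {p. cost p \<le> D}"
  have "closed {p. cost p \<le> D}" by (intro closed_Collect_le contc continuous_intros)
  then have "compact K'" unfolding K'_def by (rule compact_Int_closed[OF K])
  moreover have inK': "p \<in> K'" if "p \<in> K" "cost p + E p / e \<le> D" "0 < e" for p e
    using that E0[of p] by (auto simp: K'_def intro: order_trans[of "cost p" "cost p + E p / e"])
  then have "K' \<noteq> {}" using pen[of 1] by fastforce
  ultimately obtain p where p: "p \<in> K'" and min: "\<And>q. q \<in> K' \<Longrightarrow> E p \<le> E q"
    using continuous_attains_inf[of K' E] continuous_on_subset[OF contE] by blast
  obtain B where B: "\<And>q. q \<in> K \<Longrightarrow> - B \<le> cost q"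
    using continuous_attains_inf[OF K Kne continuous_on_subset[OF contc]] by (metis minus_minus subset_UNIV)
  have "E p \<le> 0"
  proof (rule field_le_epsilon)
    fix \<delta> :: real assume \<delta>: "0 < \<delta>"
    define e where "e = \<delta> / (\<bar>D + B\<bar> + 1)"
    have e: "0 < e" using \<delta> by (simp add: e_def add_nonneg_pos)
    from pen[OF e] obtain q where q: "q \<in> K" "cost q + E q / e \<le> D" by blast
    have "E p \<le> E q" using min inK'[OF q e] .
    also have "E q / e \<le> D + B" using q B[OF q(1)] by simp
    then have "E q \<le> e * (D + B)" using e by (simp add: field_simps)
    also have "\<dots> \<le> e * (\<bar>D + B\<bar> + 1)" using e by (intro mult_left_mono) auto
    also have "\<dots> = 0 + \<delta>" by (simp add: e_def)
    finally show "E p \<le> 0 + \<delta>" .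
  qed
  then have *: "(\<Sum>i\<in>I. (row p i - \<mu> i)\<^sup>2) = 0" "(\<Sum>j\<in>I. (col p j - \<nu> j)\<^sup>2) = 0"
    unfolding E_def using sum_nonneg[of I "\<lambda>i. (row p i - \<mu> i)\<^sup>2"] sum_nonneg[of I "\<lambda>i. (col p i - \<nu> i)\<^sup>2"] by auto
  show ?thesis
  proof
    show "0 \<le> p (i, j)" for i j using p in01[of p] unfolding K'_def by simp
    show "(\<Sum>j\<in>I. p (i, j)) = \<mu> i" if "i \<in> I" for i
      using *(1) I that by (simp add: sum_nonneg_eq_0_iff row_def)
    show "(\<Sum>i\<in>I. p (i, j)) = \<nu> j" if "j \<in> I" for j
      using *(2) I that by (simp add: sum_nonneg_eq_0_iff col_def)
    show "(\<Sum>i\<in>I. \<Sum>j\<in>I. p (i, j) * c i j) \<le> D" using p by (simp add: K'_def cost_def)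
  qed
qed

section \<open>The Gibbs variational principle\<close>

text \<open>Integrate \<open>ln r \<le> r - 1\<close> against \<open>Q\<close>, with
  \<open>r\<close> the quotient of the tilted density \<open>exp (\<psi> x - b)\<close> by the
  density of \<open>Q\<close>. The integral of \<open>r\<close> is only bounded by 1, since the
  density of \<open>Q\<close> may vanish on part of \<open>P\<close>.\<close>

lemma gibbs_variational:
  fixes \<psi> :: "'a \<Rightarrow> real"
  assumes P: "prob_space P" and Q: "prob_space Q" and sets: "sets Q = sets P"
    and ac: "absolutely_continuous P Q" and int: "integrable Q (entropy_density (exp 1) P Q)"
    and \<psi>: "\<psi> \<in> borel_measurable P" "\<And>x. x \<in> space P \<Longrightarrow> \<bar>\<psi> x\<bar> \<le> K"
  shows "(\<integral>x. \<psi> x \<partial>Q) \<le> ln (\<integral>x. exp (\<psi> x) \<partial>P) + KL_divergence (exp 1) P Q"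
proof -
  let ?I = "\<integral>x. exp (\<psi> x) \<partial>P"
  interpret P: prob_space P by fact
  interpret Q: prob_space Q by fact
  have sp: "space Q = space P" by (rule sets_eq_imp_space_eq[OF sets])
  obtain D where D[measurable]: "D \<in> borel_measurable P" and eq: "AE x in P. RN_deriv P Q x = ennreal (D x)"
    and pos: "AE x in Q. 0 < D x" and D0: "\<And>x. 0 \<le> D x"
    using P.real_RN_deriv[OF Q.finite_measure_axioms ac sets] by blast
  have QD: "Q = density P (\<lambda>x. ennreal (D x))"
    using P.density_RN_deriv[OF ac sets] density_cong[OF _ _ eq] by simp
  note [measurable] = \<psi>(1)
  have \<psi>K: "- K \<le> \<psi> x" "\<psi> x \<le> K" if "x \<in> space P" for x using \<psi>(2)[OF that] by auto
  define b where "b = ln ?I"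
  have int\<psi>: "integrable P (\<lambda>x. exp (\<psi> x))"
    by (rule P.integrable_const_bound[where B="exp K"]) (use \<psi>K in auto)
  have "exp (- K) \<le> ?I"
    using \<psi>K by (intro P.integral_ge_const[OF int\<psi>] AE_I2) auto
  then have eb: "exp b = ?I" unfolding b_def using less_le_trans[OF exp_gt_zero] by (intro exp_ln) blast
  have "AE x in Q. RN_deriv P Q x = ennreal (D x)"
    by (rule absolutely_continuous_AE[OF sets ac eq])
  then have ed: "AE x in Q. entropy_density (exp 1) P Q x = ln (D x)"
    by eventually_elim (use D0 in \<open>simp add: entropy_density_def log_def\<close>)
  have [measurable_cong]: "sets Q = sets P" by (rule sets)
  have intln: "integrable Q (\<lambda>x. ln (D x))" and KL: "KL_divergence (exp 1) P Q = (\<integral>x. ln (D x) \<partial>Q)"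
    using int ed unfolding KL_divergence_def
    by (auto intro!: integral_cong_AE intro: integrable_cong_AE_imp measurable_entropy_density simp: sets cong: measurable_cong_sets)
  let ?r = "\<lambda>x. exp (\<psi> x - b) / D x"
  have nn: "(\<integral>\<^sup>+x. ennreal (?r x) \<partial>Q) \<le> 1"
  proof -
    have "(\<integral>\<^sup>+x. ennreal (?r x) \<partial>Q) = (\<integral>\<^sup>+x. ennreal (D x) * ennreal (?r x) \<partial>P)"
      unfolding QD by (rule nn_integral_density) auto
    also have "\<dots> \<le> (\<integral>\<^sup>+x. ennreal (exp (\<psi> x - b)) \<partial>P)"
      using D0 by (intro nn_integral_mono) (auto simp flip: ennreal_mult intro!: ennreal_leI)
    also have "\<dots> = ennreal (\<integral>x. exp (\<psi> x - b) \<partial>P)"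
      using int\<psi> by (intro nn_integral_eq_integral) (auto simp: exp_diff)
    also have "(\<integral>x. exp (\<psi> x - b) \<partial>P) = 1"
      by (simp add: exp_diff eb[symmetric])
    finally show ?thesis by simp
  qed
  have int2: "integrable Q (\<lambda>x. ?r x)"
    using nn D0 by (intro integrableI_bounded) (auto simp: abs_of_nonneg le_less_trans[OF nn])
  have le1: "(\<integral>x. ?r x \<partial>Q) \<le> 1"
    using nn D0 by (subst integral_eq_nn_integral) (auto intro: enn2real_leI)
  have int3: "integrable Q \<psi>"
    by (rule Q.integrable_const_bound[where B=K]) (use \<psi>(2) in \<open>auto simp: sp\<close>)
  have "(\<integral>x. \<psi> x - b - ln (D x) \<partial>Q) \<le> (\<integral>x. ?r x - 1 \<partial>Q)"
  proof (rule integral_mono_AE)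
    show "AE x in Q. \<psi> x - b - ln (D x) \<le> ?r x - 1"
      using pos
    proof eventually_elim
      case (elim x)
      have "\<psi> x - b - ln (D x) = ln (?r x)" using elim by (simp add: ln_div)
      also have "\<dots> \<le> ?r x - 1" using elim by (intro ln_le_minus_one) simp
      finally show ?case .
    qed
  qed (use int2 int3 intln in auto)
  also have "\<dots> \<le> 0" using le1 int2 by (simp add: Q.prob_space)
  finally show ?thesis
    using int3 intln by (simp add: Q.prob_space KL b_def)
qed

section \<open>Couplings from finite plans\<close>

lemma (in prob_space) integral_finite_range:
  fixes f :: "nat \<Rightarrow> real"
  assumes q: "q \<in> measurable M (count_space UNIV)" "\<And>x. q x \<le> N"
  shows "integrable M (\<lambda>x. f (q x))" "(\<integral>x. f (q x) \<partial>M) = (\<Sum>i\<le>N. f i * measure M (q -` {i} \<inter> space M))"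
proof -
  have S: "q -` {i} \<inter> space M \<in> sets M" for i by (rule measurable_sets[OF q(1)]) simp
  have eq: "f (q x) = (\<Sum>i\<le>N. f i * indicator (q -` {i} \<inter> space M) x)" if "x \<in> space M" for x
  proof -
    have "(\<Sum>i\<le>N. f i * indicator (q -` {i} \<inter> space M) x) = (\<Sum>i\<le>N. if i = q x then f i else 0)"
      using that by (intro sum.cong) (auto simp: indicator_def)
    then show ?thesis using q(2)[of x] by simp
  qed
  have int: "integrable M (\<lambda>x. f i * indicator (q -` {i} \<inter> space M) x)" for i
    by (intro integrable_mult_right integrable_real_indicator S) (auto simp: emeasure_eq_measure)
  have "integrable M (\<lambda>x. \<Sum>i\<le>N. f i * indicator (q -` {i} \<inter> space M) x)"
    by (intro Bochner_Integration.integrable_sum int)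
  then show "integrable M (\<lambda>x. f (q x))"
    using eq by (subst Bochner_Integration.integrable_cong[OF refl]) auto
  have "(\<integral>x. f (q x) \<partial>M) = (\<integral>x. (\<Sum>i\<le>N. f i * indicator (q -` {i} \<inter> space M) x) \<partial>M)"
    by (intro Bochner_Integration.integral_cong refl eq)
  also have "\<dots> = (\<Sum>i\<le>N. f i * measure M (q -` {i} \<inter> space M))"
    by (subst Bochner_Integration.integral_sum[OF int]) (simp add: S)
  finally show "(\<integral>x. f (q x) \<partial>M) = (\<Sum>i\<le>N. f i * measure M (q -` {i} \<inter> space M))" .
qed

text \<open>Given the blocks, the two coordinates are independent. So the coupling has a density with
  respect to \<open>P \<Otimes>\<^sub>M Q\<close>, and no disintegration is needed to build it.\<close>

lemma block_coupling:
  fixes p :: "nat \<times> nat \<Rightarrow> real" and q :: "'a \<Rightarrow> nat"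
  assumes P: "prob_space P" and Q: "prob_space Q" and sets: "sets Q = sets P"
    and q: "q \<in> measurable P (count_space UNIV)" "\<And>x. q x \<le> N"
    and p0: "\<And>i j. 0 \<le> p (i, j)"
    and row: "\<And>i. i \<le> N \<Longrightarrow> (\<Sum>j\<le>N. p (i, j)) = measure P (q -` {i} \<inter> space P)"
    and col: "\<And>j. j \<le> N \<Longrightarrow> (\<Sum>i\<le>N. p (i, j)) = measure Q (q -` {j} \<inter> space Q)"
  obtains \<pi> where "\<pi> \<in> couplings P Q"
    "\<And>c. (\<And>i j. 0 \<le> c i j) \<Longrightarrow> (\<integral>\<^sup>+(x, y). ennreal (c (q x) (q y)) \<partial>\<pi>) = ennreal (\<Sum>i\<le>N. \<Sum>j\<le>N. p (i, j) * c i j)"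
proof -
  interpret P: prob_space P by fact
  interpret Q: prob_space Q by fact
  interpret PQ: pair_prob_space P Q ..
  note [measurable] = q(1)
  have q_Q[measurable]: "q \<in> measurable Q (count_space UNIV)" using q(1) sets by (simp cong: measurable_cong_sets)
  define \<mu> \<nu> where "\<mu> i = measure P (q -` {i} \<inter> space P)" and "\<nu> j = measure Q (q -` {j} \<inter> space Q)" for i j
  \<comment> \<open>On null blocks the division yields 0. The plan vanishes there too, so
    \<open>k i j * \<mu> i * \<nu> j = p (i, j)\<close> holds for all blocks.\<close>
  define k where "k i j = p (i, j) / (\<mu> i * \<nu> j)" for i j
  have \<mu>0: "0 \<le> \<mu> i" and \<nu>0: "0 \<le> \<nu> i" for i by (auto simp: \<mu>_def \<nu>_def)
  have k0: "0 \<le> k i j" for i j using p0 \<mu>0 \<nu>0 by (simp add: k_def)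
  have simple: "(\<integral>\<^sup>+x. ennreal (f (q x)) \<partial>R) = ennreal (\<Sum>i\<le>N. f i * measure R (q -` {i} \<inter> space R))"
    if "prob_space R" and [measurable]: "q \<in> measurable R (count_space UNIV)" and f: "\<And>i. 0 \<le> f i" for R and f :: "nat \<Rightarrow> real"
  proof -
    interpret R: prob_space R by fact
    have "(\<integral>\<^sup>+x. ennreal (f (q x)) \<partial>R) = ennreal (\<integral>x. f (q x) \<partial>R)"
      using R.integral_finite_range(1)[OF that(2) q(2)] f by (intro nn_integral_eq_integral) auto
    then show ?thesis by (simp only: R.integral_finite_range(2)[OF that(2) q(2)])
  qed
  have sP: "(\<integral>\<^sup>+x. ennreal (f (q x)) \<partial>P) = ennreal (\<Sum>i\<le>N. f i * \<mu> i)" if "\<And>i. 0 \<le> f i" for f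
    unfolding \<mu>_def by (rule simple[OF P q(1) that])
  have sQ: "(\<integral>\<^sup>+x. ennreal (f (q x)) \<partial>Q) = ennreal (\<Sum>i\<le>N. f i * \<nu> i)" if "\<And>i. 0 \<le> f i" for f
    unfolding \<nu>_def by (rule simple[OF Q q_Q that])
  have p\<mu>: "p (i, j) = 0" if "i \<le> N" "j \<le> N" "\<mu> i = 0" for i j
    using row[OF that(1)] that p0 by (simp add: \<mu>_def[symmetric] sum_nonneg_eq_0_iff)
  have p\<nu>: "p (i, j) = 0" if "i \<le> N" "j \<le> N" "\<nu> j = 0" for i j
    using col[OF that(2)] that p0 by (simp add: \<nu>_def[symmetric] sum_nonneg_eq_0_iff)
  \<comment> \<open>Almost every point lies in a block of positive mass, and there the conditional
    densities integrate to one.\<close>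
  have pos: "AE x in R. measure R (q -` {q x} \<inter> space R) \<noteq> 0"
    if "prob_space R" and [measurable]: "q \<in> measurable R (count_space UNIV)" for R
  proof -
    interpret R: prob_space R by fact
    have "AE x in R. \<forall>i\<in>{..N}. measure R (q -` {i} \<inter> space R) = 0 \<longrightarrow> q x \<noteq> i"
    proof (intro AE_finite_allI)
      fix i
      show "AE x in R. measure R (q -` {i} \<inter> space R) = 0 \<longrightarrow> q x \<noteq> i"
      proof (cases "measure R (q -` {i} \<inter> space R) = 0")
        case True
        then have "q -` {i} \<inter> space R \<in> null_sets R" by (auto simp: null_sets_def R.emeasure_eq_measure)
        from AE_not_in[OF this] AE_space show ?thesis by eventually_elim auto
      qed simp
    qed simp
    then show ?thesis by eventually_elim (use q(2) in auto)
  qed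
  have in1: "(\<integral>\<^sup>+y. ennreal (k i (q y)) \<partial>Q) = 1" if "i \<le> N" "\<mu> i \<noteq> 0" for i
  proof -
    have "(\<Sum>j\<le>N. k i j * \<nu> j) = (\<Sum>j\<le>N. p (i, j) / \<mu> i)"
      using p\<nu> that by (intro sum.cong) (auto simp: k_def)
    also have "\<dots> = 1" using row[OF that(1)] that(2) by (simp add: \<mu>_def flip: sum_divide_distrib)
    finally show ?thesis by (simp add: sQ k0)
  qed
  have in2: "(\<integral>\<^sup>+x. ennreal (k (q x) j) \<partial>P) = 1" if "j \<le> N" "\<nu> j \<noteq> 0" for j
  proof -
    have "(\<Sum>i\<le>N. k i j * \<mu> i) = (\<Sum>i\<le>N. p (i, j) / \<nu> j)"
      using p\<mu> that by (intro sum.cong) (auto simp: k_def)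
    also have "\<dots> = 1" using col[OF that(1)] that(2) by (simp add: \<nu>_def flip: sum_divide_distrib)
    finally show ?thesis by (simp add: sP[of "\<lambda>i. k i j"] k0)
  qed
  define \<pi> where "\<pi> = density (P \<Otimes>\<^sub>M Q) (\<lambda>(x, y). ennreal (k (q x) (q y)))"
  have ndens: "(\<integral>\<^sup>+z. F z \<partial>\<pi>) = (\<integral>\<^sup>+z. ennreal (k (q (fst z)) (q (snd z))) * F z \<partial>(P \<Otimes>\<^sub>M Q))"
    if "F \<in> borel_measurable (P \<Otimes>\<^sub>M Q)" for F
    unfolding \<pi>_def using that by (subst nn_integral_density) (auto simp: case_prod_beta')
  have fst: "(\<integral>\<^sup>+z. f (fst z) \<partial>\<pi>) = (\<integral>\<^sup>+x. f x \<partial>P)" if [measurable]: "f \<in> borel_measurable P" for f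
  proof -
    have "(\<integral>\<^sup>+z. f (fst z) \<partial>\<pi>) = (\<integral>\<^sup>+x. (\<integral>\<^sup>+y. ennreal (k (q x) (q y)) * f x \<partial>Q) \<partial>P)"
      by (subst ndens, measurable, subst Q.nn_integral_fst[symmetric]) auto
    also have "\<dots> = (\<integral>\<^sup>+x. (\<integral>\<^sup>+y. ennreal (k (q x) (q y)) \<partial>Q) * f x \<partial>P)"
      by (intro nn_integral_cong nn_integral_multc) simp
    also have "\<dots> = (\<integral>\<^sup>+x. f x \<partial>P)"
      using pos[OF P q(1)] by (intro nn_integral_cong_AE, eventually_elim) (use q(2) in \<open>simp add: in1 \<mu>_def\<close>)
    finally show ?thesis .
  qed
  have snd: "(\<integral>\<^sup>+z. f (snd z) \<partial>\<pi>) = (\<integral>\<^sup>+y. f y \<partial>Q)" if [measurable]: "f \<in> borel_measurable Q" for f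
  proof -
    have "(\<integral>\<^sup>+z. f (snd z) \<partial>\<pi>) = (\<integral>\<^sup>+y. (\<integral>\<^sup>+x. ennreal (k (q x) (q y)) * f y \<partial>P) \<partial>Q)"
      by (subst ndens, measurable, subst PQ.nn_integral_snd[symmetric]) auto
    also have "\<dots> = (\<integral>\<^sup>+y. (\<integral>\<^sup>+x. ennreal (k (q x) (q y)) \<partial>P) * f y \<partial>Q)"
      by (intro nn_integral_cong nn_integral_multc) simp
    also have "\<dots> = (\<integral>\<^sup>+y. f y \<partial>Q)"
      using pos[OF Q q_Q] by (intro nn_integral_cong_AE, eventually_elim) (use q(2) in \<open>simp add: in2 \<nu>_def\<close>)
    finally show ?thesis .
  qed
  have s\<pi>: "sets \<pi> = sets (P \<Otimes>\<^sub>M Q)" by (simp add: \<pi>_def)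
  have [measurable]: "fst \<in> measurable \<pi> P" "snd \<in> measurable \<pi> Q"
    by (simp_all add: measurable_cong_sets[OF s\<pi> refl])
  have distr: "distr \<pi> R h = R" if [measurable]: "h \<in> measurable \<pi> R"
    and eq: "\<And>f. f \<in> borel_measurable R \<Longrightarrow> (\<integral>\<^sup>+z. f (h z) \<partial>\<pi>) = (\<integral>\<^sup>+x. f x \<partial>R)" for R h
  proof (rule measure_eqI)
    fix A assume "A \<in> sets (distr \<pi> R h)"
    then have [measurable]: "A \<in> sets R" by simp
    have "emeasure (distr \<pi> R h) A = (\<integral>\<^sup>+x. indicator A x \<partial>distr \<pi> R h)" by simp
    also have "\<dots> = (\<integral>\<^sup>+z. indicator A (h z) \<partial>\<pi>)" by (rule nn_integral_distr) auto
    also have "\<dots> = emeasure R A" by (subst eq) auto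
    finally show "emeasure (distr \<pi> R h) A = emeasure R A" .
  qed simp
  have "prob_space \<pi>"
  proof
    have "emeasure \<pi> (space \<pi>) = (\<integral>\<^sup>+z. 1 \<partial>\<pi>)" by simp
    also have "\<dots> = 1" using fst[of "\<lambda>_. 1"] by (simp add: P.emeasure_space_1)
    finally show "emeasure \<pi> (space \<pi>) = 1" .
  qed
  then have "\<pi> \<in> couplings P Q" by (simp add: couplings_def s\<pi> distr fst snd)
  moreover have "(\<integral>\<^sup>+(x, y). ennreal (c (q x) (q y)) \<partial>\<pi>) = ennreal (\<Sum>i\<le>N. \<Sum>j\<le>N. p (i, j) * c i j)"
    if c: "\<And>i j. 0 \<le> c i j" for c
  proof -
    have "(\<integral>\<^sup>+(x, y). ennreal (c (q x) (q y)) \<partial>\<pi>) = (\<integral>\<^sup>+x. (\<integral>\<^sup>+y. ennreal (k (q x) (q y) * c (q x) (q y)) \<partial>Q) \<partial>P)"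
      by (subst ndens, measurable, subst Q.nn_integral_fst[symmetric]) (auto simp: ennreal_mult k0 c)
    also have "\<dots> = (\<integral>\<^sup>+x. ennreal (\<Sum>j\<le>N. k (q x) j * c (q x) j * \<nu> j) \<partial>P)"
      using sQ[of "\<lambda>j. k (q _) j * c (q _) j"] by (intro nn_integral_cong) (simp add: sQ k0 c)
    also have "\<dots> = ennreal (\<Sum>i\<le>N. (\<Sum>j\<le>N. k i j * c i j * \<nu> j) * \<mu> i)"
      by (rule sP) (auto intro!: sum_nonneg mult_nonneg_nonneg k0 c \<nu>0)
    also have "(\<Sum>i\<le>N. (\<Sum>j\<le>N. k i j * c i j * \<nu> j) * \<mu> i) = (\<Sum>i\<le>N. \<Sum>j\<le>N. p (i, j) * c i j)"
      unfolding sum_distrib_right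
    proof (intro sum.cong refl)
      fix i j assume "i \<in> {..N}" "j \<in> {..N}"
      then show "k i j * c i j * \<nu> j * \<mu> i = p (i, j) * c i j"
        using p\<mu>[of i j] p\<nu>[of i j] by (auto simp: k_def)
    qed
    finally show ?thesis .
  qed
  ultimately show ?thesis by (rule that)
qed

section \<open>Continuous test functions and quantization\<close>

lemma mcontinuous_tendsto:
  assumes "mcontinuous m f" "\<And>n. u n \<in> mspace m" "x \<in> mspace m" "(\<lambda>n. mdist m (u n) x) \<longlonglongrightarrow> 0"
  shows "(\<lambda>n. f (u n)) \<longlonglongrightarrow> f x"
proof -
  interpret Metric_space "mspace m" "mdist m" by (rule Metric_space_mspace_mdist)
  have "limitin (mtopology_of m) u x sequentially"
    using assms(2-4) by (simp add: mtopology_of_def limitin_metric_dist_null)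
  from continuous_map_limit[OF assms(1) this] show ?thesis by (simp add: comp_def)
qed

lemma mcontinuous_quadratic:
  assumes "c \<in> mspace m"
  shows "mcontinuous m (\<lambda>x. a + b * (mdist m c x)\<^sup>2)"
  using mcontinuous_mdist[OF assms]
  by (intro continuous_map_add continuous_map_real_mult continuous_map_real_pow) auto

lemma mcontinuous_Min:
  "(\<And>i. i \<le> N \<Longrightarrow> mcontinuous m (f i)) \<Longrightarrow> mcontinuous m (\<lambda>x. Min ((\<lambda>i. f i x) ` {..N::nat}))"
  by (induction N) (simp_all add: atMost_0 atMost_Suc continuous_map_real_min)

lemma mcontinuous_Max:
  "(\<And>i. i \<le> N \<Longrightarrow> mcontinuous m (f i)) \<Longrightarrow> mcontinuous m (\<lambda>x. Max ((\<lambda>i. f i x) ` {..N::nat}))"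
  by (induction N) (simp_all add: atMost_0 atMost_Suc continuous_map_real_max)

text \<open>Points that are not close to one of the first \<open>N\<close> centres are all sent to
  \<open>x0\<close>. Their error is the squared distance to \<open>x0\<close> on a set that shrinks
  to the empty set, so finite second moments and dominated convergence make it small, for
  \<open>P\<close> and \<open>Q\<close> with a common \<open>N\<close>.\<close>

lemma (in separable_metric) finite_quantization:
  assumes P: "prob_space P" "sets P = sets (mborel m)" and Q: "prob_space Q" "sets Q = sets (mborel m)"
    and x0: "x0 \<in> mspace m" 
    and momP: "(\<integral>\<^sup>+x. ennreal ((mdist m x0 x)\<^sup>2) \<partial>P) < \<infinity>"
    and momQ: "(\<integral>\<^sup>+x. ennreal ((mdist m x0 x)\<^sup>2) \<partial>Q) < \<infinity>"
    and \<eta>: "0 < \<eta>"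
  obtains N :: nat and q :: "'a \<Rightarrow> nat" and e :: "nat \<Rightarrow> 'a"
  where "q \<in> measurable (mborel m) (count_space UNIV)" "\<And>x. q x \<le> N" "\<And>i. e i \<in> mspace m"
    "(\<integral>\<^sup>+x. ennreal ((mdist m (e (q x)) x)\<^sup>2) \<partial>P) \<le> ennreal \<eta>"
    "(\<integral>\<^sup>+x. ennreal ((mdist m (e (q x)) x)\<^sup>2) \<partial>Q) \<le> ennreal \<eta>"
proof -
  \<comment> \<open>Half of \<open>\<eta>\<close> is allotted to the points near a centre, half to
    the others.\<close>
  define d where "d = sqrt (\<eta> / 2)"
  have d: "0 < d" "d\<^sup>2 = \<eta> / 2" using \<eta> by (auto simp: d_def)
  have "C \<noteq> {}" using countable_dense(3)[OF x0, of 1] by auto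
  then have C: "range (from_nat_into C) = C" by (rule range_from_nat_into) (rule countable_dense)
  \<comment> \<open>Index 0 is reserved for \<open>x0\<close>, because 0 is the default value of
    \<open>q\<close>.\<close>
  define e where "e k = (case k of 0 \<Rightarrow> x0 | Suc k \<Rightarrow> from_nat_into C k)" for k
  have e: "e i \<in> mspace m" for i
    using x0 C countable_dense(2) by (auto simp: e_def split: nat.split)
  have ex: "\<exists>k. mdist m (e k) x < d" if x: "x \<in> mspace m" for x
  proof -
    obtain c where "c \<in> C" "mdist m c x < d" using countable_dense(3)[OF x d(1)] by blast
    moreover from this obtain k where "c = from_nat_into C k" using C by (metis rangeE)
    ultimately show ?thesis by (intro exI[of _ "Suc k"]) (simp add: e_def)
  qed
  define good where "good N x \<longleftrightarrow> (\<exists>k\<le>N. mdist m (e k) x < d)" for N x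
  define q where "q N x = (if good N x then LEAST k. mdist m (e k) x < d else 0)" for N x
  have [measurable]: "mdist m (e k) \<in> borel_measurable (mborel m)" for k by (rule measurable_mdist_mborel[OF e])
  have [measurable]: "Measurable.pred (mborel m) (good N)" for N unfolding good_def by measurable
  have q_m: "q N \<in> measurable (mborel m) (count_space UNIV)" for N unfolding q_def by measurable
  have q_N: "q N x \<le> N" for N x
    unfolding q_def good_def by (auto intro: Least_le order_trans)
  have e0: "e 0 = x0" by (simp add: e_def)
  have bound: "(mdist m (e (q N x)) x)\<^sup>2 \<le> d\<^sup>2 + indicator {x. \<not> good N x} x * (mdist m x0 x)\<^sup>2" for N x
  proof (cases "good N x")
    case True
    then have "mdist m (e (q N x)) x < d" unfolding q_def good_def by (auto intro: LeastI)
    then have "(mdist m (e (q N x)) x)\<^sup>2 \<le> d\<^sup>2" by (intro power_mono) auto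
    with True show ?thesis by simp
  qed (simp add: q_def e0)
  let ?E = "\<lambda>N R. (\<integral>\<^sup>+x. ennreal ((mdist m (e (q N x)) x)\<^sup>2) \<partial>R)"
  let ?b = "\<lambda>N x. ennreal (indicator {x. \<not> good N x} x * (mdist m x0 x)\<^sup>2)"
  have lim: "eventually (\<lambda>N. ?E N R \<le> ennreal \<eta>) sequentially"
    if R: "prob_space R" "sets R = sets (mborel m)" and mom: "(\<integral>\<^sup>+x. ennreal ((mdist m x0 x)\<^sup>2) \<partial>R) < \<infinity>" for R
  proof -
    interpret R: prob_space R by (rule R)
    note [measurable_cong] = R(2)
    have sp: "space R = mspace m" using sets_eq_imp_space_eq[OF R(2)] by simp
    have [measurable]: "mdist m x0 \<in> borel_measurable R" unfolding e0[symmetric] by measurable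
    have "(\<lambda>N. \<integral>\<^sup>+x. ?b N x \<partial>R) \<longlonglongrightarrow> (\<integral>\<^sup>+x. 0 \<partial>R)"
    proof (rule nn_integral_dominated_convergence[where w="\<lambda>x. ennreal ((mdist m x0 x)\<^sup>2)"])
      show "AE x in R. ?b N x \<le> ennreal ((mdist m x0 x)\<^sup>2)" for N
        by (intro AE_I2 ennreal_leI) (auto simp: indicator_def)
      show "AE x in R. (\<lambda>N. ?b N x) \<longlonglongrightarrow> 0"
      proof (intro AE_I2)
        fix x assume "x \<in> space R"
        then obtain k where "mdist m (e k) x < d" using ex sp by blast
        then have "good N x" if "k \<le> N" for N using that by (auto simp: good_def)
        then have "eventually (\<lambda>N. ?b N x = 0) sequentially"
          unfolding eventually_sequentially by (intro exI[of _ k]) auto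
        then show "(\<lambda>N. ?b N x) \<longlonglongrightarrow> 0"
          by (rule tendsto_eventually)
      qed
    qed (use mom in auto)
    then have "eventually (\<lambda>N. (\<integral>\<^sup>+x. ?b N x \<partial>R) < ennreal (\<eta> / 2)) sequentially"
      using \<eta> by (intro order_tendstoD(2)) auto
    then show ?thesis
    proof eventually_elim
      case (elim N)
      have "?E N R \<le>
          (\<integral>\<^sup>+x. ennreal (d\<^sup>2) + ?b N x \<partial>R)"
        by (intro nn_integral_mono) (simp add: bound ennreal_leI flip: ennreal_plus)
      also have "\<dots> = ennreal (d\<^sup>2) + (\<integral>\<^sup>+x. ?b N x \<partial>R)"
        by (subst nn_integral_add) (auto simp: R.emeasure_space_1)
      also have "\<dots> \<le> ennreal (\<eta> / 2) + ennreal (\<eta> / 2)"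
        using elim d by (intro add_mono) auto
      also have "\<dots> = ennreal \<eta>" using \<eta> by (simp flip: ennreal_plus)
      finally show ?case .
    qed
  qed
  have "eventually (\<lambda>N. ?E N P \<le> ennreal \<eta> \<and>
      ?E N Q \<le> ennreal \<eta>) sequentially"
    using lim[OF P momP] lim[OF Q momQ] by (rule eventually_conj)
  then obtain N where "?E N P \<le> ennreal \<eta>"
      "?E N Q \<le> ennreal \<eta>"
    by (auto simp: eventually_sequentially)
  then show ?thesis by (rule that[OF q_m q_N e])
qed

text \<open>The leading factor can be taken arbitrarily close to 1, so that quantization does not
  affect the constant in the limit.\<close>

lemma power2_sum_le:
  fixes s u \<delta> :: real
  assumes "0 < \<delta>"
  shows "(s + u)\<^sup>2 \<le> (1 + \<delta>) * (s\<^sup>2 + u\<^sup>2 / \<delta>)"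
proof -
  have "0 \<le> (\<delta> * s - u)\<^sup>2 / \<delta>" using assms by simp
  also have "\<dots> = (1 + \<delta>) * (s\<^sup>2 + u\<^sup>2 / \<delta>) - (s + u)\<^sup>2"
    using assms by (simp add: power2_eq_square field_simps)
  finally show ?thesis by simp
qed

text \<open>Serves in both directions: it extends a dual pair from the representatives to the space,
  and it bounds the cost between points by the cost between their representatives.\<close>

lemma mdist_comparison:
  assumes "x \<in> mspace m" "y \<in> mspace m" "a \<in> mspace m" "b \<in> mspace m" "0 < \<delta>"
  shows "(mdist m a b)\<^sup>2 \<le> (1 + \<delta>) * ((mdist m x y)\<^sup>2 + 2 / \<delta> * ((mdist m a x)\<^sup>2 + (mdist m b y)\<^sup>2))"
proof -
  interpret Metric_space "mspace m" "mdist m" by (rule Metric_space_mspace_mdist)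
  have "mdist m a b \<le> mdist m x y + (mdist m a x + mdist m b y)"
    using triangle[OF assms(3,1,4)] triangle[OF assms(1,2,4)] by (simp add: commute)
  then have "(mdist m a b)\<^sup>2 \<le> (mdist m x y + (mdist m a x + mdist m b y))\<^sup>2"
    by (intro power_mono) auto
  also have "\<dots> \<le> (1 + \<delta>) * ((mdist m x y)\<^sup>2 + (mdist m a x + mdist m b y)\<^sup>2 / \<delta>)"
    by (rule power2_sum_le) fact
  also have "\<dots> \<le> (1 + \<delta>) * ((mdist m x y)\<^sup>2 + (2 * ((mdist m a x)\<^sup>2 + (mdist m b y)\<^sup>2)) / \<delta>)"
    using assms(5) power2_sum_le[of 1 "mdist m a x" "mdist m b y"]
    by (intro mult_left_mono add_left_mono divide_right_mono) auto
  finally show ?thesis by simp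
qed

section \<open>Consequences of the dual inequality for \<open>P\<close> and \<open>Q\<close>\<close>

text \<open>Restricting the test functions to continuous ones lets the inequality pass to limits of
  random paths that converge almost surely.\<close>

definition cont_inf_conv_ineq :: "'a metric \<Rightarrow> 'a measure \<Rightarrow> real \<Rightarrow> bool" where
  "cont_inf_conv_ineq m P \<kappa> \<longleftrightarrow> (\<forall>\<phi> \<psi> K. mcontinuous m \<phi> \<longrightarrow> mcontinuous m \<psi> \<longrightarrow>
     (\<forall>x\<in>mspace m. \<bar>\<phi> x\<bar> \<le> K \<and> \<bar>\<psi> x\<bar> \<le> K) \<longrightarrow>
     (\<forall>x\<in>mspace m. \<forall>y\<in>mspace m. \<psi> x \<le> \<phi> y + \<kappa> * (mdist m x y)\<^sup>2) \<longrightarrow>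
     (\<integral>x. exp (\<psi> x) \<partial>P) \<le> exp (\<integral>x. \<phi> x \<partial>P))"

lemma cont_inf_conv_ineqI:
  assumes "\<And>\<phi> \<psi> K. mcontinuous m \<phi> \<Longrightarrow> mcontinuous m \<psi> \<Longrightarrow>
     (\<And>x. x \<in> mspace m \<Longrightarrow> \<bar>\<phi> x\<bar> \<le> K) \<Longrightarrow> (\<And>x. x \<in> mspace m \<Longrightarrow> \<bar>\<psi> x\<bar> \<le> K) \<Longrightarrow>
     (\<And>x y. x \<in> mspace m \<Longrightarrow> y \<in> mspace m \<Longrightarrow> \<psi> x \<le> \<phi> y + \<kappa> * (mdist m x y)\<^sup>2) \<Longrightarrow>
     (\<integral>x. exp (\<psi> x) \<partial>P) \<le> exp (\<integral>x. \<phi> x \<partial>P)"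
  shows "cont_inf_conv_ineq m P \<kappa>"
  using assms unfolding cont_inf_conv_ineq_def by blast

lemma cont_inf_conv_ineqD:
  assumes "cont_inf_conv_ineq m P \<kappa>" "mcontinuous m \<phi>" "mcontinuous m \<psi>"
    "\<And>x. x \<in> mspace m \<Longrightarrow> \<bar>\<phi> x\<bar> \<le> K" "\<And>x. x \<in> mspace m \<Longrightarrow> \<bar>\<psi> x\<bar> \<le> K"
    "\<And>x y. x \<in> mspace m \<Longrightarrow> y \<in> mspace m \<Longrightarrow> \<psi> x \<le> \<phi> y + \<kappa> * (mdist m x y)\<^sup>2"
  shows "(\<integral>x. exp (\<psi> x) \<partial>P) \<le> exp (\<integral>x. \<phi> x \<partial>P)"
  using assms unfolding cont_inf_conv_ineq_def by blast

text \<open>By the triangle inequality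
  \<open>X x \<le> 2 * X y + \<kappa> * (mdist m x y)^2\<close>; the factor
  \<open>\<kappa> / 2\<close> in \<open>X\<close> is chosen for this. Truncating both functions at
  the same level keeps the relation and makes them bounded.\<close>

lemma second_moment_tests:
  assumes x0: "x0 \<in> mspace m" and \<kappa>: "0 < \<kappa>" and t: "0 \<le> t"
  defines "X \<equiv> \<lambda>x. \<kappa> / 2 * (mdist m x0 x)\<^sup>2"
  shows "mcontinuous m (\<lambda>x. min (2 * X x) t)" "mcontinuous m (\<lambda>x. min (X x) t)"
    and "\<bar>min (2 * X x) t\<bar> \<le> t" "\<bar>min (X x) t\<bar> \<le> t"
    and "x \<in> mspace m \<Longrightarrow> y \<in> mspace m \<Longrightarrow> min (X x) t \<le> min (2 * X y) t + \<kappa> * (mdist m x y)\<^sup>2"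
proof -
  have X0: "0 \<le> X x" for x using \<kappa> by (simp add: X_def)
  show "mcontinuous m (\<lambda>x. min (2 * X x) t)" "mcontinuous m (\<lambda>x. min (X x) t)"
    using continuous_map_real_min[OF mcontinuous_quadratic[OF x0, of 0 "\<kappa>"], of "\<lambda>_. t"]
      continuous_map_real_min[OF mcontinuous_quadratic[OF x0, of 0 "\<kappa> / 2"], of "\<lambda>_. t"]
    by (simp_all add: X_def)
  show "\<bar>min (2 * X x) t\<bar> \<le> t" "\<bar>min (X x) t\<bar> \<le> t" using X0[of x] t by auto
  show "min (X x) t \<le> min (2 * X y) t + \<kappa> * (mdist m x y)\<^sup>2" if "x \<in> mspace m" "y \<in> mspace m"
  proof -
    interpret Metric_space "mspace m" "mdist m" by (rule Metric_space_mspace_mdist)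
    have "mdist m x0 x \<le> mdist m x0 y + mdist m x y"
      using triangle[OF x0 that(2,1)] by (simp add: commute)
    then have "(mdist m x0 x)\<^sup>2 \<le> (mdist m x0 y + mdist m x y)\<^sup>2" by (intro power_mono) auto
    also have "\<dots> \<le> 2 * ((mdist m x0 y)\<^sup>2 + (mdist m x y)\<^sup>2)"
      using power2_sum_le[of 1 "mdist m x0 y" "mdist m x y"] by simp
    finally have "\<kappa> / 2 * (mdist m x0 x)\<^sup>2 \<le> \<kappa> / 2 * (2 * ((mdist m x0 y)\<^sup>2 + (mdist m x y)\<^sup>2))"
      using \<kappa> by (intro mult_left_mono) auto
    then have "X x \<le> 2 * X y + \<kappa> * (mdist m x y)\<^sup>2" by (simp add: X_def algebra_simps)
    moreover have "0 \<le> \<kappa> * (mdist m x y)\<^sup>2" using \<kappa> by simp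
    ultimately show ?thesis by (auto simp: min_def)
  qed
qed

text \<open>Testing with truncations of the squared distance at level \<open>t\<close> gives a tail of order \<open>exp (-t/2)\<close>.\<close>

lemma second_moment_finite:
  assumes P: "P \<in> borel_probs m" and dual: "cont_inf_conv_ineq m P \<kappa>" and \<kappa>: "0 < \<kappa>" and x0: "x0 \<in> mspace m"
  shows "(\<integral>\<^sup>+x. ennreal ((mdist m x0 x)\<^sup>2) \<partial>P) < \<infinity>"
proof -
  have P': "prob_space P" "sets P = sets (mborel m)" using P by (auto simp: borel_probs_def)
  interpret P: prob_space P by (rule P')
  note [measurable_cong] = P'(2)
  define X where "X x = \<kappa> / 2 * (mdist m x0 x)\<^sup>2" for x
  have [measurable]: "mdist m x0 \<in> borel_measurable P" using measurable_mdist_mborel[OF x0] by simp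
  have X[measurable]: "X \<in> borel_measurable P" unfolding X_def by measurable
  let ?A = "\<lambda>r. {x\<in>space P. r < X x}"
  have "(\<lambda>n. measure P (?A (real n))) \<longlonglongrightarrow> measure P (\<Inter>n. ?A (real n))"
    by (intro P.finite_Lim_measure_decseq) (auto simp: decseq_def)
  also have "(\<Inter>n. ?A (real n)) = {}"
  proof -
    have "\<exists>n. \<not> real n < X x" for x using reals_Archimedean2[of "X x"] by (auto intro: less_imp_le simp: not_less)
    then show ?thesis by blast
  qed
  finally have "eventually (\<lambda>n. measure P (?A (real n)) < 1 / 2) sequentially"
    by (intro order_tendstoD(2)) auto
  then obtain n where n: "measure P (?A (real n)) < 1 / 2" by (auto simp: eventually_sequentially)
  have ind: "integrable P (\<lambda>x. a * indicator (?A r) x)" for a r :: real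
    by (intro integrable_mult_right integrable_real_indicator) (auto simp: P.emeasure_eq_measure)
  have tail: "measure P (?A t) \<le> exp (2 * real n) * exp (- t / 2)" if t: "0 < t" for t
  proof -
    note test = second_moment_tests[OF x0 \<kappa> less_imp_le[OF t], folded X_def]
    have *: "(\<integral>x. exp (min (X x) t) \<partial>P) \<le> exp (\<integral>x. min (2 * X x) t \<partial>P)"
      by (rule cont_inf_conv_ineqD[OF dual test(1,2)]) (use test(3-5) in auto)
    have "exp t * measure P (?A t) = (\<integral>x. exp t * indicator (?A t) x \<partial>P)"
      by simp
    also have "\<dots> \<le> (\<integral>x. exp (min (X x) t) \<partial>P)"
    proof (rule integral_mono_AE)
      show "integrable P (\<lambda>x. exp (min (X x) t))"
        by (rule P.integrable_const_bound[where B="exp t"]) auto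
      show "AE x in P. exp t * indicator (?A t) x \<le> exp (min (X x) t)"
        by (intro AE_I2) (auto simp: indicator_def)
    qed (rule ind)
    also note *
    \<comment> \<open>The integrand is at most \<open>2 * real n\<close> where
      \<open>X \<le> n\<close>, and at most \<open>t\<close> elsewhere. As the latter event has
      probability below 1/2, half of \<open>exp t\<close> remains after division.\<close>
    also have "(\<integral>x. min (2 * X x) t \<partial>P) \<le> (\<integral>x. 2 * real n + t * indicator (?A (real n)) x \<partial>P)"
    proof (rule integral_mono_AE)
      show "integrable P (\<lambda>x. min (2 * X x) t)"
        by (rule P.integrable_const_bound[where B=t]) (use test(3) in auto)
      show "AE x in P. min (2 * X x) t \<le> 2 * real n + t * indicator (?A (real n)) x"
        using t by (intro AE_I2) (auto simp: indicator_def)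
      show "integrable P (\<lambda>x. 2 * real n + t * indicator (?A (real n)) x)"
        using ind by simp
    qed
    also have "\<dots> = 2 * real n + t * measure P (?A (real n))"
      by (subst Bochner_Integration.integral_add[OF _ ind]) (auto simp: P.prob_space)
    also have "\<dots> \<le> 2 * real n + t * (1 / 2)"
      using n t by (intro add_left_mono mult_left_mono) auto
    finally have "exp t * measure P (?A t) \<le> exp t * (exp (2 * real n) * exp (- t / 2))"
      by (simp add: add.commute flip: exp_add)
    then show ?thesis by simp
  qed
  have "(\<integral>\<^sup>+x. ennreal (X x) \<partial>P) = (\<integral>\<^sup>+t. indicator {0<..} t * emeasure P (?A t) \<partial>lborel)"
    by (rule nn_integral_layer_cake) (auto intro: P.sigma_finite_measure_axioms)
  \<comment> \<open>The tail bound is twice an exponential density of rate 1/2, whose integral is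
    known.\<close>
  also have "\<dots> \<le> (\<integral>\<^sup>+t. ennreal (2 * exp (2 * real n)) * ennreal (exponential_density (1 / 2) t) \<partial>lborel)"
  proof (rule nn_integral_mono)
    fix t :: real
    show "indicator {0<..} t * emeasure P (?A t) \<le> ennreal (2 * exp (2 * real n)) * ennreal (exponential_density (1 / 2) t)"
    proof (cases "0 < t")
      case True
      then show ?thesis
        using tail[OF True]
        by (auto simp: P.emeasure_eq_measure exponential_density_def simp flip: ennreal_mult intro!: ennreal_leI)
    qed simp
  qed
  also have "\<dots> = ennreal (2 * exp (2 * real n)) * (\<integral>\<^sup>+t. ennreal (exponential_density (1 / 2) t) \<partial>lborel)"
    by (rule nn_integral_cmult) auto
  also have "(\<integral>\<^sup>+t. ennreal (exponential_density (1 / 2) t) \<partial>lborel) = 1"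
    using prob_space.emeasure_space_1[OF prob_space_exponential_density[of "1 / 2"]] by (simp add: emeasure_density)
  finally have fin: "(\<integral>\<^sup>+x. ennreal (X x) \<partial>P) < \<infinity>" by (simp add: le_less_trans)
  have "(\<integral>\<^sup>+x. ennreal ((mdist m x0 x)\<^sup>2) \<partial>P) = (\<integral>\<^sup>+x. ennreal (2 / \<kappa>) * ennreal (X x) \<partial>P)"
    using \<kappa> by (intro nn_integral_cong) (simp add: X_def flip: ennreal_mult)
  also have "\<dots> = ennreal (2 / \<kappa>) * (\<integral>\<^sup>+x. ennreal (X x) \<partial>P)" by (rule nn_integral_cmult) auto
  also have "\<dots> < \<infinity>" using fin by (simp add: ennreal_mult_less_top)
  finally show ?thesis .
qed

text \<open>The case in which \<open>relative_entropy\<close> is the Kullback-Leibler integral;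
  otherwise it is infinite and the claim is trivial.\<close>

locale finite_entropy =
  fixes m :: "'a metric" and P Q :: "'a measure" and \<kappa> :: real
  assumes P: "P \<in> borel_probs m" and Q: "Q \<in> borel_probs m" and dual: "cont_inf_conv_ineq m P \<kappa>"
    and ac: "absolutely_continuous P Q" and int: "integrable Q (entropy_density (exp 1) P Q)"
    and \<kappa>: "0 < \<kappa>"
begin

abbreviation "H \<equiv> KL_divergence (exp 1) P Q"

lemma P': "prob_space P" "sets P = sets (mborel m)" "space P = mspace m"
  and Q': "prob_space Q" "sets Q = sets (mborel m)" "space Q = mspace m"
  using P Q sets_eq_imp_space_eq[of P "mborel m"] sets_eq_imp_space_eq[of Q "mborel m"]
  by (auto simp: borel_probs_def)

sublocale P: prob_space P by (rule P')
sublocale Q: prob_space Q by (rule Q')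

lemma transport_dual_bound:
  assumes cont: "mcontinuous m \<phi>" "mcontinuous m \<psi>"
    and bd: "\<And>x. x \<in> mspace m \<Longrightarrow> \<bar>\<phi> x\<bar> \<le> K" "\<And>x. x \<in> mspace m \<Longrightarrow> \<bar>\<psi> x\<bar> \<le> K"
    and le: "\<And>x y. x \<in> mspace m \<Longrightarrow> y \<in> mspace m \<Longrightarrow> \<psi> x \<le> \<phi> y + \<kappa> * (mdist m x y)\<^sup>2"
  shows "(\<integral>x. \<psi> x \<partial>Q) \<le> (\<integral>x. \<phi> x \<partial>P) + H"
proof -
  have [measurable]: "\<psi> \<in> borel_measurable P"
    using mcontinuous_measurable[OF cont(2)] P'(2) by (simp cong: measurable_cong_sets)
  have \<psi>K: "- K \<le> \<psi> x" "\<psi> x \<le> K" if "x \<in> space P" for x using bd(2)[of x] that P'(3) by auto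
  have "integrable P (\<lambda>x. exp (\<psi> x))"
    by (rule P.integrable_const_bound[where B="exp K"]) (use \<psi>K in auto)
  then have "exp (- K) \<le> (\<integral>x. exp (\<psi> x) \<partial>P)"
    using \<psi>K by (intro P.integral_ge_const AE_I2) auto
  then have pos: "0 < (\<integral>x. exp (\<psi> x) \<partial>P)" using less_le_trans[OF exp_gt_zero] by blast
  have "(\<integral>x. exp (\<psi> x) \<partial>P) \<le> exp (\<integral>x. \<phi> x \<partial>P)"
    by (rule cont_inf_conv_ineqD[OF dual cont bd le])
  then have "ln (\<integral>x. exp (\<psi> x) \<partial>P) \<le> (\<integral>x. \<phi> x \<partial>P)" using pos by (metis ln_exp ln_le_cancel_iff exp_gt_zero)
  moreover have "(\<integral>x. \<psi> x \<partial>Q) \<le> ln (\<integral>x. exp (\<psi> x) \<partial>P) + H"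
    by (rule gibbs_variational[OF P'(1) Q'(1) _ ac int, where K=K]) (use P' Q' bd in auto)
  ultimately show ?thesis by simp
qed

lemma second_moment_finite_Q:
  assumes x0: "x0 \<in> mspace m"
  shows "(\<integral>\<^sup>+x. ennreal ((mdist m x0 x)\<^sup>2) \<partial>Q) < \<infinity>"
proof -
  note [measurable_cong] = P'(2) Q'(2)
  define X where "X x = \<kappa> / 2 * (mdist m x0 x)\<^sup>2" for x
  have X0: "0 \<le> X x" for x using \<kappa> by (simp add: X_def)
  have [measurable]: "mdist m x0 \<in> borel_measurable (mborel m)" by (rule measurable_mdist_mborel[OF x0])
  have X[measurable]: "X \<in> borel_measurable P" "X \<in> borel_measurable Q" unfolding X_def by measurable
  have nnX: "(\<integral>\<^sup>+x. ennreal (X x) \<partial>R) = ennreal (\<kappa> / 2) * (\<integral>\<^sup>+x. ennreal ((mdist m x0 x)\<^sup>2) \<partial>R)"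
    if "sets R = sets (mborel m)" for R
  proof -
    have [measurable]: "mdist m x0 \<in> borel_measurable R" using that by (simp cong: measurable_cong_sets)
    have "(\<integral>\<^sup>+x. ennreal (X x) \<partial>R) = (\<integral>\<^sup>+x. ennreal (\<kappa> / 2) * ennreal ((mdist m x0 x)\<^sup>2) \<partial>R)"
      using \<kappa> by (intro nn_integral_cong) (simp add: X_def flip: ennreal_mult)
    then show ?thesis by (simp add: nn_integral_cmult)
  qed
  have "(\<integral>\<^sup>+x. ennreal (X x) \<partial>P) < \<infinity>"
    using second_moment_finite[OF P dual \<kappa> x0] unfolding nnX[OF P'(2)] by (simp add: ennreal_mult_less_top)
  then have intX: "integrable P X" using X0 by (intro integrableI_bounded) auto
  define B where "B = 2 * (\<integral>x. X x \<partial>P) + H"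
  have le: "(\<integral>\<^sup>+x. ennreal (min (X x) (real n)) \<partial>Q) \<le> ennreal B" for n
  proof -
    note test = second_moment_tests[OF x0 \<kappa> of_nat_0_le_iff[of n], folded X_def]
    have "(\<integral>x. min (X x) (real n) \<partial>Q) \<le> (\<integral>x. min (2 * X x) (real n) \<partial>P) + H"
      by (rule transport_dual_bound[OF test(1,2)]) (use test(3-5) in auto)
    also have "(\<integral>x. min (2 * X x) (real n) \<partial>P) \<le> (\<integral>x. 2 * X x \<partial>P)"
    proof (rule integral_mono_AE)
      show "integrable P (\<lambda>x. min (2 * X x) (real n))"
        by (rule P.integrable_const_bound[where B="real n"]) (use test(3) in auto)
    qed (use intX in auto)
    finally have "(\<integral>x. min (X x) (real n) \<partial>Q) \<le> B" by (simp add: B_def)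
    moreover have "integrable Q (\<lambda>x. min (X x) (real n))"
      by (rule Q.integrable_const_bound[where B="real n"]) (use test(4) in auto)
    ultimately show ?thesis
      using X0 by (subst nn_integral_eq_integral) (auto intro: ennreal_leI)
  qed
  have "(\<integral>\<^sup>+x. ennreal (X x) \<partial>Q) = (\<integral>\<^sup>+x. (SUP n. ennreal (min (X x) (real n))) \<partial>Q)"
  proof (rule nn_integral_cong)
    fix x
    show "ennreal (X x) = (SUP n. ennreal (min (X x) (real n)))"
    proof (rule antisym)
      obtain n where "X x \<le> real n" using real_arch_simple by blast
      then show "ennreal (X x) \<le> (SUP n. ennreal (min (X x) (real n)))"
        by (intro SUP_upper2[of n]) auto
      show "(SUP n. ennreal (min (X x) (real n))) \<le> ennreal (X x)"
        by (intro SUP_least ennreal_leI) auto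
    qed
  qed
  also have "\<dots> = (SUP n. \<integral>\<^sup>+x. ennreal (min (X x) (real n)) \<partial>Q)"
    by (rule nn_integral_monotone_convergence_SUP) (auto simp: incseq_def le_fun_def intro!: ennreal_leI)
  also have "\<dots> \<le> ennreal B" by (intro SUP_least le)
  finally have "(\<integral>\<^sup>+x. ennreal (X x) \<partial>Q) < \<infinity>" by (simp add: le_less_trans)
  then show ?thesis
    using \<kappa> unfolding nnX[OF Q'(2)] by (auto simp: ennreal_mult_less_top)
qed

end

section \<open>From finite plans to near-optimal couplings\<close>

lemma measurable_quantization_error:
  assumes [measurable]: "q \<in> measurable (mborel m) (count_space (UNIV :: nat set))" and e: "\<And>i. e i \<in> mspace m"
  shows "(\<lambda>x. mdist m (e (q x)) x) \<in> borel_measurable (mborel m)"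
proof -
  have [measurable]: "mdist m (e k) \<in> borel_measurable (mborel m)" for k by (rule measurable_mdist_mborel[OF e])
  show ?thesis by (rule measurable_compose_countable[where g=q]) measurable
qed

text \<open>A dual pair on the representatives is extended to the space by a minimum, respectively
  maximum, over representatives with a quadratic term of weight \<open>L\<close>. Evaluating it at
  the representative of a point itself shows that each integral changes by at most
  \<open>L * \<eta>\<close>. Shrinking the cost by \<open>1 + \<delta>\<close> pays for the passage
  from representatives to points.\<close>

lemma (in finite_entropy) dual_pair_bound:
  fixes a b :: "nat \<Rightarrow> real" and e :: "nat \<Rightarrow> 'a"
  assumes \<delta>: "0 < \<delta>" and \<eta>: "0 \<le> \<eta>"
    and q: "q \<in> measurable (mborel m) (count_space UNIV)" "\<And>x. q x \<le> N" and e: "\<And>i. e i \<in> mspace m"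
    and qP: "(\<integral>\<^sup>+x. ennreal ((mdist m (e (q x)) x)\<^sup>2) \<partial>P) \<le> ennreal \<eta>"
    and qQ: "(\<integral>\<^sup>+x. ennreal ((mdist m (e (q x)) x)\<^sup>2) \<partial>Q) \<le> ennreal \<eta>"
    and le: "\<And>i j. i \<le> N \<Longrightarrow> j \<le> N \<Longrightarrow> b j - a i \<le> \<kappa> * (mdist m (e i) (e j))\<^sup>2 / (1 + \<delta>)"
  shows "(\<Sum>j\<le>N. b j * measure Q (q -` {j} \<inter> space Q)) - (\<Sum>i\<le>N. a i * measure P (q -` {i} \<inter> space P))
    \<le> H + 4 * \<kappa> * \<eta> / \<delta>"
proof -
  let ?a = "\<Sum>i\<le>N. a i * measure P (q -` {i} \<inter> space P)" and ?b = "\<Sum>j\<le>N. b j * measure Q (q -` {j} \<inter> space Q)"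
    and ?E = "\<lambda>x. (mdist m (e (q x)) x)\<^sup>2" and ?d = "\<lambda>i x. (mdist m (e i) x)\<^sup>2"
  have q_P: "q \<in> measurable P (count_space UNIV)" and q_Q: "q \<in> measurable Q (count_space UNIV)"
    using q(1) P'(2) Q'(2) by (simp_all cong: measurable_cong_sets)
  interpret Metric_space "mspace m" "mdist m" by (rule Metric_space_mspace_mdist)
  \<comment> \<open>The weight that \<open>mdist_comparison\<close> puts on the two quantization
    errors, times \<open>\<kappa>\<close>.\<close>
  define L where "L = 2 * \<kappa> / \<delta>"
  have L: "0 < L" using \<kappa> \<delta> by (simp add: L_def)
  define \<phi>0 where "\<phi>0 y = Min ((\<lambda>i. a i + L * ?d i y) ` {..N})" for y
  define \<psi>0 where "\<psi>0 x = Max ((\<lambda>j. b j + (- L) * ?d j x) ` {..N})" for x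
  \<comment> \<open>Since \<open>\<phi>0 \<ge> - K\<close> and \<open>\<psi>0 \<le> K\<close>,
    cutting \<open>\<phi>0\<close> from above and \<open>\<psi>0\<close> from below at these levels
    makes both bounded and keeps the constraint.\<close>
  define K where "K = (\<Sum>i\<le>N. \<bar>a i\<bar>) + (\<Sum>j\<le>N. \<bar>b j\<bar>)"
  define \<phi> where "\<phi> y = min (\<phi>0 y) K" for y
  define \<psi> where "\<psi> x = max (\<psi>0 x) (- K)" for x
  have aK: "\<bar>a i\<bar> \<le> K" "\<bar>b i\<bar> \<le> K" if "i \<le> N" for i
    using member_le_sum[of i "{..N}" "\<lambda>i. \<bar>a i\<bar>"] member_le_sum[of i "{..N}" "\<lambda>i. \<bar>b i\<bar>"] that
      sum_nonneg[of "{..N}" "\<lambda>i. \<bar>a i\<bar>"] sum_nonneg[of "{..N}" "\<lambda>i. \<bar>b i\<bar>"]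
    by (auto simp: K_def)
  have K0: "0 \<le> K" using aK(1)[of 0] by simp
  have lower: "- K \<le> \<phi>0 y" for y
  proof -
    have "- K \<le> a i + L * ?d i y" if "i \<le> N" for i
    proof -
      have "0 \<le> L * ?d i y" using L by simp
      then show ?thesis using aK(1)[OF that] by linarith
    qed
    then show ?thesis unfolding \<phi>0_def by (subst Min_ge_iff) auto
  qed
  have upper: "\<psi>0 x \<le> K" for x
  proof -
    have "b j + (- L) * ?d j x \<le> K" if "j \<le> N" for j
    proof -
      have "0 \<le> L * ?d j x" using L by simp
      then show ?thesis using aK(2)[OF that] by linarith
    qed
    then show ?thesis unfolding \<psi>0_def by (subst Max_le_iff) auto
  qed
  have le0: "\<psi>0 x \<le> \<phi>0 y + \<kappa> * (mdist m x y)\<^sup>2" if xy: "x \<in> mspace m" "y \<in> mspace m" for x y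
  proof -
    have "b j + (- L) * ?d j x - \<kappa> * (mdist m x y)\<^sup>2 \<le> a i + L * ?d i y"
      if ij: "i \<le> N" "j \<le> N" for i j
    proof -
      have "(mdist m (e i) (e j))\<^sup>2 \<le> (1 + \<delta>) * ((mdist m x y)\<^sup>2 + 2 / \<delta> * (?d j x + ?d i y))"
        using mdist_comparison[OF xy e[of j] e[of i] \<delta>] by (simp add: commute)
      then have "\<kappa> * (mdist m (e i) (e j))\<^sup>2 \<le>
          \<kappa> * ((1 + \<delta>) * ((mdist m x y)\<^sup>2 + 2 / \<delta> * (?d j x + ?d i y)))"
        using \<kappa> by (intro mult_left_mono) auto
      then have "\<kappa> * (mdist m (e i) (e j))\<^sup>2 / (1 + \<delta>) \<le>
          \<kappa> * ((mdist m x y)\<^sup>2 + 2 / \<delta> * (?d j x + ?d i y))"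
        using \<delta> by (simp add: pos_divide_le_eq mult_ac)
      also have "\<dots> = \<kappa> * (mdist m x y)\<^sup>2 + L * ?d j x + L * ?d i y"
        by (simp add: L_def algebra_simps)
      finally show ?thesis using le[OF ij] by simp
    qed
    then have "b j + (- L) * ?d j x - \<kappa> * (mdist m x y)\<^sup>2 \<le> \<phi>0 y" if "j \<le> N" for j
      unfolding \<phi>0_def using that by (subst Min_ge_iff) auto
    then have "b j + (- L) * ?d j x \<le> \<phi>0 y + \<kappa> * (mdist m x y)\<^sup>2" if "j \<le> N" for j
      using that by (simp add: diff_le_eq)
    then show ?thesis unfolding \<psi>0_def by (subst Max_le_iff) auto
  qed
  have bd: "\<bar>\<phi> x\<bar> \<le> K" "\<bar>\<psi> x\<bar> \<le> K" for x
    using lower[of x] upper[of x] K0 by (auto simp: \<phi>_def \<psi>_def min_def max_def abs_le_iff)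
  have cont: "mcontinuous m \<phi>" "mcontinuous m \<psi>"
    unfolding \<phi>_def \<psi>_def \<phi>0_def \<psi>0_def
    by (intro continuous_map_real_min continuous_map_real_max mcontinuous_Min mcontinuous_Max mcontinuous_quadratic e; simp)+
  have main: "(\<integral>x. \<psi> x \<partial>Q) \<le> (\<integral>x. \<phi> x \<partial>P) + H"
  proof (rule transport_dual_bound[OF cont])
    fix x y assume "x \<in> mspace m" "y \<in> mspace m"
    moreover have "0 \<le> \<kappa> * (mdist m x y)\<^sup>2" using \<kappa> by simp
    ultimately show "\<psi> x \<le> \<phi> y + \<kappa> * (mdist m x y)\<^sup>2"
      using le0[of x y] lower[of y] upper[of x] K0 \<open>0 \<le> \<kappa> * (mdist m x y)\<^sup>2\<close>
      by (auto simp: \<phi>_def \<psi>_def min_def max_def)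
  qed (use bd in auto)
  note mb = measurable_quantization_error[OF q(1) e]
  have err: "integrable R (\<lambda>x. ?E x)" "(\<integral>x. ?E x \<partial>R) \<le> \<eta>"
    if "sets R = sets (mborel m)" "(\<integral>\<^sup>+x. ennreal (?E x) \<partial>R) \<le> ennreal \<eta>" for R
  proof -
    have [measurable]: "(\<lambda>x. mdist m (e (q x)) x) \<in> borel_measurable R" using mb that(1) by (simp cong: measurable_cong_sets)
    show "integrable R (\<lambda>x. ?E x)"
      using that(2) by (intro integrableI_bounded) (auto simp: le_less_trans)
    show "(\<integral>x. ?E x \<partial>R) \<le> \<eta>"
      using that(2) \<eta> by (subst integral_eq_nn_integral) (auto intro: enn2real_leI)
  qed
  have int\<phi>: "integrable P \<phi>"
    by (rule P.integrable_const_bound[where B=K]) (use bd mcontinuous_measurable[OF cont(1)] P'(2) in \<open>auto cong: measurable_cong_sets\<close>)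
  have int\<psi>: "integrable Q \<psi>"
    by (rule Q.integrable_const_bound[where B=K]) (use bd mcontinuous_measurable[OF cont(2)] Q'(2) in \<open>auto cong: measurable_cong_sets\<close>)
  have "(\<integral>y. \<phi> y \<partial>P) \<le> (\<integral>y. a (q y) + L * ?E y \<partial>P)"
  proof (rule integral_mono)
    show "\<phi> y \<le> a (q y) + L * ?E y" for y
      unfolding \<phi>_def \<phi>0_def using q(2)[of y] by (intro min.coboundedI1 Min_le) auto
  qed (use int\<phi> P.integral_finite_range(1)[OF q_P q(2), of a] err(1)[OF P'(2) qP] in auto)
  also have "\<dots> = ?a + L * (\<integral>y. ?E y \<partial>P)"
    using P.integral_finite_range[OF q_P q(2), of a] err(1)[OF P'(2) qP] by simp
  also have "\<dots> \<le> ?a + L * \<eta>"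
    using err(2)[OF P'(2) qP] L by (intro add_left_mono mult_left_mono) auto
  finally have up: "(\<integral>y. \<phi> y \<partial>P) \<le> ?a + L * \<eta>" .
  have "?b - L * \<eta> \<le>
      ?b - L * (\<integral>x. ?E x \<partial>Q)"
    using err(2)[OF Q'(2) qQ] L by (intro diff_left_mono mult_left_mono) auto
  also have "\<dots> = (\<integral>x. b (q x) + (- L) * ?E x \<partial>Q)"
    using Q.integral_finite_range[OF q_Q q(2), of b] err(1)[OF Q'(2) qQ] by simp
  also have "\<dots> \<le> (\<integral>x. \<psi> x \<partial>Q)"
  proof (rule integral_mono)
    show "b (q x) + (- L) * ?E x \<le> \<psi> x" for x
      unfolding \<psi>_def \<psi>0_def using q(2)[of x] by (intro max.coboundedI1 Max_ge) auto
  qed (use int\<psi> Q.integral_finite_range(1)[OF q_Q q(2), of b] err(1)[OF Q'(2) qQ] in auto)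
  finally have "?b - L * \<eta> \<le> (\<integral>x. \<psi> x \<partial>Q)" .
  then have "?b - ?a
    \<le> H + 2 * (L * \<eta>)"
    using main up by simp
  then show ?thesis by (simp add: L_def mult_ac)
qed

text \<open>One factor \<open>1 + \<delta>\<close> is lost in the dual problem between points and
  representatives, the other when the cost of the block coupling is estimated between the
  points.\<close>

lemma (in finite_entropy) approx_optimal_coupling:
  assumes sep: "separable_metric m C" and \<delta>: "0 < \<delta>"
  shows "\<exists>\<pi>\<in>couplings P Q. (\<integral>\<^sup>+(x, y). ennreal ((mdist m x y)\<^sup>2) \<partial>\<pi>) \<le>
    ennreal ((1 + \<delta>) * ((1 + \<delta>) * (H + 4 * \<delta>) + 4 * \<delta>) / \<kappa>)"
proof -
  let ?r = "(1 + \<delta>) * ((1 + \<delta>) * (H + 4 * \<delta>) + 4 * \<delta>) / \<kappa>" and ?g = "2 * \<delta> * (1 + \<delta>) / \<kappa>"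
  obtain x0 where x0: "x0 \<in> mspace m" using P.not_empty P'(3) by auto
  \<comment> \<open>Quantization errors enter with weight of order \<open>1/\<delta>\<close>; an
    error of order \<open>\<delta>^2\<close> leaves a loss of order \<open>\<delta>\<close>.\<close>
  define \<eta> where "\<eta> = \<delta>\<^sup>2 / \<kappa>"
  have \<eta>: "0 < \<eta>" using \<delta> \<kappa> by (simp add: \<eta>_def)
  obtain N :: nat and q and e :: "nat \<Rightarrow> 'a" where q: "q \<in> measurable (mborel m) (count_space UNIV)" "\<And>x. q x \<le> N"
    and e: "\<And>i. e i \<in> mspace m"
    and qP: "(\<integral>\<^sup>+x. ennreal ((mdist m (e (q x)) x)\<^sup>2) \<partial>P) \<le> ennreal \<eta>"
    and qQ: "(\<integral>\<^sup>+x. ennreal ((mdist m (e (q x)) x)\<^sup>2) \<partial>Q) \<le> ennreal \<eta>"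
    by (rule separable_metric.finite_quantization[OF sep P'(1,2) Q'(1,2) x0 second_moment_finite[OF P dual \<kappa> x0]
      second_moment_finite_Q[OF x0] \<eta>]) (rule that)
  have q_P: "q \<in> measurable P (count_space UNIV)" and q_Q: "q \<in> measurable Q (count_space UNIV)"
    using q(1) P'(2) Q'(2) by (simp_all cong: measurable_cong_sets)
  define \<mu> \<nu> where "\<mu> i = measure P (q -` {i} \<inter> space P)" and "\<nu> j = measure Q (q -` {j} \<inter> space Q)" for i j
  have \<mu>1: "(\<Sum>i\<le>N. \<mu> i) = 1" and \<nu>1: "(\<Sum>j\<le>N. \<nu> j) = 1"
    using P.integral_finite_range(2)[OF q_P q(2), of "\<lambda>_. 1"] Q.integral_finite_range(2)[OF q_Q q(2), of "\<lambda>_. 1"]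
    by (simp_all add: \<mu>_def \<nu>_def P.prob_space Q.prob_space)
  define c where "c i j = (mdist m (e i) (e j))\<^sup>2" for i j
  have c0: "0 \<le> c i j" for i j by (simp add: c_def)
  obtain p where p: "\<And>i j. 0 \<le> p (i, j)" "\<And>i. i \<in> {..N} \<Longrightarrow> (\<Sum>j\<in>{..N}. p (i, j)) = \<mu> i"
    "\<And>j. j \<in> {..N} \<Longrightarrow> (\<Sum>i\<in>{..N}. p (i, j)) = \<nu> j"
    and cost: "(\<Sum>i\<in>{..N}. \<Sum>j\<in>{..N}. p (i, j) * (\<kappa> * c i j / (1 + \<delta>))) \<le> H + 4 * \<delta>"
  proof (rule finite_kantorovich_duality[of "{..N}" \<mu> \<nu> "\<lambda>i j. \<kappa> * c i j / (1 + \<delta>)" "H + 4 * \<delta>"])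
    fix a b :: "nat \<Rightarrow> real"
    assume ab: "\<And>i j. i \<in> {..N} \<Longrightarrow> j \<in> {..N} \<Longrightarrow> b j - a i \<le> \<kappa> * c i j / (1 + \<delta>)"
    have "(\<Sum>j\<le>N. b j * \<nu> j) - (\<Sum>i\<le>N. a i * \<mu> i) \<le> H + 4 * \<kappa> * \<eta> / \<delta>"
      unfolding \<mu>_def \<nu>_def
      by (rule dual_pair_bound[OF \<delta> less_imp_le[OF \<eta>] q e qP qQ]) (use ab in \<open>auto simp: c_def\<close>)
    also have "4 * \<kappa> * \<eta> / \<delta> = 4 * \<delta>" using \<kappa> \<delta> by (simp add: \<eta>_def power2_eq_square)
    finally show "(\<Sum>j\<in>{..N}. b j * \<nu> j) - (\<Sum>i\<in>{..N}. a i * \<mu> i) \<le> H + 4 * \<delta>" .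
  qed (use \<mu>1 \<nu>1 in auto)
  obtain \<pi> where \<pi>: "\<pi> \<in> couplings P Q"
    and \<pi>c: "\<And>c. (\<And>i j. 0 \<le> c i j) \<Longrightarrow> (\<integral>\<^sup>+(x, y). ennreal (c (q x) (q y)) \<partial>\<pi>) = ennreal (\<Sum>i\<le>N. \<Sum>j\<le>N. p (i, j) * c i j)"
  proof (rule block_coupling[OF P'(1) Q'(1) _ q_P q(2), where p=p])
    show "sets Q = sets P" using P' Q' by simp
  qed (use p in \<open>auto simp: \<mu>_def \<nu>_def\<close>)
  have s\<pi>: "sets \<pi> = sets (P \<Otimes>\<^sub>M Q)" and d\<pi>: "distr \<pi> P fst = P" "distr \<pi> Q snd = Q"
    using \<pi> by (auto simp: couplings_def)
  have sp\<pi>: "space \<pi> = mspace m \<times> mspace m"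
    using sets_eq_imp_space_eq[OF s\<pi>] P'(3) Q'(3) by (simp add: space_pair_measure)
  have fst[measurable]: "fst \<in> measurable \<pi> P" and snd[measurable]: "snd \<in> measurable \<pi> Q"
    by (simp_all add: measurable_cong_sets[OF s\<pi> refl])
  note [measurable] = q_P q_Q
  \<comment> \<open>The part of the comparison bound that depends on one coordinate, so that its
    integral is determined by the marginal.\<close>
  define g where "g x = (1 + \<delta>) * (2 / \<delta>) * (mdist m (e (q x)) x)\<^sup>2" for x
  let ?E = "\<lambda>x. (mdist m (e (q x)) x)\<^sup>2"
  note mb = measurable_quantization_error[OF q(1) e]
  have g: "g \<in> borel_measurable (mborel m)"
    unfolding g_def using mb by measurable
  then have [measurable]: "g \<in> borel_measurable P" "g \<in> borel_measurable Q"
    using P'(2) Q'(2) by (simp_all cong: measurable_cong_sets)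
  have g0: "0 \<le> g x" for x using \<delta> by (simp add: g_def)
  have gint: "(\<integral>\<^sup>+x. ennreal (g x) \<partial>R) \<le> ennreal ?g"
    if "sets R = sets (mborel m)" "(\<integral>\<^sup>+x. ennreal (?E x) \<partial>R) \<le> ennreal \<eta>" for R
  proof -
    have [measurable]: "(\<lambda>x. mdist m (e (q x)) x) \<in> borel_measurable R"
      using mb that(1) by (simp cong: measurable_cong_sets)
    have "(\<integral>\<^sup>+x. ennreal (g x) \<partial>R) = (\<integral>\<^sup>+x. ennreal ((1 + \<delta>) * (2 / \<delta>)) * ennreal (?E x) \<partial>R)"
      using \<delta> by (intro nn_integral_cong) (simp add: g_def flip: ennreal_mult)
    also have "\<dots> = ennreal ((1 + \<delta>) * (2 / \<delta>)) * (\<integral>\<^sup>+x. ennreal (?E x) \<partial>R)"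
      by (rule nn_integral_cmult) measurable
    also have "\<dots> \<le> ennreal ((1 + \<delta>) * (2 / \<delta>)) * ennreal \<eta>"
      using that(2) by (rule mult_left_mono) simp
    also have "\<dots> = ennreal ?g"
      using \<delta> \<kappa> by (simp add: \<eta>_def power2_eq_square field_simps flip: ennreal_mult)
    finally show ?thesis .
  qed
  let ?s = "\<Sum>i\<le>N. \<Sum>j\<le>N. p (i, j) * c i j"
  define w where "w = (1 + \<delta>) * ?s"
  have w0: "0 \<le> w" unfolding w_def using \<delta> p(1) c0 by (intro mult_nonneg_nonneg sum_nonneg) auto
  have "(\<integral>\<^sup>+(x, y). ennreal ((mdist m x y)\<^sup>2) \<partial>\<pi>) \<le>
      (\<integral>\<^sup>+z. ennreal ((1 + \<delta>) * c (q (fst z)) (q (snd z))) + (ennreal (g (fst z)) + ennreal (g (snd z))) \<partial>\<pi>)"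
  proof (rule nn_integral_mono)
    fix z assume "z \<in> space \<pi>"
    then obtain x y where z: "z = (x, y)" "x \<in> mspace m" "y \<in> mspace m" using sp\<pi> by auto
    interpret Metric_space "mspace m" "mdist m" by (rule Metric_space_mspace_mdist)
    have "(mdist m x y)\<^sup>2 \<le> (1 + \<delta>) * c (q x) (q y) + (g x + g y)"
      using mdist_comparison[OF e[of "q x"] e[of "q y"] z(2,3) \<delta>]
      by (simp add: c_def g_def commute algebra_simps)
    then show "(case z of (x, y) \<Rightarrow> ennreal ((mdist m x y)\<^sup>2)) \<le>
        ennreal ((1 + \<delta>) * c (q (fst z)) (q (snd z))) + (ennreal (g (fst z)) + ennreal (g (snd z)))"
      using g0 c0 \<delta> z(1) by (simp add: ennreal_leI flip: ennreal_plus)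
  qed
  also have "\<dots> = (\<integral>\<^sup>+z. ennreal ((1 + \<delta>) * c (q (fst z)) (q (snd z))) \<partial>\<pi>) +
      ((\<integral>\<^sup>+z. ennreal (g (fst z)) \<partial>\<pi>) + (\<integral>\<^sup>+z. ennreal (g (snd z)) \<partial>\<pi>))"
    by (subst nn_integral_add, measurable, subst nn_integral_add, measurable)
  also have "(\<integral>\<^sup>+z. ennreal ((1 + \<delta>) * c (q (fst z)) (q (snd z))) \<partial>\<pi>) = ennreal w"
    using \<pi>c[of "\<lambda>i j. (1 + \<delta>) * c i j"] c0 \<delta>
    by (simp add: case_prod_beta' w_def sum_distrib_left mult_ac)
  also have "(\<integral>\<^sup>+z. ennreal (g (fst z)) \<partial>\<pi>) = (\<integral>\<^sup>+x. ennreal (g x) \<partial>P)"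
    using nn_integral_distr[OF fst, of "\<lambda>x. ennreal (g x)"] by (simp add: d\<pi>)
  also have "(\<integral>\<^sup>+z. ennreal (g (snd z)) \<partial>\<pi>) = (\<integral>\<^sup>+x. ennreal (g x) \<partial>Q)"
    using nn_integral_distr[OF snd, of "\<lambda>x. ennreal (g x)"] by (simp add: d\<pi>)
  also have "ennreal w + ((\<integral>\<^sup>+x. ennreal (g x) \<partial>P) + (\<integral>\<^sup>+x. ennreal (g x) \<partial>Q)) \<le>
      ennreal w + (ennreal ?g + ennreal ?g)"
    by (intro add_left_mono add_mono gint P'(2) Q'(2) qP qQ)
  also have "\<dots> = ennreal (w + 4 * \<delta> * (1 + \<delta>) / \<kappa>)"
    using w0 \<delta> \<kappa> by (simp flip: ennreal_plus)
  also have "\<dots> \<le> ennreal ?r"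
  proof (rule ennreal_leI)
    have "\<kappa> / (1 + \<delta>) * ?s \<le> H + 4 * \<delta>"
      using cost by (simp add: sum_distrib_left mult_ac)
    then have "?s \<le> (1 + \<delta>) * (H + 4 * \<delta>) / \<kappa>"
      using \<kappa> \<delta> by (simp add: field_simps)
    then have "w \<le> (1 + \<delta>) * ((1 + \<delta>) * (H + 4 * \<delta>) / \<kappa>)"
      unfolding w_def using \<delta> by (intro mult_left_mono) auto
    also have "\<dots> + 4 * \<delta> * (1 + \<delta>) / \<kappa> = ?r"
      by (simp add: add_divide_distrib distrib_left mult_ac)
    finally show "w + 4 * \<delta> * (1 + \<delta>) / \<kappa> \<le> ?r" by simp
  qed
  finally show ?thesis using \<pi> by blast
qed

text \<open>As \<open>W2\<close> is an infimum, couplings that are optimal up to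
  \<open>\<delta>\<close> suffice; \<open>\<delta>\<close> runs through
  \<open>1/(n+1)\<close>.\<close>

theorem (in separable_metric) T2_inequality_of_dual:
  assumes P: "P \<in> borel_probs m" and C0: "0 < C0" and dual: "cont_inf_conv_ineq m P (1 / (2 * C0))"
  shows "T2_inequality m C0 P"
  unfolding T2_inequality_def
proof (intro conjI P ballI)
  fix Q assume Q: "Q \<in> borel_probs m"
  show "W2 m P Q \<le> ennreal_sqrt (ennreal (2 * C0) * relative_entropy Q P)"
  proof (cases "absolutely_continuous P Q \<and> integrable Q (entropy_density (exp 1) P Q)")
    case False
    show ?thesis
      unfolding relative_entropy_def if_not_P[OF False] using C0 by (simp add: ennreal_mult_top ennreal_sqrt_def)
  next
    case True
    define H where "H = KL_divergence (exp 1) P Q"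
    interpret E: finite_entropy m P Q "1 / (2 * C0)"
      by standard (use P Q dual True C0 in auto)
    \<comment> \<open>Testing with zero functions yields the nonnegativity of the entropy.\<close>
    have H: "0 \<le> H"
      using E.transport_dual_bound[of "\<lambda>_. 0" "\<lambda>_. 0" 0] C0 by (simp add: H_def)
    define f where "f n = (let \<delta> = inverse (real (Suc n)) in (1 + \<delta>) * ((1 + \<delta>) * (H + 4 * \<delta>) + 4 * \<delta>) / (1 / (2 * C0)))" for n
    have f0: "0 \<le> f n" for n using H C0 by (auto simp: f_def Let_def)
    have W2: "W2 m P Q \<le> ennreal (sqrt (f n))" for n
    proof -
      obtain \<pi> where \<pi>: "\<pi> \<in> couplings P Q" "(\<integral>\<^sup>+(x, y). ennreal ((mdist m x y)\<^sup>2) \<partial>\<pi>) \<le> ennreal (f n)"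
        using E.approx_optimal_coupling[OF separable_metric_axioms, of "inverse (real (Suc n))"]
        by (auto simp: f_def Let_def H_def)
      have "W2 m P Q \<le> ennreal_sqrt (\<integral>\<^sup>+(x, y). ennreal ((mdist m x y)\<^sup>2) \<partial>\<pi>)"
        unfolding W2_def using \<pi>(1) by (rule INF_lower)
      also have "\<dots> \<le> ennreal (sqrt (f n))"
        using \<pi>(2) f0[of n] by (auto simp: ennreal_sqrt_def top_unique intro!: ennreal_leI enn2real_leI)
      finally show ?thesis .
    qed
    have "f \<longlonglongrightarrow> (1 + 0) * ((1 + 0) * (H + 4 * 0) + 4 * 0) / (1 / (2 * C0))"
      unfolding f_def Let_def using C0 by (intro tendsto_intros LIMSEQ_inverse_real_of_nat) auto
    then have "(\<lambda>n. ennreal (sqrt (f n))) \<longlonglongrightarrow> ennreal (sqrt (2 * C0 * H))"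
      by (intro tendsto_ennrealI tendsto_real_sqrt) (simp add: mult_ac)
    then have "W2 m P Q \<le> ennreal (sqrt (2 * C0 * H))"
      by (rule LIMSEQ_le_const) (use W2 in auto)
    also have "\<dots> = ennreal_sqrt (ennreal (2 * C0) * relative_entropy Q P)"
      using True H C0 by (simp add: relative_entropy_def ennreal_sqrt_def H_def[symmetric] flip: ennreal_mult)
    finally show ?thesis .
  qed
qed

section \<open>Projection scheme for reflected Brownian motion\<close>

lemma (in brownian_motion) W_measurable: "0 \<le> t \<Longrightarrow> W t \<in> borel_measurable M"
  by (rule measurable_from_subalg[OF subalgebra_F W_adapted])

lemma (in brownian_motion) inf_conv_ineq_increment:
  assumes A: "transpose A = A" "positive_definite A" and st: "0 \<le> s" "s < t"
  shows "inf_conv_ineq (distr M borel (\<lambda>\<omega>. W t \<omega> - W s \<omega>))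
    (\<lambda>x y. (norm (x - y))\<^sup>2 / (2 * ((t - s) * onorm (\<lambda>x. A *v x))))"
proof -
  define S where "S = (t - s) *\<^sub>R A"
  have SA: "S *v x = (t - s) *\<^sub>R (A *v x)" for x by (simp add: S_def scaleR_matrix_vector_assoc)
  have S: "transpose S = S" "positive_definite S"
    using A st by (auto simp: S_def transpose_scalar positive_definite_def simp flip: scaleR_matrix_vector_assoc)
  have on: "onorm (\<lambda>x. S *v x) = (t - s) * onorm (\<lambda>x. A *v x)"
    unfolding SA using onorm_scaleR[OF matrix_vector_mul_bounded_linear[of A], of "t - s"] st by simp
  note D = W_gaussian[OF st, folded S_def]
  have eq: "distr M borel (\<lambda>\<omega>. W t \<omega> - W s \<omega>) = density lborel (\<lambda>x. ennreal (mvnormal_density S x))"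
    using distributed_distr_eq_density[OF D] by (simp cong: distr_cong)
  have "prob_space (distr M borel (\<lambda>\<omega>. W t \<omega> - W s \<omega>))"
    using st by (intro prob_space_distr borel_measurable_diff W_measurable) auto
  then show ?thesis
    unfolding on[symmetric] eq by (intro inf_conv_ineq_mvnormal S)
qed

text \<open>The first \<open>N\<close> increments are measurable with respect to \<open>F s\<close>
  for \<open>s = real N * h\<close>, and the next one is independent of \<open>F s\<close>. So the
  joint law is a product and the costs add up.\<close>

lemma (in brownian_motion) inf_conv_ineq_increments:
  assumes A: "transpose A = A" "positive_definite A" and h: "0 < h"
  shows "inf_conv_ineq
    (distr M (PiM {..<N} (\<lambda>_. borel)) (\<lambda>\<omega>. \<lambda>k\<in>{..<N}. W (real (Suc k) * h) \<omega> - W (real k * h) \<omega>))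
    (\<lambda>x y. \<Sum>k<N. (norm (x k - y k))\<^sup>2 / (2 * (h * onorm (\<lambda>x. A *v x))))"
proof (induction N)
  case 0
  let ?P = "distr M (PiM {} (\<lambda>_. borel)) (\<lambda>\<omega>. \<lambda>k\<in>{}. W (real (Suc k) * h) \<omega> - W (real k * h) \<omega>)"
  have "inf_conv_ineq ?P (\<lambda>x y. 0)"
  proof (rule inf_conv_ineqI)
    fix \<phi> \<psi> :: "(nat \<Rightarrow> real ^ 'n) \<Rightarrow> real" and K
    assume "\<phi> \<in> borel_measurable ?P" "\<psi> \<in> borel_measurable ?P"
    then have [measurable]: "\<phi> \<in> borel_measurable (PiM {} (\<lambda>_. borel))" "\<psi> \<in> borel_measurable (PiM {} (\<lambda>_. borel))"
      by simp_all
    assume le: "\<And>x y. x \<in> space ?P \<Longrightarrow> y \<in> space ?P \<Longrightarrow> \<psi> x \<le> \<phi> y + 0"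
    have "\<psi> (\<lambda>k. undefined) \<le> \<phi> (\<lambda>k. undefined)" using le by (simp add: space_PiM)
    then show "(\<integral>x. exp (\<psi> x) \<partial>?P) \<le> exp (\<integral>x. \<phi> x \<partial>?P)"
      by (simp add: integral_return space_PiM restrict_def)
  qed
  then show ?case unfolding lessThan_0 sum.empty .
next
  case (Suc N)
  let ?a = "2 * (h * onorm (\<lambda>x. A *v x))"
  define s where "s = real N * h"
  have s: "0 \<le> s" "s < s + h" using h by (auto simp: s_def)
  define \<xi> where "\<xi> = (\<lambda>N \<omega>. \<lambda>k\<in>{..<N}. W (real (Suc k) * h) \<omega> - W (real k * h) \<omega>)"
  let ?B = "\<lambda>N. PiM {..<N} (\<lambda>_. borel :: (real ^ 'n) measure)"
  define Y where "Y = (\<lambda>\<omega>. W (s + h) \<omega> - W s \<omega>)"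
  have Y[measurable]: "Y \<in> borel_measurable M"
    unfolding Y_def using s h by (intro borel_measurable_diff W_measurable) auto
  have \<xi>F: "\<xi> N \<in> measurable (F s) (?B N)"
    unfolding \<xi>_def
  proof (rule measurable_restrict)
    fix k assume "k \<in> {..<N}"
    then have k: "0 \<le> real k * h" "real k * h \<le> s" "0 \<le> real (Suc k) * h" "real (Suc k) * h \<le> s"
      using h unfolding s_def by (auto intro!: mult_right_mono simp del: of_nat_Suc)
    have "W t \<in> borel_measurable (F s)" if "0 \<le> t" "t \<le> s" for t
    proof (rule measurable_from_subalg[OF _ W_adapted[OF that(1)]])
      show "subalgebra (F s) (F t)"
        using that subalgebra_F[of t] subalgebra_F[of s] sets_F_mono[of t s] s by (auto simp: subalgebra_def)
    qed
    with k show "(\<lambda>\<omega>. W (real (Suc k) * h) \<omega> - W (real k * h) \<omega>) \<in> borel_measurable (F s)"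
      by (intro borel_measurable_diff) auto
  qed
  have \<xi>[measurable]: "\<xi> N \<in> measurable M (?B N)"
    by (rule measurable_from_subalg[OF subalgebra_F[OF s(1)] \<xi>F])
  have "distr M (?B N) (\<xi> N) \<Otimes>\<^sub>M distr M borel Y = distr M (?B N \<Otimes>\<^sub>M borel) (\<lambda>\<omega>. (\<xi> N \<omega>, Y \<omega>))"
  proof (rule pair_measure_eqI)
    interpret P: prob_space "distr M (?B N) (\<xi> N)" by (rule prob_space_distr) (rule \<xi>)
    interpret Q: prob_space "distr M borel Y" by (rule prob_space_distr) (rule Y)
    show "sigma_finite_measure (distr M (?B N) (\<xi> N))" "sigma_finite_measure (distr M borel Y)" ..
    fix A B assume "A \<in> sets (distr M (?B N) (\<xi> N))" "B \<in> sets (distr M borel Y)"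
    then have [measurable]: "A \<in> sets (?B N)" "B \<in> sets borel" by simp_all
    have "\<xi> N -` A \<inter> space M \<in> sets (F s)"
      using measurable_sets[OF \<xi>F, of A] subalgebra_F[OF s(1)] by (simp add: subalgebra_def)
    moreover have "Y -` B \<inter> space M \<in> sets (vimage_algebra (space M) Y borel)"
      by (intro in_vimage_algebra) simp
    ultimately have "prob ((\<xi> N -` A \<inter> space M) \<inter> (Y -` B \<inter> space M)) = prob (\<xi> N -` A \<inter> space M) * prob (Y -` B \<inter> space M)"
      using W_indep[OF s] unfolding Y_def[symmetric] by (intro indep_setD)
    moreover have "(\<lambda>\<omega>. (\<xi> N \<omega>, Y \<omega>)) -` (A \<times> B) \<inter> space M = (\<xi> N -` A \<inter> space M) \<inter> (Y -` B \<inter> space M)"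
      by auto
    ultimately show "emeasure (distr M (?B N) (\<xi> N)) A * emeasure (distr M borel Y) B =
      emeasure (distr M (?B N \<Otimes>\<^sub>M borel) (\<lambda>\<omega>. (\<xi> N \<omega>, Y \<omega>))) (A \<times> B)"
      by (simp add: emeasure_distr emeasure_eq_measure ennreal_mult)
  qed simp
  note pair = this[symmetric]
  have "inf_conv_ineq (distr M (?B N) (\<xi> N) \<Otimes>\<^sub>M distr M borel Y)
    (\<lambda>x y. (\<Sum>k<N. (norm (fst x k - fst y k))\<^sup>2 / ?a) +
      (norm (snd x - snd y))\<^sup>2 / ?a)"
  proof (intro inf_conv_ineq_pair prob_space_distr \<xi> Y)
    show "inf_conv_ineq (distr M (?B N) (\<xi> N)) (\<lambda>x y. \<Sum>k<N. (norm (x k - y k))\<^sup>2 / ?a)"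
      unfolding \<xi>_def by (rule Suc)
    show "inf_conv_ineq (distr M borel Y) (\<lambda>x y. (norm (x - y))\<^sup>2 / ?a)"
      unfolding Y_def using inf_conv_ineq_increment[OF A s] by simp
  qed
  then have "inf_conv_ineq (distr (distr M (?B N \<Otimes>\<^sub>M borel) (\<lambda>\<omega>. (\<xi> N \<omega>, Y \<omega>))) (?B (Suc N)) (\<lambda>(f, y). f(N := y)))
    (\<lambda>x y. \<Sum>k<Suc N. (norm (x k - y k))\<^sup>2 / ?a)"
    unfolding pair
  proof (rule inf_conv_ineq_distr)
    show "(\<lambda>(f, y). f(N := y)) \<in> measurable (distr M (?B N) (\<xi> N) \<Otimes>\<^sub>M distr M borel Y) (?B (Suc N))"
      unfolding lessThan_Suc using measurable_add_dim[of N "{..<N}" "\<lambda>_. borel"]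
      by (simp cong: measurable_cong_sets sets_pair_measure_cong)
    show "(\<Sum>k<Suc N. (norm ((case p of (f, y) \<Rightarrow> f(N := y)) k - (case q of (f, y) \<Rightarrow> f(N := y)) k))\<^sup>2 / ?a)
      \<le> (\<Sum>k<N. (norm (fst p k - fst q k))\<^sup>2 / ?a) +
      (norm (snd p - snd q))\<^sup>2 / ?a" for p q :: "(nat \<Rightarrow> real ^ 'n) \<times> (real ^ 'n)"
      by (cases p; cases q) simp
  qed
  also have "distr (distr M (?B N \<Otimes>\<^sub>M borel) (\<lambda>\<omega>. (\<xi> N \<omega>, Y \<omega>))) (?B (Suc N)) (\<lambda>(f, y). f(N := y)) =
    distr M (?B (Suc N)) (\<lambda>\<omega>. (\<xi> N \<omega>)(N := Y \<omega>))"
    unfolding lessThan_Suc using measurable_add_dim[of N "{..<N}" "\<lambda>_. borel :: (real ^ 'n) measure"]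
    by (subst distr_distr) (auto simp: comp_def)
  also have "(\<lambda>\<omega>. (\<xi> N \<omega>)(N := Y \<omega>)) = \<xi> (Suc N)"
    by (auto simp: fun_eq_iff \<xi>_def Y_def s_def algebra_simps)
  finally show ?case by (simp add: \<xi>_def)
qed

section \<open>Pathwise error of the projection scheme\<close>

text \<open>Extending \<open>l\<close> by the constant \<open>l 0\<close> to negative times keeps it
  continuous, so there is no atom at 0 and the closed interval has the same form of mass.\<close>

lemma emeasure_stieltjes:
  assumes "continuous_on {0..} l" "mono_on {0..} l"
  shows "0 \<le> a \<Longrightarrow> a \<le> b \<Longrightarrow> emeasure (stieltjes l) {a<..b} = ennreal (l b - l a)"
    and "0 \<le> b \<Longrightarrow> emeasure (stieltjes l) {0..b} = ennreal (l b - l 0)"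
proof -
  have m: "l (max 0 x) \<le> l (max 0 y)" if "x \<le> y" for x y
    using that by (intro mono_onD[OF assms(2)]) auto
  have c: "continuous_on UNIV (\<lambda>s. l (max 0 s))"
    by (rule continuous_on_compose2[OF assms(1)]) (auto intro!: continuous_intros)
  then have rc: "continuous (at_right a) (\<lambda>s. l (max 0 s))" for a
    by (auto intro: continuous_within_subset simp: continuous_on_eq_continuous_within)
  show "0 \<le> a \<Longrightarrow> a \<le> b \<Longrightarrow> emeasure (stieltjes l) {a<..b} = ennreal (l b - l a)"
    unfolding stieltjes_def using emeasure_interval_measure_Ioc[OF _ m rc, of a b] by simp
  show "0 \<le> b \<Longrightarrow> emeasure (stieltjes l) {0..b} = ennreal (l b - l 0)"
    unfolding stieltjes_def using emeasure_interval_measure_Icc[OF _ m c, of 0 b] by simp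
qed

lemma sets_stieltjes [simp, measurable_cong]: "sets (stieltjes l) = sets borel"
  by (simp add: stieltjes_def)

lemma space_stieltjes [simp]: "space (stieltjes l) = UNIV"
  by (simp add: stieltjes_def)

text \<open>One step of the scheme. The projection moves along an inward normal at the new point and the
  reflection term along inward normals at points of the path, so by convexity both only decrease the
  distance, up to the oscillation of the path during the step.\<close>

lemma projection_step:
  fixes D :: "'a::euclidean_space set"
  assumes D: "convex D" "closed D" and Z: "Z' \<in> D"
    and refl: "(closest_point D (z + x) - Z') \<bullet> \<kappa> \<ge> - r"
    and eq: "Z' = Z + x + \<kappa>"
  shows "(norm (closest_point D (z + x) - Z'))\<^sup>2 \<le> (norm (z - Z))\<^sup>2 + 2 * r"
proof -
  define e where "e = closest_point D (z + x) - Z'"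
  define k where "k = closest_point D (z + x) - (z + x)"
  \<comment> \<open>The displacement \<open>k\<close> of the projection makes an obtuse angle with
    the new error \<open>e\<close>. Expanding \<open>z - Z = e - (k - \<kappa>)\<close> then leaves
    only \<open>e \<bullet> \<kappa>\<close> to be bounded.\<close>
  have "(z + x - closest_point D (z + x)) \<bullet> (Z' - closest_point D (z + x)) \<le> 0"
    by (rule closest_point_dot[OF D Z])
  then have "e \<bullet> k \<le> 0" by (simp add: e_def k_def inner_commute inner_diff_left inner_diff_right algebra_simps)
  moreover have "z - Z = e - (k - \<kappa>)" unfolding e_def k_def eq by simp
  then have "(norm (z - Z))\<^sup>2 = (norm e)\<^sup>2 - 2 * (e \<bullet> k) + 2 * (e \<bullet> \<kappa>) + (norm (k - \<kappa>))\<^sup>2"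
    by (simp only: power2_norm_eq_inner) (simp add: inner_diff_left inner_diff_right inner_commute)
  moreover have "- r \<le> e \<bullet> \<kappa>" using refl by (simp add: e_def)
  ultimately show ?thesis using zero_le_power2[of "norm (k - \<kappa>)"] unfolding e_def[symmetric] by linarith
qed

text \<open>Each step adds at most \<open>2 * w\<close> times the increment of \<open>l\<close>, and
  these increments telescope. So reflection enters only through the total growth of
  \<open>l\<close>.\<close>

lemma projection_scheme_error:
  fixes D :: "(real ^ 'n) set" and Z W n :: "real \<Rightarrow> real ^ 'n" and h w :: real
  assumes D: "convex D" "closed D"
    and l: "continuous_on {0..} l" "mono_on {0..} l"
    and n: "set_borel_measurable borel {0..} n" "\<And>t. 0 \<le> t \<Longrightarrow> norm (n t) = 1"
    and refl: "AE t in stieltjes l. n t \<in> inward_normals D (Z t)"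
    and ZD: "\<And>t. 0 \<le> t \<Longrightarrow> Z t \<in> D"
    and eq: "\<And>t. 0 \<le> t \<Longrightarrow> Z t = x0 + W t + t *\<^sub>R g + (LINT s:{0..t}|stieltjes l. n s)"
    and h: "0 \<le> h" and k: "k \<le> N"
    and osc: "\<And>s t. 0 \<le> s \<Longrightarrow> s \<le> t \<Longrightarrow> t \<le> real N * h \<Longrightarrow> t - s \<le> h \<Longrightarrow> norm (Z t - Z s) \<le> w"
    and z: "z 0 = Z 0" "\<And>k. k < N \<Longrightarrow> z (Suc k) = closest_point D (z k + (W (Suc k * h) - W (k * h) + h *\<^sub>R g))"
  shows "(norm (z k - Z (k * h)))\<^sup>2 \<le> 2 * w * (l (k * h) - l 0)"
  using k
proof (induction k)
  case (Suc k)
  define s t where "s = real k * h" and "t = real (Suc k) * h"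
  have st: "0 \<le> s" "s \<le> t" "0 \<le> t" using h by (auto simp: s_def t_def mult_right_mono)
  have tN: "t \<le> real N * h" using Suc.prems h by (auto simp: t_def intro: mult_right_mono)
  have ts: "t = s + h" by (simp add: s_def t_def algebra_simps)
  let ?S = "stieltjes l"
  \<comment> \<open>Half-open, so that it is disjoint from \<open>{0..s}\<close> and the reflection
    integral splits.\<close>
  define J where "J = {s<..t}"
  have eJ: "emeasure ?S J = ennreal (l t - l s)" unfolding J_def by (rule emeasure_stieltjes(1)[OF l st(1,2)])
  have ls: "l s \<le> l t" using st by (intro mono_onD[OF l(2)]) auto
  have mJ: "measure ?S J = l t - l s" using eJ ls by (simp add: measure_def)
  have meas: "set_borel_measurable ?S A n" if "A \<subseteq> {0..}" "A \<in> sets borel" for A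
  proof -
    have "(\<lambda>x. indicator A x *\<^sub>R (indicator {0..} x *\<^sub>R n x)) \<in> borel_measurable borel"
      using that n(1) by (intro borel_measurable_scaleR[OF _ n(1)[unfolded set_borel_measurable_def]]) auto
    also have "(\<lambda>x. indicator A x *\<^sub>R (indicator {0..} x *\<^sub>R n x)) = (\<lambda>x. indicator A x *\<^sub>R n x)"
      using that(1) by (auto simp: fun_eq_iff indicator_def)
    finally show ?thesis by (simp add: set_borel_measurable_def cong: measurable_cong_sets)
  qed
  have int: "set_integrable ?S A n" if "A \<subseteq> {0..}" "A \<in> sets borel" "emeasure ?S A < \<infinity>" for A
  proof -
    have "integrable ?S (\<lambda>x. indicator A x *\<^sub>R (indicator A x *\<^sub>R n x))"
    proof (rule integrableI_bounded_set_indicator[where B=1])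
      show "(\<lambda>x. indicator A x *\<^sub>R n x) \<in> borel_measurable ?S"
        using meas[OF that(1,2)] by (simp add: set_borel_measurable_def)
      show "AE x in ?S. x \<in> A \<longrightarrow> norm (indicator A x *\<^sub>R n x) \<le> 1"
        using that(1) n(2) by (intro AE_I2) auto
    qed (use that in auto)
    also have "(\<lambda>x. indicator A x *\<^sub>R (indicator A x *\<^sub>R n x)) = (\<lambda>x. indicator A x *\<^sub>R n x)"
      by (auto simp: fun_eq_iff indicator_def)
    finally show ?thesis by (simp add: set_integrable_def)
  qed
  define \<kappa> where "\<kappa> = (LINT s:J|?S. n s)"
  have J: "J \<subseteq> {0..}" "J \<in> sets borel" using st by (auto simp: J_def)
  have intJ: "set_integrable ?S J n" by (rule int[OF J]) (simp add: eJ)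
  have "(LINT s:{0..t}|?S. n s) = (LINT s:{0..s} \<union> J|?S. n s)"
    using st by (intro arg_cong[where f="\<lambda>A. LINT s:A|?S. n s"]) (auto simp: J_def)
  also have "\<dots> = (LINT s:{0..s}|?S. n s) + \<kappa>"
    unfolding \<kappa>_def
    by (rule set_integral_Un[OF _ int intJ]) (auto simp: J_def emeasure_stieltjes(2)[OF l st(1)])
  finally have Zt: "Z t = Z s + (W t - W s + h *\<^sub>R g) + \<kappa>"
    using eq[OF st(1)] eq[OF st(3)] by (simp add: ts scaleR_add_left)
  define y where "y = closest_point D (z k + (W t - W s + h *\<^sub>R g))"
  have yD: "y \<in> D" unfolding y_def using D(2) ZD[of 0] by (intro closest_point_in_set) auto
  have "- (w * (l t - l s)) \<le> (y - Z t) \<bullet> \<kappa>"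
  proof -
    \<comment> \<open>The normal \<open>n x\<close> is inward at \<open>Z x\<close>, so its product
      with \<open>y - Z x\<close> is nonnegative; replacing \<open>Z x\<close> by \<open>Z t\<close>
      costs at most \<open>w\<close>.\<close>
    have "(LINT s:J|?S. - w) \<le> (LINT s:J|?S. (y - Z t) \<bullet> n s)"
      unfolding set_lebesgue_integral_def
    proof (rule integral_mono_AE)
      show "integrable ?S (\<lambda>x. indicator J x *\<^sub>R (- w))"
        using J(2) eJ by (simp add: integrable_indicator_iff)
      show "integrable ?S (\<lambda>x. indicator J x *\<^sub>R ((y - Z t) \<bullet> n x))"
        using integrable_inner_right[OF intJ[unfolded set_integrable_def], of "y - Z t"] by simp
      show "AE x in ?S. indicator J x *\<^sub>R (- w) \<le> indicator J x *\<^sub>R ((y - Z t) \<bullet> n x)"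
        using refl
      proof eventually_elim
        case (elim x)
        show ?case
        proof (cases "x \<in> J")
          case True
          then have x: "s < x" "x \<le> t" "0 \<le> x" using st by (auto simp: J_def)
          have "0 \<le> (y - Z x) \<bullet> n x" using elim yD by (simp add: inward_normals_def)
          moreover have "\<bar>(Z t - Z x) \<bullet> n x\<bar> \<le> norm (Z t - Z x)"
            using Cauchy_Schwarz_ineq2[of "Z t - Z x" "n x"] n(2)[OF x(3)] by simp
          moreover have "norm (Z t - Z x) \<le> w"
            using x tN ts by (intro osc) auto
          moreover have "(y - Z t) \<bullet> n x = (y - Z x) \<bullet> n x - (Z t - Z x) \<bullet> n x"
            by (simp add: inner_diff_left)
          ultimately have "- w \<le> (y - Z t) \<bullet> n x" by linarith
          then show ?thesis using True by simp
        qed simp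
      qed
    qed
    also have "(LINT s:J|?S. (y - Z t) \<bullet> n s) = (y - Z t) \<bullet> \<kappa>"
      using integral_inner_right[OF intJ[unfolded set_integrable_def], of "y - Z t"]
      by (simp add: \<kappa>_def set_lebesgue_integral_def)
    also have "(LINT s:J|?S. - w) = - (w * (l t - l s))"
      using J(2) by (simp add: set_lebesgue_integral_def mJ)
    finally show ?thesis .
  qed
  then have "(norm (y - Z t))\<^sup>2 \<le> (norm (z k - Z s))\<^sup>2 + 2 * (w * (l t - l s))"
    unfolding y_def by (intro projection_step[OF D ZD[OF st(3)] _ Zt]) auto
  also have "(norm (z k - Z s))\<^sup>2 \<le> 2 * w * (l s - l 0)"
    using Suc by (simp add: s_def)
  finally have "(norm (y - Z t))\<^sup>2 \<le> 2 * w * (l t - l 0)" by (simp add: algebra_simps)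
  moreover have "z (Suc k) = y"
    using z(2)[of k] Suc.prems by (simp add: y_def s_def t_def)
  ultimately show ?case by (simp only: t_def)
qed (simp add: z)

section \<open>The scheme as a function of the increments\<close>

text \<open>The projected Euler scheme, a discrete Skorokhod map: \<open>x k\<close> is the Brownian
  increment and \<open>v\<close> the drift of one step.\<close>

primrec projection_scheme :: "'a::euclidean_space set \<Rightarrow> 'a \<Rightarrow> 'a \<Rightarrow> (nat \<Rightarrow> 'a) \<Rightarrow> nat \<Rightarrow> 'a" where
  "projection_scheme D z v x 0 = z"
| "projection_scheme D z v x (Suc k) = closest_point D (projection_scheme D z v x k + (x k + v))"

lemma projection_scheme_lipschitz:
  assumes D: "convex D" "closed D" "D \<noteq> {}"
  shows "dist (projection_scheme D z v x k) (projection_scheme D z v y k) \<le> (\<Sum>i<k. norm (x i - y i))"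
proof (induction k)
  case (Suc k)
  have "dist (projection_scheme D z v x (Suc k)) (projection_scheme D z v y (Suc k))
    \<le> norm ((projection_scheme D z v x k - projection_scheme D z v y k) + (x k - y k))"
    using closest_point_lipschitz[OF D, of "projection_scheme D z v x k + (x k + v)" "projection_scheme D z v y k + (y k + v)"]
    by (simp add: dist_norm algebra_simps)
  also have "\<dots> \<le> dist (projection_scheme D z v x k) (projection_scheme D z v y k) + norm (x k - y k)"
    unfolding dist_norm by (rule norm_triangle_ineq)
  finally show ?case using Suc by simp
qed simp

lemma projection_scheme_measurable:
  assumes D: "convex D" "closed D" "D \<noteq> {}" and "k \<le> N"
  shows "(\<lambda>x. projection_scheme D z v x k) \<in> borel_measurable (PiM {..<N} (\<lambda>_. borel))"
  using \<open>k \<le> N\<close>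
proof (induction k)
  case (Suc k)
  have [measurable]: "closest_point D \<in> borel_measurable borel"
    by (intro borel_measurable_continuous_onI continuous_on_closest_point D)
  have [measurable]: "(\<lambda>x. projection_scheme D z v x k) \<in> borel_measurable (PiM {..<N} (\<lambda>_. borel))"
    "(\<lambda>x. x k) \<in> borel_measurable (PiM {..<N} (\<lambda>_. borel))"
    using Suc by (auto intro: measurable_component_singleton)
  show ?case by simp
qed simp

text \<open>Pathwise, on the almost sure event where all properties hold, the error has two parts:
  that of the scheme at the nodes, which the Bernstein operator does not increase, and that of the
  Bernstein path of \<open>Z\<close> itself.\<close>

lemma (in reflected_brownian_motion) projection_scheme_tendsto:
  assumes D: "is_domain D" "convex D" and T: "0 < T" and z0: "z0 \<in> D"
  shows "AE \<omega> in M. (\<lambda>N. mdist (path_space T) (bernstein_path T N (projection_scheme D z0 ((T / real N) *\<^sub>R g)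
    (\<lambda>k\<in>{..<N}. W (real (Suc k) * (T / real N)) \<omega> - W (real k * (T / real N)) \<omega>)))
    (restrict (\<lambda>t. Z t \<omega>) {0..T})) \<longlonglongrightarrow> 0"
  using W_start l_continuous l_nondecreasing n_measurable n_unit reflection equation AE_space
proof eventually_elim
  case (elim \<omega>)
  define x where "x = restrict (\<lambda>t. Z t \<omega>) {0..T}"
  define z where "z N = projection_scheme D z0 ((T / real N) *\<^sub>R g)
    (\<lambda>k\<in>{..<N}. W (real (Suc k) * (T / real N)) \<omega> - W (real k * (T / real N)) \<omega>)" for N
  have closed: "closed D" using D(1) by (auto simp: is_domain_def)
  have cZ: "continuous_on {0..} (\<lambda>t. Z t \<omega>)" using elim Z_continuous by blast
  have cZT: "continuous_on {0..T} (\<lambda>t. Z t \<omega>)" by (rule continuous_on_subset[OF cZ]) auto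
  have x: "x \<in> mspace (path_space T)"
    unfolding x_def path_space_iff using cZT by (auto intro: continuous_on_eq)
  \<comment> \<open>The equation at time 0 contains the integral over \<open>{0..0}\<close>, which
    vanishes because the measure of \<open>l\<close> has no atom there.\<close>
  have Z0: "Z 0 \<omega> = z0"
  proof -
    have "emeasure (stieltjes (\<lambda>s. l s \<omega>)) {0..0} = 0"
      using elim by (subst emeasure_stieltjes(2)) auto
    then have "AE s in stieltjes (\<lambda>s. l s \<omega>). s \<notin> {0}"
      by (intro AE_not_in null_setsI) auto
    then have "(LINT s:{0..0}|stieltjes (\<lambda>s. l s \<omega>). n s \<omega>) = 0"
      unfolding set_lebesgue_integral_def by (intro integral_eq_zero_AE) (auto elim: eventually_mono)
    then show ?thesis using elim by simp
  qed
  have grid: "dist (z N k) (x (real k * (T / real N))) \<le> sqrt (2 * w * (l T \<omega> - l 0 \<omega>))"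
    if N: "0 < N" "k \<le> N" and w: "0 \<le> w"
      and osc: "\<And>s t. 0 \<le> s \<Longrightarrow> s \<le> t \<Longrightarrow> t \<le> T \<Longrightarrow> t - s \<le> T / real N \<Longrightarrow> norm (Z t \<omega> - Z s \<omega>) \<le> w"
    for N k w
  proof -
    define h where "h = T / real N"
    have h: "0 \<le> h" "real N * h = T" using T N by (auto simp: h_def)
    have kh: "0 \<le> real k * h" "real k * h \<le> T" using h N mult_right_mono[of "real k" "real N" h] by auto
    have "(norm (z N k - Z (real k * h) \<omega>))\<^sup>2 \<le> 2 * w * (l (real k * h) \<omega> - l 0 \<omega>)"
    proof (rule projection_scheme_error[where D=D and Z="\<lambda>t. Z t \<omega>" and W="\<lambda>t. W t \<omega>" and n="\<lambda>t. n t \<omega>"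
          and l="\<lambda>t. l t \<omega>" and ?x0.0=z0 and g=g and N=N])
      show "z N (Suc k) = closest_point D (z N k + (W (real (Suc k) * h) \<omega> - W (real k * h) \<omega> + h *\<^sub>R g))" if "k < N" for k
        using that by (simp add: z_def h_def)
      show "AE t in stieltjes (\<lambda>t. l t \<omega>). n t \<omega> \<in> inward_normals D (Z t \<omega>)"
        using elim by (auto elim: eventually_mono)
      show "Z t \<omega> \<in> D" if "0 \<le> t" for t using Z_in_D elim(8) that by blast
      show "Z t \<omega> = z0 + W t \<omega> + t *\<^sub>R g + (LINT s:{0..t}|stieltjes (\<lambda>t. l t \<omega>). n s \<omega>)"
        if "0 \<le> t" for t using elim(7) that by blast
      show "norm (Z t \<omega> - Z s \<omega>) \<le> w" if "0 \<le> s" "s \<le> t" "t \<le> real N * h" "t - s \<le> h" for s t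
        using osc[OF that(1,2)] that(3,4) h(2) by (simp add: h_def[symmetric])
      show "z N 0 = Z 0 \<omega>" by (simp add: z_def Z0)
    qed (use D(2) closed elim(2-5) h(1) N in auto)
    also have "\<dots> \<le> 2 * w * (l T \<omega> - l 0 \<omega>)"
      using w kh T elim by (intro mult_left_mono diff_right_mono mono_onD[of "{0..}" "\<lambda>t. l t \<omega>"]) auto
    finally show ?thesis using kh by (simp add: x_def h_def dist_norm real_le_rsqrt)
  qed
  have lT: "0 \<le> l T \<omega> - l 0 \<omega>"
    using elim T by (auto intro: mono_onD[of "{0..}" "\<lambda>t. l t \<omega>"])
  interpret Metric_space "mspace (path_space T) :: (real \<Rightarrow> real ^ 'n) set" "mdist (path_space T)" by (rule Metric_space_mspace_mdist)
  let ?d = "mdist (path_space T)" and ?Z = "\<lambda>N. bernstein_path T N (z N)" and ?B = "\<lambda>N. bernstein_path T N (\<lambda>k. x (real k * (T / real N)))"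
  have "(\<lambda>N. ?d (?Z N) x) \<longlonglongrightarrow> 0"
  proof (rule LIMSEQ_I)
    fix e :: real assume e: "0 < e"
    \<comment> \<open>Chosen so that the bound on the nodes is at most \<open>e/2\<close>; the
      summand 1 covers paths on which \<open>l\<close> does not grow.\<close>
    define w where "w = (e / 2)\<^sup>2 / (2 * (l T \<omega> - l 0 \<omega>) + 1)"
    have w: "0 < w" using e lT by (simp add: w_def add_nonneg_pos)
    have "2 * w * (l T \<omega> - l 0 \<omega>) \<le> w * (2 * (l T \<omega> - l 0 \<omega>) + 1)" using w by (simp add: algebra_simps)
    also have "\<dots> = (e / 2)\<^sup>2" using lT by (simp add: w_def add_nonneg_eq_0_iff)
    finally have we: "sqrt (2 * w * (l T \<omega> - l 0 \<omega>)) \<le> e / 2" using e by (intro real_le_lsqrt) auto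
    have "uniformly_continuous_on {0..T} (\<lambda>t. Z t \<omega>)"
      using cZT by (rule compact_uniformly_continuous) simp
    then obtain d where d: "0 < d" "\<And>s t. s \<in> {0..T} \<Longrightarrow> t \<in> {0..T} \<Longrightarrow> dist t s < d \<Longrightarrow> dist (Z t \<omega>) (Z s \<omega>) < w"
      unfolding uniformly_continuous_on_def using w by metis
    obtain N1 where N1: "T / d < real N1" using reals_Archimedean2 by blast
    obtain N2 where N2: "\<And>N. N2 \<le> N \<Longrightarrow> ?d (?B N) x < e / 2"
      using LIMSEQ_D[OF bernstein_path_tendsto[OF T x], of "e / 2"] e by auto
    show "\<exists>no. \<forall>N\<ge>no. norm (?d (?Z N) x - 0) < e"
    proof (intro exI allI impI)
      fix N assume N: "max (Suc N1) N2 \<le> N"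
      have N0: "0 < N" and "real N1 < real N" using N by auto
      then have "T / d < real N" using N1 by linarith
      then have Td: "T / real N < d" using d T N0 by (simp add: field_simps)
      have "dist (z N k) (x (real k * (T / real N))) \<le> e / 2" if "k \<le> N" for k
      proof (rule order_trans[OF grid[OF N0 that less_imp_le[OF w]] we])
        show "norm (Z t \<omega> - Z s \<omega>) \<le> w" if "0 \<le> s" "s \<le> t" "t \<le> T" "t - s \<le> T / real N" for s t
          using d(2)[of s t] that Td by (auto simp: dist_norm)
      qed
      then have "?d (?Z N) (?B N) \<le> e / 2"
        by (rule mdist_bernstein_path_le[OF T])
      moreover have "?d (?Z N) x \<le>
          ?d (?Z N) (?B N) +
          ?d (?B N) x"
        by (intro triangle bernstein_path_mspace T x)
      ultimately show "norm (?d (?Z N) x - 0) < e"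
        using N2[of N] N by simp
    qed
  qed
  then show ?case by (simp add: z_def x_def)
qed

section \<open>Passage to the law of the reflected process\<close>

lemma (in reflected_brownian_motion) measurable_path:
  assumes T: "0 < T"
  shows "(\<lambda>\<omega>. restrict (\<lambda>t. Z t \<omega>) {0..T}) \<in> measurable M (mborel (path_space T))"
proof (rule measurable_path_spaceI[OF T])
  show "(\<lambda>\<omega>. restrict (\<lambda>t. Z t \<omega>) {0..T}) \<in> space M \<rightarrow> mspace (path_space T)"
  proof
    fix \<omega> assume "\<omega> \<in> space M"
    then have "continuous_on {0..T} (\<lambda>t. Z t \<omega>)"
      by (intro continuous_on_subset[OF Z_continuous]) auto
    then show "restrict (\<lambda>t. Z t \<omega>) {0..T} \<in> mspace (path_space T)"
      unfolding path_space_iff by (auto intro: continuous_on_eq)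
  qed
  show "(\<lambda>\<omega>. restrict (\<lambda>t. Z t \<omega>) {0..T} t) \<in> borel_measurable M" if "t \<in> {0..T}" for t
    using that measurable_from_subalg[OF subalgebra_F Z_adapted, of t] by simp
qed

text \<open>The paths of the scheme are Lipschitz in the Euclidean norm of the increments, with a constant
  that does not depend on the mesh; so the inequality for Gaussian vectors passes to the limit.\<close>

lemma (in reflected_brownian_motion) path_law_inf_conv:
  assumes D: "is_domain D" "convex D" and T: "0 < T" and z0: "z0 \<in> D"
    and A: "transpose A = A" "positive_definite A"
  shows "cont_inf_conv_ineq (path_space T) (path_law M T Z) (1 / (2 * (T * onorm (\<lambda>x. A *v x))))"
proof (rule cont_inf_conv_ineqI)
  fix \<phi> \<psi> :: "(real \<Rightarrow> real ^ 'n) \<Rightarrow> real" and K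
  assume cont: "mcontinuous (path_space T) \<phi>" "mcontinuous (path_space T) \<psi>"
    and bd: "\<And>x. x \<in> mspace (path_space T) \<Longrightarrow> \<bar>\<phi> x\<bar> \<le> K" "\<And>x. x \<in> mspace (path_space T) \<Longrightarrow> \<bar>\<psi> x\<bar> \<le> K"
    and le: "\<And>x y. x \<in> mspace (path_space T) \<Longrightarrow> y \<in> mspace (path_space T) \<Longrightarrow>
       \<psi> x \<le> \<phi> y + 1 / (2 * (T * onorm (\<lambda>x. A *v x))) * (mdist (path_space T) x y)\<^sup>2"
  note [measurable] = mcontinuous_measurable[OF cont(1)] mcontinuous_measurable[OF cont(2)]
  define a where "a = onorm (\<lambda>x. A *v x)"
  have a: "0 < a" unfolding a_def by (rule onorm_positive_definite[OF A(2)])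
  have D': "convex D" "closed D" "D \<noteq> {}" using D z0 by (auto simp: is_domain_def)
  let ?M = "\<lambda>N. PiM {..<N} (\<lambda>_. borel :: (real ^ 'n) measure)" and ?C = "mborel (path_space T)"
    and ?S = "\<lambda>N. projection_scheme D z0 ((T / real N) *\<^sub>R g)"
  define \<xi> where "\<xi> N \<omega> = (\<lambda>k\<in>{..<N}. W (real (Suc k) * (T / real N)) \<omega> - W (real k * (T / real N)) \<omega>)" for N \<omega>
  have \<xi>[measurable]: "\<xi> N \<in> measurable M (?M N)" for N
    unfolding \<xi>_def using T by (intro measurable_restrict borel_measurable_diff W_measurable) auto
  define \<Gamma> where "\<Gamma> N x = bernstein_path T N (?S N x)" for N x
  have \<Gamma>[measurable]: "\<Gamma> N \<in> measurable (?M N) (?C)" for N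
  proof (rule measurable_path_spaceI[OF T])
    show "\<Gamma> N \<in> space (?M N) \<rightarrow> mspace (path_space T)"
      unfolding \<Gamma>_def using bernstein_path_mspace[OF T] by auto
    fix t assume t: "t \<in> {0..T}"
    have "(\<lambda>x. \<Sum>k\<le>N. Bernstein N k (t / T) *\<^sub>R ?S N x k)
      \<in> borel_measurable (?M N)"
      by (intro borel_measurable_sum borel_measurable_scaleR projection_scheme_measurable D') auto
    then show "(\<lambda>x. \<Gamma> N x t) \<in> borel_measurable (?M N)"
      using t by (simp add: \<Gamma>_def bernstein_path_def)
  qed
  let ?G = "\<lambda>N \<omega>. \<Gamma> N (\<xi> N \<omega>)"
  have approx: "(\<integral>\<omega>. exp (\<psi> (?G N \<omega>)) \<partial>M) \<le> exp (\<integral>\<omega>. \<phi> (?G N \<omega>) \<partial>M)" if N: "0 < N" for N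
  proof -
    have "inf_conv_ineq (distr M (?M N) (\<xi> N))
        (\<lambda>x y. \<Sum>k<N. (norm (x k - y k))\<^sup>2 / (2 * ((T / real N) * a)))"
      unfolding \<xi>_def a_def using T N by (intro inf_conv_ineq_increments A) auto
    then have "inf_conv_ineq (distr (distr M (?M N) (\<xi> N)) (?C) (\<Gamma> N))
        (\<lambda>x y. (mdist (path_space T) x y)\<^sup>2 / (2 * (T * a)))"
    proof (rule inf_conv_ineq_distr)
      fix x y :: "nat \<Rightarrow> real ^ 'n"
      define r where "r = (\<Sum>i<N. norm (x i - y i))"
      have "mdist (path_space T) (\<Gamma> N x) (\<Gamma> N y) \<le> r"
        unfolding \<Gamma>_def
      proof (rule mdist_bernstein_path_le[OF T])
        fix k assume "k \<le> N"
        then have "(\<Sum>i<k. norm (x i - y i)) \<le> r" unfolding r_def by (intro sum_mono2) auto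
        then show "dist (?S N x k)
           (?S N y k) \<le> r"
          using projection_scheme_lipschitz[OF D', of z0 "(T / real N) *\<^sub>R g" x k y] by linarith
      qed
      then have "(mdist (path_space T) (\<Gamma> N x) (\<Gamma> N y))\<^sup>2 \<le> r\<^sup>2" by (intro power_mono) auto
      also have "\<dots> \<le> real N * (\<Sum>k<N. (norm (x k - y k))\<^sup>2)"
        using Cauchy_Schwarz_ineq_sum[of "\<lambda>_. 1" "\<lambda>i. norm (x i - y i)" "{..<N}"] by (simp add: r_def)
      finally have "(mdist (path_space T) (\<Gamma> N x) (\<Gamma> N y))\<^sup>2 / (2 * (T * a)) \<le>
          (real N * (\<Sum>k<N. (norm (x k - y k))\<^sup>2)) / (2 * (T * a))"
        using T a by (intro divide_right_mono) auto
      also have "\<dots> = (\<Sum>k<N. (norm (x k - y k))\<^sup>2 / (2 * ((T / real N) * a)))"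
        unfolding sum_distrib_left sum_divide_distrib
        using N T a by (intro sum.cong) (auto simp: field_simps)
      finally show "(mdist (path_space T) (\<Gamma> N x) (\<Gamma> N y))\<^sup>2 / (2 * (T * a)) \<le>
        (\<Sum>k<N. (norm (x k - y k))\<^sup>2 / (2 * ((T / real N) * a)))" .
    qed simp
    from inf_conv_ineqD[OF this, of \<phi> \<psi> K] bd le show ?thesis
      by (simp add: integral_distr a_def)
  qed
  define X where "X \<omega> = restrict (\<lambda>t. Z t \<omega>) {0..T}" for \<omega>
  have X[measurable]: "X \<in> measurable M (?C)"
    unfolding X_def by (rule measurable_path[OF T])
  have Xin: "X \<omega> \<in> mspace (path_space T)" if "\<omega> \<in> space M" for \<omega>
    using measurable_space[OF X that] by simp
  have \<Gamma>in: "\<Gamma> N x \<in> mspace (path_space T)" for N x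
    unfolding \<Gamma>_def by (rule bernstein_path_mspace[OF T])
  have lim: "AE \<omega> in M. (\<lambda>N. f (?G N \<omega>)) \<longlonglongrightarrow> f (X \<omega>)" if "mcontinuous (path_space T) f" for f
    using projection_scheme_tendsto[OF D T z0] AE_space
  proof eventually_elim
    case (elim \<omega>)
    have "(\<lambda>N. mdist (path_space T) (?G N \<omega>) (X \<omega>)) \<longlonglongrightarrow> 0"
      unfolding \<Gamma>_def \<xi>_def X_def by (rule elim(1))
    then show ?case by (intro mcontinuous_tendsto[OF that \<Gamma>in Xin[OF elim(2)]])
  qed
  have "(\<integral>\<omega>. exp (\<psi> (X \<omega>)) \<partial>M) \<le> exp (\<integral>\<omega>. \<phi> (X \<omega>) \<partial>M)"
  proof (rule LIMSEQ_le)
    show "(\<lambda>N. \<integral>\<omega>. exp (\<psi> (?G N \<omega>)) \<partial>M) \<longlonglongrightarrow> (\<integral>\<omega>. exp (\<psi> (X \<omega>)) \<partial>M)"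
    proof (rule integral_dominated_convergence[where w="\<lambda>_. exp K"])
      show "AE \<omega> in M. (\<lambda>N. exp (\<psi> (?G N \<omega>))) \<longlonglongrightarrow> exp (\<psi> (X \<omega>))"
        using lim[OF cont(2)] by eventually_elim (rule tendsto_exp)
      show "AE \<omega> in M. norm (exp (\<psi> (?G N \<omega>))) \<le> exp K" for N
        using bd(2)[OF \<Gamma>in] by (intro AE_I2) (auto simp: abs_le_iff)
    qed auto
    show "(\<lambda>N. exp (\<integral>\<omega>. \<phi> (?G N \<omega>) \<partial>M)) \<longlonglongrightarrow> exp (\<integral>\<omega>. \<phi> (X \<omega>) \<partial>M)"
    proof (rule tendsto_exp, rule integral_dominated_convergence[where w="\<lambda>_. K"])
      show "AE \<omega> in M. norm (\<phi> (?G N \<omega>)) \<le> K" for N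
        using bd(1)[OF \<Gamma>in] by (intro AE_I2) auto
    qed (use lim[OF cont(1)] in auto)
    show "\<exists>N. \<forall>n\<ge>N. (\<integral>\<omega>. exp (\<psi> (?G n \<omega>)) \<partial>M) \<le> exp (\<integral>\<omega>. \<phi> (?G n \<omega>) \<partial>M)"
      using approx by (intro exI[of _ 1]) auto
  qed
  then show "(\<integral>x. exp (\<psi> x) \<partial>path_law M T Z) \<le> exp (\<integral>x. \<phi> x \<partial>path_law M T Z)"
    unfolding path_law_def X_def[symmetric] by (simp add: integral_distr)
qed

theorem corollary1p3:
  fixes D :: "(real ^ 'n) set" and A :: "real ^ 'n ^ 'n" and g z0 :: "real ^ 'n" and T :: real
    and M :: "'w measure" and F :: "real \<Rightarrow> 'w measure"
    and W Z n :: "real \<Rightarrow> 'w \<Rightarrow> real ^ 'n" and l :: "real \<Rightarrow> 'w \<Rightarrow> real"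
  assumes "CARD('n) \<ge> 2"
    and "is_domain D" and "convex D"
    and "T > 0"
    and "transpose A = A" and "positive_definite A"
    and "z0 \<in> D"
    and "reflected_brownian_motion M F A W D g z0 Z n l"
  shows "T2_inequality (path_space T) (T * onorm (\<lambda>x. A *v x)) (path_law M T Z)"
proof -
  interpret reflected_brownian_motion M F A W D g z0 Z n l by fact
  obtain C :: "(real \<Rightarrow> real ^ 'n) set" where "separable_metric (path_space T) C"
    by (rule separable_path_space[OF \<open>T > 0\<close>])
  then interpret separable_metric "path_space T" C .
  show ?thesis
  proof (rule T2_inequality_of_dual)
    show "path_law M T Z \<in> borel_probs (path_space T)"
      unfolding borel_probs_def path_law_def
      using prob_space_distr[OF measurable_path[OF \<open>T > 0\<close>]] by simp
    show "0 < T * onorm (\<lambda>x. A *v x)"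
      using assms onorm_positive_definite[of A] by simp
    show "cont_inf_conv_ineq (path_space T) (path_law M T Z) (1 / (2 * (T * onorm (\<lambda>x. A *v x))))"
      using assms by (intro path_law_inf_conv) auto
  qed
qed

end
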